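(* Let $P\subset\mathbb{R}^2$ be a rational polygon (all vertices have rational coordinates) whose edges fall into exactly $k$ distinct classes of parallel edges (i.e. the edges of $P$ have exactly $k$ distinct directions). Then there exists an odd cover $\mathcal{F}=\{P+z\}_{z\in Z}$ of $\mathbb{R}^2$ by translates of $P$, of uniformly bounded degree, with density $\rho(\mathcal{F})\le A_{\rm INT}(P)\cdot 2^{k-1}$. Consequently, $\alpha^\circ(P)\ge A_{\rm INT}(P)^{-1}\cdot 2^{-(k-1)}$.
   Context: All covering statements are up to sets of Lebesgue measure $0$. $A(X)$ denotes the area of $X$. For a rational polygon $P$, $P_{\rm INT}$ is an integer polygon (all vertices in $\mathbb{Z}^2$) of minimal area among integer polygons affinely equivalent to $P$ (images of $P$ under non-singular affine maps), and $A_{\rm INT}(P)=A(P_{\rm INT})$. For a compact set $X$ and a discrete set $Z\subseteq\mathbb{R}^2$ (translates with multiplicity allowed), the family $\mathcal{F}=\{X+z\}_{z\in Z}$ has uniformly bounded degree if there is a constant $d$ such that every point of $\mathbb{R}^2$ lies in at most $d$ members of $\mathcal{F}$. Such an $\mathcal{F}$ is an odd cover of $\mathbb{R}^2$ if almost every point of $\mathbb{R}^2$ lies in an odd number of members of $\mathcal{F}$. Its density is $\rho(\mathcal{F})=\liminf_{n\to\infty} n^{-2}\sum_{z\in Z}A(Q_n\cap(X+z))$, where $Q_n$ is the $n\times n$ axis-parallel square centered at the origin. For a compact $X$ with $0<A(X)<\infty$, the odd area $A_{odd}(X)$ is the infimum, over all finite sets $K\subset\mathbb{R}^2$ of odd cardinality,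 of the area of the set of points lying in an odd number of the translates $X+k$, $k\in K$; the odd compression ratio is $\alpha^\circ(X)=A_{odd}(X)/A(X)$. *)

theory Defs
  imports "HOL-Analysis.Analysis"
begin

abbreviation area :: "(real^2) set \<Rightarrow> real" where
  "area X \<equiv> measure lebesgue X"

abbreviation translate :: "(real^2) set \<Rightarrow> real^2 \<Rightarrow> (real^2) set" where
  "translate X z \<equiv> (\<lambda>x. x + z) ` X"

fun polygonal_path :: "(real^2) list \<Rightarrow> real \<Rightarrow> real^2" where
  "polygonal_path [] = linepath 0 0"
| "polygonal_path [a] = linepath a a"
| "polygonal_path [a, b] = linepath a b"
| "polygonal_path (a # b # c # vs) = linepath a b +++ polygonal_path (b # c # vs)"

definition polygon_boundary :: "(real^2) list \<Rightarrow> real \<Rightarrow> real^2" where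
  "polygon_boundary vs = polygonal_path (vs @ [hd vs])"

text \<open>A polygon is the compact region bounded by a simple closed polygonal curve. The list
  gives its vertices in cyclic order. Straight angles are excluded, so the region
  determines its vertex list up to rotation and reversal, and with it its edges.\<close>

definition polygon_with_vertices :: "(real^2) list \<Rightarrow> (real^2) set \<Rightarrow> bool" where
  "polygon_with_vertices vs P \<longleftrightarrow>
     3 \<le> length vs \<and>
     simple_path (polygon_boundary vs) \<and>
     (\<forall>i < length vs. \<not> collinear {vs ! i, vs ! ((i + 1) mod length vs),
                                   vs ! ((i + 2) mod length vs)}) \<and>
     P = path_image (polygon_boundary vs) \<union> inside (path_image (polygon_boundary vs))"

definition polygon_edges :: "(real^2) list \<Rightarrow> ((real^2) \<times> (real^2)) set" where
  "polygon_edges vs = set (zip vs (rotate1 vs))"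

text \<open>The direction of an edge is the line through the origin parallel to it, so the
  directions correspond to the classes of parallel edges.\<close>

definition edge_directions :: "(real^2) list \<Rightarrow> (real^2) set set" where
  "edge_directions vs = (\<lambda>(a, b). span {b - a}) ` polygon_edges vs"

definition rational_polygon :: "(real^2) list \<Rightarrow> (real^2) set \<Rightarrow> bool" where
  "rational_polygon vs P \<longleftrightarrow> polygon_with_vertices vs P \<and> (\<forall>v \<in> set vs. \<forall>i. v $ i \<in> \<rat>)"

definition integer_polygon :: "(real^2) set \<Rightarrow> bool" where
  "integer_polygon P \<longleftrightarrow>
     (\<exists>vs. polygon_with_vertices vs P \<and> (\<forall>v \<in> set vs. \<forall>i. v $ i \<in> \<int>))"

definition affinely_equivalent :: "(real^2) set \<Rightarrow> (real^2) set \<Rightarrow> bool" where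
  "affinely_equivalent P Q \<longleftrightarrow>
     (\<exists>(f :: real^2 \<Rightarrow> real^2) c. linear f \<and> bij f \<and> Q = (\<lambda>x. f x + c) ` P)"

definition P_INT :: "(real^2) set \<Rightarrow> (real^2) set" where
  "P_INT P = arg_min area (\<lambda>Q. integer_polygon Q \<and> affinely_equivalent P Q)"

definition A_INT :: "(real^2) set \<Rightarrow> real" where
  "A_INT P = area (P_INT P)"

text \<open>A family of translates of a set is given by a multiplicity function \<open>Z\<close>, where
  \<open>Z z\<close> is the number of copies of the translate by \<open>z\<close>. The copies are indexed by the
  pairs \<open>(z, i)\<close> with \<open>i < Z z\<close>.\<close>

definition family_index :: "(real^2 \<Rightarrow> nat) \<Rightarrow> ((real^2) \<times> nat) set" where
  "family_index Z = {(z, i). i < Z z}"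

definition members_at :: "(real^2) set \<Rightarrow> (real^2 \<Rightarrow> nat) \<Rightarrow> real^2 \<Rightarrow> ((real^2) \<times> nat) set" where
  "members_at X Z x = {(z, i) \<in> family_index Z. x \<in> translate X z}"

definition uniformly_bounded_degree :: "(real^2) set \<Rightarrow> (real^2 \<Rightarrow> nat) \<Rightarrow> bool" where
  "uniformly_bounded_degree X Z \<longleftrightarrow>
     (\<exists>d. \<forall>x. finite (members_at X Z x) \<and> card (members_at X Z x) \<le> d)"

definition odd_cover :: "(real^2) set \<Rightarrow> (real^2 \<Rightarrow> nat) \<Rightarrow> bool" where
  "odd_cover X Z \<longleftrightarrow>
     discrete {z. 0 < Z z} \<and>
     uniformly_bounded_degree X Z \<and>
     (AE x in lebesgue. odd (card (members_at X Z x)))"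

definition centered_square :: "nat \<Rightarrow> (real^2) set" where
  "centered_square n = cbox (\<chi> i. - real n / 2) (\<chi> i. real n / 2)"

text \<open>Density takes values in \<open>ennreal\<close>, where the infinite sum of areas always exists.\<close>

definition cover_density :: "(real^2) set \<Rightarrow> (real^2 \<Rightarrow> nat) \<Rightarrow> ennreal" where
  "cover_density X Z =
     liminf (\<lambda>n. (\<Sum>\<^sub>\<infinity>(z, i)\<in>family_index Z.
                    emeasure lebesgue (centered_square n \<inter> translate X z)) / of_nat n ^ 2)"

definition odd_area :: "(real^2) set \<Rightarrow> real" where
  "odd_area X =
     (INF K \<in> {K. finite K \<and> odd (card K)}. area {x. odd (card {k \<in> K. x \<in> translate X k})})"

definition odd_compression_ratio :: "(real^2) set \<Rightarrow> real" where
  "odd_compression_ratio X = odd_area X / area X"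

end

theory Submission
  imports Defs "HOL-Library.Z2"
begin

text \<open>
  Let \<open>Q\<close> be an integer polygon and count modulo 2. For large \<open>N = 2^m\<close> the translates of \<open>Q\<close> by
  \<open>N \<int>\<^sup>2\<close> define a nonzero \<open>N \<int>\<^sup>2\<close>-periodic function. The group ring of \<open>(\<int>/N)\<^sup>2\<close> over the field
  with two elements is local, so at most \<open>N\<^sup>2\<close> integer translates of this function add up to a
  nonzero function \<open>G\<close> that is \<open>\<int>\<^sup>2\<close>-periodic. By the Jordan curve theorem the jumps of \<open>G\<close> lie on
  the lines \<open>w \<bullet> x \<in> \<int>\<close>, where \<open>w\<close> ranges over the primitive integer normals of the edges; since all
  edges join lattice points, the jump is constant along all lines with the same \<open>w\<close>. Hence
  \<open>G x = c + (\<Sum>w. m w * \<lfloor>w \<bullet> x\<rfloor>)\<close>. If some \<open>m w0\<close> is nonzero, then \<open>k - 1\<close> successive sums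
  \<open>G x + G (x - u)\<close> with \<open>u\<close> orthogonal to one of the other normals kill all other terms and, for
  suitable lengths of the vectors \<open>u\<close>, turn the \<open>w0\<close>-term into the constant 1. This uses at most
  \<open>2^(k - 1)\<close> translates of \<open>Q\<close> per unit area.

  Pulling this back along the affine map from \<open>P\<close> to its minimal integer polygon gives the odd
  cover of \<open>P\<close>. If \<open>Y\<close> is the set of points lying in an odd number of translates of \<open>P\<close> by an odd
  set, then the translates of \<open>Y\<close> by the same vectors still cover the plane, which bounds the area
  of \<open>Y\<close> from below.
\<close>

section \<open>Sums of translates modulo 2\<close>

text \<open>Summing over all integer translates at once may give zero: those of
  \<open>[0,2] x [0,1]\<close> cover almost every point exactly twice. Hence the passage through a
  period \<open>N\<close> so large that the translates by \<open>N \<int>^2\<close> are disjoint and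
  nothing cancels at the start. The period is then halved again and again, and a halving step that
  would produce zero is skipped because the function already has the smaller period.

  At most \<open>N^2\<close> shifts serve a cell of area \<open>N^2\<close>, so up to this point
  there is at most one translate of \<open>Q\<close> per unit area. Each further doubling removes
  one normal from the formula for \<open>G\<close>; the normal \<open>w0\<close> that survives to
  produce the constant 1 needs no doubling of its own, whence the exponent \<open>k - 1\<close>. For
  \<open>P\<close> the unit of area shrinks by the factor \<open>\<bar>det (matrix f)\<bar>\<close>
  of the linear part \<open>f\<close>, and this factor times \<open>area P\<close> is
  \<open>A_INT P\<close>.

  All local statements are made off the jump lines, a null set, so the values on the boundary of a
  polygon never matter.\<close>

declare add_bit_eq_xor [simp del] mult_bit_eq_and [simp del]

lemma bit_add_self [simp]: "(a::bit) + a = 0"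
  by (cases a) auto

text \<open>The action on functions of the group ring over the field with two elements, a list
  standing for the formal sum of its entries. Lists keep repetitions, and their lengths are the
  numbers of translates that enter the density.\<close>

definition conv :: "'v::ab_group_add list \<Rightarrow> ('v \<Rightarrow> bit) \<Rightarrow> 'v \<Rightarrow> bit" where
  "conv us f x = (\<Sum>u\<leftarrow>us. f (x - u))"

text \<open>The product in the group ring, left unreduced so that lengths multiply exactly.\<close>

definition list_sumset :: "'v::ab_group_add list \<Rightarrow> 'v list \<Rightarrow> 'v list" where
  "list_sumset us vs = concat (map (\<lambda>u. map ((+) u) vs) us)"

lemma length_list_sumset: "length (list_sumset us vs) = length us * length vs"
  by (induction us) (auto simp: list_sumset_def)

lemma set_list_sumset: "set (list_sumset us vs) = (\<lambda>(u, v). u + v) ` (set us \<times> set vs)"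
  by (auto simp: list_sumset_def)

lemma conv_list_sumset: "conv (list_sumset us vs) f x = conv us (conv vs f) x"
  by (induction us) (simp_all add: list_sumset_def conv_def o_def diff_diff_eq)

text \<open>Doubling the list is multiplication by \<open>1 + u\<close>, the difference step modulo
  2.\<close>

lemma conv_double:
  "conv (us @ map ((+) u) us) f x = conv us (\<lambda>x. f x + f (x - u)) x"
  by (simp add: conv_def o_def sum_list_addf diff_diff_eq add.commute)

lemma conv_period:
  assumes "\<And>x. f (x + p) = f x"
  shows "conv us f (x + p) = conv us f x"
proof -
  have "f (x + p - u) = f (x - u)" for u
    using assms[of "x - u"] by (simp add: algebra_simps)
  then show ?thesis by (simp add: conv_def)
qed


lemma bit_add_eq_0_iff: "(a::bit) + b = 0 \<longleftrightarrow> a = b"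
  by (cases a; cases b) auto

lemma bit_of_nat_eq_1_iff: "(of_nat n :: bit) = 1 \<longleftrightarrow> odd n"
  by (cases "even n") (auto elim!: evenE oddE)

lemma bit_add_add_cancel: "(a + b) + (a + c) = b + (c::bit)"
  by (cases a; cases b; cases c) auto

text \<open>Modulo 2, the function \<open>f x + f (x - 2^j e)\<close> has period \<open>2^j e\<close> whenever \<open>f\<close> has period
  \<open>2^(j+1) e\<close>. If it vanishes, then \<open>f\<close> itself already has the smaller period.\<close>

lemma exists_conv_invariant:
  fixes e :: "'v::real_vector"
  assumes "\<And>x. f (x + 2 ^ j *\<^sub>R e) = f x" and "\<exists>x. f x \<noteq> 0"
  shows "\<exists>us. length us \<le> 2 ^ j \<and> set us \<subseteq> range (\<lambda>n. of_nat n *\<^sub>R e) \<and>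
           (\<exists>x. conv us f x \<noteq> 0) \<and> (\<forall>x. conv us f (x + e) = conv us f x)"
  using assms
proof (induction j arbitrary: f)
  case 0
  then show ?case
    by (intro exI[of _ "[0]"]) (auto simp: conv_def intro!: range_eqI[of _ _ 0])
next
  case (Suc j)
  define u where "u = 2 ^ j *\<^sub>R e"
  have per2: "f (x + u + u) = f x" for x
  proof -
    have "u + u = 2 ^ Suc j *\<^sub>R e"
      by (simp add: u_def flip: scaleR_add_left)
    then show ?thesis
      using Suc.prems(1)[of x] by (simp add: add.assoc)
  qed
  define h where "h = (\<lambda>x. f x + f (x - u))"
  show ?case
  proof (cases "\<exists>x. h x \<noteq> 0")
    case False
    then have eq: "f x = f (x - u)" for x
      using False unfolding h_def bit_add_eq_0_iff by blast
    have "f (x + 2 ^ j *\<^sub>R e) = f x" for x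
      using eq[of "x + u"] by (simp add: u_def)
    from Suc.IH[OF this Suc.prems(2)] obtain us where us: "length us \<le> 2 ^ j"
      "set us \<subseteq> range (\<lambda>n. of_nat n *\<^sub>R e)" "\<exists>x. conv us f x \<noteq> 0"
      "\<forall>x. conv us f (x + e) = conv us f x" by blast
    have "length us \<le> 2 ^ Suc j" using us(1) by simp
    with us show ?thesis by blast
  next
    case True
    have "h (x + 2 ^ j *\<^sub>R e) = h x" for x
      using per2[of "x - u"] by (simp add: h_def add.commute flip: u_def)
    from Suc.IH[OF this True] obtain us where us: "length us \<le> 2 ^ j"
      "set us \<subseteq> range (\<lambda>n. of_nat n *\<^sub>R e)" "\<exists>x. conv us h x \<noteq> 0"
      "\<forall>x. conv us h (x + e) = conv us h x" by blast
    have "u + of_nat n *\<^sub>R e = of_nat (2 ^ j + n) *\<^sub>R e" for n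
      by (simp add: u_def scaleR_add_left)
    then have "set (us @ map ((+) u) us) \<subseteq> range (\<lambda>n. of_nat n *\<^sub>R e)"
      using us(2) by (fastforce simp del: of_nat_add)
    moreover have "conv (us @ map ((+) u) us) f = conv us h"
      unfolding h_def by (rule ext, rule conv_double)
    ultimately show ?thesis
      using us by (intro exI[of _ "us @ map ((+) u) us"]) auto
  qed
qed

section \<open>Determinants and floor functions in the plane\<close>

definition cross2 :: "real^2 \<Rightarrow> real^2 \<Rightarrow> real" where
  "cross2 v w = v $ 1 * w $ 2 - v $ 2 * w $ 1"

lemma inner_vec2: "x \<bullet> y = x $ 1 * y $ 1 + x $ 2 * y $ (2::2)" for x y :: "real^2"
  by (simp add: inner_vec_def sum_2)

lemma exists_orthogonal_inner_eq:
  assumes "cross2 w v \<noteq> 0"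
  shows "\<exists>u. v \<bullet> u = 0 \<and> w \<bullet> u = s"
proof
  let ?u = "(\<chi> i. if i = 1 then s * v $ 2 / cross2 w v else - s * v $ 1 / cross2 w v) :: real^2"
  show "v \<bullet> ?u = 0 \<and> w \<bullet> ?u = s"
    using assms by (simp add: inner_vec2 flip: add_divide_distrib diff_divide_distrib)
      (simp add: cross2_def field_simps)
qed

text \<open>Hermite's identity \<open>\<lfloor>y\<rfloor> + \<lfloor>y + 1/2\<rfloor> = \<lfloor>2 *
  y\<rfloor>\<close> with the half step taken downwards, which lowers the sum by 1. Modulo 2, a half
  step thus doubles the frequency of the jumps.\<close>

lemma floor_add_floor_diff_half:
  fixes y :: real
  shows "(of_int \<lfloor>y\<rfloor> + of_int \<lfloor>y - 1 / 2\<rfloor> :: bit) = 1 + of_int \<lfloor>2 * y\<rfloor>"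
proof -
  have "\<lfloor>y\<rfloor> + \<lfloor>y - 1 / 2\<rfloor> = \<lfloor>2 * y\<rfloor> - 1"
  proof (cases "y < of_int \<lfloor>y\<rfloor> + 1 / 2")
    case True
    then have "\<lfloor>y - 1 / 2\<rfloor> = \<lfloor>y\<rfloor> - 1" "\<lfloor>2 * y\<rfloor> = 2 * \<lfloor>y\<rfloor>"
      by (intro floor_unique; simp; linarith)+
    then show ?thesis by simp
  next
    case False
    then have "\<lfloor>y - 1 / 2\<rfloor> = \<lfloor>y\<rfloor>" "\<lfloor>2 * y\<rfloor> = 2 * \<lfloor>y\<rfloor> + 1"
      by (intro floor_unique; simp; linarith)+
    then show ?thesis by simp
  qed
  then have "(of_int \<lfloor>y\<rfloor> + of_int \<lfloor>y - 1 / 2\<rfloor> :: bit) = of_int (\<lfloor>2 * y\<rfloor> - 1)"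
    by (metis of_int_add)
  then show ?thesis by (simp add: add.commute)
qed

text \<open>Translation by a vector orthogonal to \<open>w\<close> kills the terms depending on \<open>w \<bullet> x\<close> only.
  All but the last of these vectors also turn the steps of length \<open>1/q\<close> in direction \<open>w0\<close>
  into steps of length \<open>1/(2q)\<close>; the last one has length one full step there.\<close>

lemma exists_conv_eq_1:
  fixes g :: "real^2 \<Rightarrow> real \<Rightarrow> bit" and c :: bit
  assumes "finite ws" "ws \<noteq> {}" "\<And>w. w \<in> ws \<Longrightarrow> cross2 w0 w \<noteq> 0" "q > 0"
  shows "\<exists>us. length us = 2 ^ card ws \<and>
    (\<forall>x. conv us (\<lambda>x. c + of_int \<lfloor>q * (w0 \<bullet> x)\<rfloor> + (\<Sum>w\<in>ws. g w (w \<bullet> x))) x = 1)"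
  using assms
proof (induction arbitrary: q g c rule: finite_ne_induct)
  case (singleton w)
  obtain u where u: "w \<bullet> u = 0" "w0 \<bullet> u = 1 / q"
    using exists_orthogonal_inner_eq singleton by blast
  have "conv [0, u] (\<lambda>x. c + of_int \<lfloor>q * (w0 \<bullet> x)\<rfloor> + (\<Sum>w\<in>{w}. g w (w \<bullet> x))) x = 1" for x
  proof -
    \<comment> \<open>A step of one full period lowers the floor by exactly 1 and so flips its
      parity, while \<open>c\<close> and the \<open>w\<close>-term cancel.\<close>
    have "q * (w0 \<bullet> (x - u)) = q * (w0 \<bullet> x) - 1"
      using u \<open>q > 0\<close> by (simp add: inner_diff_right field_simps)
    then have "\<lfloor>q * (w0 \<bullet> (x - u))\<rfloor> = \<lfloor>q * (w0 \<bullet> x)\<rfloor> - 1" by simp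
    then show ?thesis
      using u(1) by (simp add: conv_def inner_diff_right)
  qed
  then show ?case by (intro exI[of _ "[0, u]"]) auto
next
  case (insert w ws)
  obtain u where u: "w \<bullet> u = 0" "w0 \<bullet> u = 1 / (2 * q)"
    using exists_orthogonal_inner_eq insert by blast
  \<comment> \<open>Differences of functions of \<open>v \<bullet> x\<close> are again functions of
    \<open>v \<bullet> x\<close>; for this reason the induction leaves \<open>g\<close>,
    \<open>q\<close> and \<open>c\<close> arbitrary.\<close>
  define g' where "g' = (\<lambda>v y. g v y + g v (y - v \<bullet> u))"
  have "\<exists>us. length us = 2 ^ card ws \<and>
    (\<forall>x. conv us (\<lambda>x. 1 + of_int \<lfloor>(2 * q) * (w0 \<bullet> x)\<rfloor> + (\<Sum>w\<in>ws. g' w (w \<bullet> x))) x = 1)"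
    by (rule insert.IH) (use insert in auto)
  then obtain us where us: "length us = 2 ^ card ws"
    "\<And>x. conv us (\<lambda>x. 1 + of_int \<lfloor>(2 * q) * (w0 \<bullet> x)\<rfloor> + (\<Sum>w\<in>ws. g' w (w \<bullet> x))) x = 1"
    by blast
  let ?H = "\<lambda>x. c + of_int \<lfloor>q * (w0 \<bullet> x)\<rfloor> + (\<Sum>w\<in>insert w ws. g w (w \<bullet> x))"
  have H: "?H x + ?H (x - u) =
      1 + of_int \<lfloor>(2 * q) * (w0 \<bullet> x)\<rfloor> + (\<Sum>w\<in>ws. g' w (w \<bullet> x))" for x
  proof -
    have "q * (w0 \<bullet> (x - u)) = q * (w0 \<bullet> x) - 1 / 2"
      using u \<open>q > 0\<close> by (simp add: inner_diff_right field_simps)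
    then have 1: "of_int \<lfloor>q * (w0 \<bullet> x)\<rfloor> + of_int \<lfloor>q * (w0 \<bullet> (x - u))\<rfloor> =
        (1 + of_int \<lfloor>(2 * q) * (w0 \<bullet> x)\<rfloor> :: bit)"
      using floor_add_floor_diff_half[of "q * (w0 \<bullet> x)"] by (simp add: mult.assoc)
    have 2: "(\<Sum>w\<in>insert w ws. g w (w \<bullet> x)) + (\<Sum>w\<in>insert w ws. g w (w \<bullet> (x - u)))
        = (\<Sum>w\<in>ws. g' w (w \<bullet> x))"
    proof -
      have "(\<Sum>w\<in>insert w ws. g w (w \<bullet> y)) = g w (w \<bullet> y) + (\<Sum>w\<in>ws. g w (w \<bullet> y))" for y
        using insert.hyps by simp
      moreover have "w \<bullet> (x - u) = w \<bullet> x"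
        using u(1) by (simp add: inner_diff_right)
      ultimately show ?thesis
        by (simp only: bit_add_add_cancel) (simp add: g'_def sum.distrib inner_diff_right)
    qed
    have "?H x + ?H (x - u) = (c + c) +
      (of_int \<lfloor>q * (w0 \<bullet> x)\<rfloor> + of_int \<lfloor>q * (w0 \<bullet> (x - u))\<rfloor>) +
      ((\<Sum>w\<in>insert w ws. g w (w \<bullet> x)) + (\<Sum>w\<in>insert w ws. g w (w \<bullet> (x - u))))"
      by (simp only: ac_simps)
    then show ?thesis unfolding 1 2 by simp
  qed
  have "conv (us @ map ((+) u) us) ?H x = 1" for x
    unfolding conv_double H by (rule us(2))
  then show ?case
    using us(1) insert by (intro exI[of _ "us @ map ((+) u) us"]) auto
qed

section \<open>Step functions with jumps along lattice lines\<close>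

definition int_lattice :: "(real^2) set" where
  "int_lattice = {z. \<forall>i. z $ i \<in> \<int>}"

lemma int_lattice_add: "x \<in> int_lattice \<Longrightarrow> y \<in> int_lattice \<Longrightarrow> x + y \<in> int_lattice"
  and int_lattice_diff: "x \<in> int_lattice \<Longrightarrow> y \<in> int_lattice \<Longrightarrow> x - y \<in> int_lattice"
  and int_lattice_minus: "x \<in> int_lattice \<Longrightarrow> - x \<in> int_lattice"
  by (auto simp: int_lattice_def)

lemma int_lattice_inner: "x \<in> int_lattice \<Longrightarrow> y \<in> int_lattice \<Longrightarrow> x \<bullet> y \<in> \<int>"
  by (auto simp: int_lattice_def inner_vec2)

lemma Ints_add_iff: "b \<in> \<int> \<Longrightarrow> a + b \<in> \<int> \<longleftrightarrow> (a::real) \<in> \<int>"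
  by (metis Ints_add Ints_diff add_diff_cancel_right')

lemma vec2_eqI: "x $ 1 = y $ 1 \<Longrightarrow> x $ 2 = y $ (2::2) \<Longrightarrow> x = (y::real^2)"
  by (simp add: vec_eq_iff forall_2)

lemma inner_eq_imp_eq:
  assumes "cross2 v w \<noteq> 0" "v \<bullet> x = v \<bullet> y" "w \<bullet> x = w \<bullet> y"
  shows "x = y"
proof (rule vec2_eqI)
  have e: "v $ 1 * (x $ 1 - y $ 1) + v $ 2 * (x $ 2 - y $ 2) = 0"
    "w $ 1 * (x $ 1 - y $ 1) + w $ 2 * (x $ 2 - y $ 2) = 0"
    using assms(2,3) by (simp_all add: inner_vec2 algebra_simps)
  have "cross2 v w * (x $ 1 - y $ 1) = 0" "cross2 v w * (x $ 2 - y $ 2) = 0"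
    using e unfolding cross2_def by algebra+
  with assms(1) show "x $ 1 = y $ 1" "x $ 2 = y $ 2" by auto
qed

lemma floor_inner_locally_constant:
  fixes v y :: "real^2"
  assumes "v \<bullet> y \<notin> \<int>"
  shows "\<exists>e>0. \<forall>x\<in>ball y e. \<lfloor>v \<bullet> x\<rfloor> = \<lfloor>v \<bullet> y\<rfloor>"
proof -
  have "open ((\<lambda>x. v \<bullet> x) -` {of_int \<lfloor>v \<bullet> y\<rfloor> <..< of_int \<lfloor>v \<bullet> y\<rfloor> + 1})"
    by (intro open_vimage open_greaterThanLessThan continuous_intros)
  moreover have "of_int \<lfloor>v \<bullet> y\<rfloor> \<noteq> v \<bullet> y" using assms by (metis Ints_of_int)
  then have "of_int \<lfloor>v \<bullet> y\<rfloor> < v \<bullet> y" "v \<bullet> y < of_int \<lfloor>v \<bullet> y\<rfloor> + 1"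
    using floor_correct[of "v \<bullet> y"] by linarith+
  ultimately obtain e where "e > 0"
    "ball y e \<subseteq> (\<lambda>x. v \<bullet> x) -` {of_int \<lfloor>v \<bullet> y\<rfloor> <..< of_int \<lfloor>v \<bullet> y\<rfloor> + 1}"
    by (metis greaterThanLessThan_iff openE vimageI)
  then have "\<forall>x\<in>ball y e. \<lfloor>v \<bullet> x\<rfloor> = \<lfloor>v \<bullet> y\<rfloor>"
    by (auto simp: subset_iff intro!: floor_unique less_imp_le)
  with \<open>e > 0\<close> show ?thesis by blast
qed

lemma closed_segment_inner_eq:
  fixes a b v x :: "real^2"
  assumes "x \<in> closed_segment a b" "v \<bullet> (b - a) = 0"
  shows "v \<bullet> x = v \<bullet> a"
proof -
  obtain t where "x = (1 - t) *\<^sub>R a + t *\<^sub>R b" using assms(1) by (auto simp: in_segment)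
  then have "v \<bullet> x = (1 - t) * (v \<bullet> a) + t * (v \<bullet> b)" by (simp add: inner_add_right)
  also have "v \<bullet> b = v \<bullet> a" using assms(2) by (simp add: inner_diff_right)
  finally show ?thesis by (simp add: algebra_simps)
qed

text \<open>The vector \<open>dual w\<close> certifies that \<open>w\<close> is primitive:
  \<open>w \<bullet> x\<close> and \<open>dual w \<bullet> x\<close> are unimodular coordinates of
  the plane. The first selects a line with normal \<open>w\<close>, the second gives the position
  along it, the lattice points of such a line being those with integral second coordinate.\<close>

locale primitive_normals =
  fixes W :: "(real^2) set" and dual :: "real^2 \<Rightarrow> real^2"
  assumes finite_W: "finite W"
    and W_int: "w \<in> W \<Longrightarrow> w \<in> int_lattice"
    and dual_int: "w \<in> W \<Longrightarrow> dual w \<in> int_lattice"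
    and cross2_dual: "w \<in> W \<Longrightarrow> cross2 w (dual w) = 1"
    and cross2_distinct: "w \<in> W \<Longrightarrow> w' \<in> W \<Longrightarrow> w \<noteq> w' \<Longrightarrow> cross2 w w' \<noteq> 0"
    and two_normals: "w \<in> W \<Longrightarrow> \<exists>w'\<in>W. w' \<noteq> w"
begin

lemma W_nonzero: "w \<in> W \<Longrightarrow> w \<noteq> 0"
  using cross2_dual by (force simp: cross2_def)

lemma exists_int_lattice_point:
  assumes "w \<in> W" "s \<in> \<int>" "t \<in> \<int>"
  shows "\<exists>z\<in>int_lattice. w \<bullet> z = s \<and> dual w \<bullet> z = t"
proof
  let ?p = "dual w"
  \<comment> \<open>The inverse of the matrix with rows \<open>w\<close> and \<open>dual w\<close>,
    of determinant 1, applied to \<open>(s, t)\<close>.\<close>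
  let ?z = "(\<chi> i. if i = 1 then ?p $ 2 * s - w $ 2 * t else w $ 1 * t - ?p $ 1 * s) :: real^2"
  show "?z \<in> int_lattice"
    using W_int[OF assms(1)] dual_int[OF assms(1)] assms(2,3)
    by (auto simp: int_lattice_def)
  have c: "w $ 1 * ?p $ 2 - w $ 2 * ?p $ 1 = 1"
    using cross2_dual[OF assms(1)] by (simp add: cross2_def)
  have "w $ 1 * (?p $ 2 * s - w $ 2 * t) + w $ 2 * (w $ 1 * t - ?p $ 1 * s) = s"
    "?p $ 1 * (?p $ 2 * s - w $ 2 * t) + ?p $ 2 * (w $ 1 * t - ?p $ 1 * s) = t"
    using c by algebra+
  then show "w \<bullet> ?z = s \<and> ?p \<bullet> ?z = t"
    by (simp add: inner_vec2)
qed

lemma int_lattice_if_inner: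
  assumes "w \<in> W" "w \<bullet> x \<in> \<int>" "dual w \<bullet> x \<in> \<int>"
  shows "x \<in> int_lattice"
  using exists_int_lattice_point[OF assms] inner_eq_imp_eq[of w "dual w"] cross2_dual[OF assms(1)]
  by (metis zero_neq_one)

text \<open>A dense set with negligible complement, invariant under integer translations.
  Restricting local statements to it makes the values of a function on its own jump lines
  irrelevant.\<close>

definition off_lines :: "(real^2) set" where
  "off_lines = {x. \<forall>w\<in>W. w \<bullet> x \<notin> \<int>}"

lemma off_lines_add: "z \<in> int_lattice \<Longrightarrow> x + z \<in> off_lines \<longleftrightarrow> x \<in> off_lines"
  using W_int int_lattice_inner by (auto simp: off_lines_def inner_add_right Ints_add_iff)

lemma off_lines_diff: "z \<in> int_lattice \<Longrightarrow> x - z \<in> off_lines \<longleftrightarrow> x \<in> off_lines"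
  using off_lines_add[of "- z" x] int_lattice_minus by simp

lemma negligible_compl_off_lines: "negligible (- off_lines)"
proof -
  have eq: "- off_lines = (\<Union>w\<in>W. \<Union>n. {x. w \<bullet> x = of_int n})"
    by (auto simp: off_lines_def Ints_def)
  have "negligible (\<Union>n::int. {x. w \<bullet> x = of_int n})" if "w \<in> W" for w
    by (rule negligible_countable_Union) (use W_nonzero[OF that] in \<open>auto intro!: negligible_hyperplane\<close>)
  then show ?thesis
    unfolding eq using finite_W by (intro negligible_Union) auto
qed

lemma open_meets_off_lines:
  assumes "open S" "S \<noteq> {}"
  shows "\<exists>x\<in>S. x \<in> off_lines"
  using open_not_negligible[OF assms] negligible_subset[OF negligible_compl_off_lines, of S] by blast

lemma upper_half_ball:
  assumes "w \<in> W" "e > 0"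
  shows "\<exists>x\<in>ball y e \<inter> off_lines. w \<bullet> x > w \<bullet> y"
proof -
  have n: "norm w > 0" using W_nonzero[OF assms(1)] by simp
  have "y + (e / 2 / norm w) *\<^sub>R w \<in> ball y e \<inter> {x. w \<bullet> x > w \<bullet> y}"
    using n assms(2) by (auto simp: dist_norm inner_add_right)
  moreover have "open (ball y e \<inter> {x. w \<bullet> x > w \<bullet> y})"
    by (intro open_Int open_ball open_halfspace_gt)
  ultimately show ?thesis
    using open_meets_off_lines by blast
qed

lemma lower_half_ball:
  assumes "w \<in> W" "e > 0"
  shows "\<exists>x\<in>ball y e \<inter> off_lines. w \<bullet> x < w \<bullet> y"
proof -
  have n: "norm w > 0" using W_nonzero[OF assms(1)] by simp
  have "y - (e / 2 / norm w) *\<^sub>R w \<in> ball y e \<inter> {x. w \<bullet> x < w \<bullet> y}"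
    using n assms(2) by (auto simp: dist_norm inner_diff_right)
  moreover have "open (ball y e \<inter> {x. w \<bullet> x < w \<bullet> y})"
    by (intro open_Int open_ball open_halfspace_lt)
  ultimately show ?thesis
    using open_meets_off_lines by blast
qed

definition on_one_line :: "real^2 \<Rightarrow> real^2 \<Rightarrow> bool" where
  "on_one_line w y \<longleftrightarrow> w \<in> W \<and> w \<bullet> y \<in> \<int> \<and> (\<forall>w'\<in>W. w' \<noteq> w \<longrightarrow> w' \<bullet> y \<notin> \<int>)"

lemma on_one_line_add: "z \<in> int_lattice \<Longrightarrow> on_one_line w (y + z) \<longleftrightarrow> on_one_line w y"
  using W_int int_lattice_inner by (auto simp: on_one_line_def inner_add_right Ints_add_iff)

lemma on_one_line_diff: "z \<in> int_lattice \<Longrightarrow> on_one_line w (y - z) \<longleftrightarrow> on_one_line w y"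
  using on_one_line_add[of "- z" w y] int_lattice_minus by simp

text \<open>A lattice point lies on a line of every normal in \<open>W\<close>, and there are at
  least two normals. A point on a single line is therefore no lattice point, so its second
  unimodular coordinate is not integral.\<close>

lemma on_one_line_dual:
  assumes "on_one_line w y"
  shows "dual w \<bullet> y \<notin> \<int>"
proof
  assume "dual w \<bullet> y \<in> \<int>"
  then have "y \<in> int_lattice"
    using assms int_lattice_if_inner by (auto simp: on_one_line_def)
  moreover obtain w' where "w' \<in> W" "w' \<noteq> w"
    using assms two_normals by (auto simp: on_one_line_def)
  ultimately show False
    using assms W_int int_lattice_inner unfolding on_one_line_def by blast
qed

text \<open>Modulo 2 a jump has no sign, so \<open>j\<close> does not depend on the orientation of
  \<open>w\<close>. The value \<open>j = 0\<close> means that \<open>f\<close> is constant near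
  \<open>y\<close> off the lines.\<close>

definition has_jump :: "(real^2 \<Rightarrow> bit) \<Rightarrow> real^2 \<Rightarrow> real^2 \<Rightarrow> bit \<Rightarrow> bool" where
  "has_jump f w y j \<longleftrightarrow>
     (\<exists>e>0. \<exists>c. \<forall>x\<in>ball y e \<inter> off_lines. f x = c + (if w \<bullet> x > w \<bullet> y then j else 0))"

lemma has_jump_unique:
  assumes "has_jump f w y j" "has_jump f w y j'" "w \<in> W"
  shows "j = j'"
proof -
  obtain e c where e: "e > 0"
    "\<And>x. x \<in> ball y e \<inter> off_lines \<Longrightarrow> f x = c + (if w \<bullet> x > w \<bullet> y then j else 0)"
    using assms(1) unfolding has_jump_def by blast
  obtain e' c' where e': "e' > 0"
    "\<And>x. x \<in> ball y e' \<inter> off_lines \<Longrightarrow> f x = c' + (if w \<bullet> x > w \<bullet> y then j' else 0)"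
    using assms(2) unfolding has_jump_def by blast
  have m: "min e e' > 0" using e e' by simp
  obtain x where x: "x \<in> ball y (min e e') \<inter> off_lines" "w \<bullet> x > w \<bullet> y"
    using upper_half_ball[OF assms(3) m] by blast
  obtain x' where x': "x' \<in> ball y (min e e') \<inter> off_lines" "w \<bullet> x' < w \<bullet> y"
    using lower_half_ball[OF assms(3) m] by blast
  have "c = c'" using e(2)[of x'] e'(2)[of x'] x' by simp
  moreover have "c + j = c' + j'" using e(2)[of x] e'(2)[of x] x by simp
  ultimately show ?thesis by simp
qed

lemma has_jump_add:
  assumes "has_jump f w y j" "has_jump g w y j'"
  shows "has_jump (\<lambda>x. f x + g x) w y (j + j')"
proof -
  obtain e c where e: "e > 0"
    "\<And>x. x \<in> ball y e \<inter> off_lines \<Longrightarrow> f x = c + (if w \<bullet> x > w \<bullet> y then j else 0)"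
    using assms(1) unfolding has_jump_def by blast
  obtain e' c' where e': "e' > 0"
    "\<And>x. x \<in> ball y e' \<inter> off_lines \<Longrightarrow> g x = c' + (if w \<bullet> x > w \<bullet> y then j' else 0)"
    using assms(2) unfolding has_jump_def by blast
  show ?thesis
    unfolding has_jump_def
    by (rule exI[of _ "min e e'"], intro conjI exI[of _ "c + c'"] ballI)
      (use e e' in \<open>auto simp: ac_simps\<close>)
qed

lemma has_jump_translate:
  assumes "has_jump f w y j" "z \<in> int_lattice"
  shows "has_jump (\<lambda>x. f (x - z)) w (y + z) j"
proof -
  obtain e c where e: "e > 0"
    "\<And>x. x \<in> ball y e \<inter> off_lines \<Longrightarrow> f x = c + (if w \<bullet> x > w \<bullet> y then j else 0)"
    using assms(1) unfolding has_jump_def by blast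
  have "f (x - z) = c + (if w \<bullet> x > w \<bullet> (y + z) then j else 0)"
    if "x \<in> ball (y + z) e \<inter> off_lines" for x
    using e(2)[of "x - z"] that assms(2)
    by (auto simp: off_lines_diff dist_norm inner_diff_right inner_add_right algebra_simps)
  with e(1) show ?thesis unfolding has_jump_def by blast
qed

lemma has_jump_cong:
  assumes "has_jump g w y j" "open S" "y \<in> S" "\<And>x. x \<in> S \<Longrightarrow> f x = g x"
  shows "has_jump f w y j"
proof -
  obtain e c where e: "e > 0"
    "\<And>x. x \<in> ball y e \<inter> off_lines \<Longrightarrow> g x = c + (if w \<bullet> x > w \<bullet> y then j else 0)"
    using assms(1) unfolding has_jump_def by blast
  obtain e' where e': "e' > 0" "ball y e' \<subseteq> S"
    using assms(2,3) openE by blast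
  show ?thesis
    unfolding has_jump_def
    by (rule exI[of _ "min e e'"], intro conjI exI[of _ "c"] ballI)
      (use e e' assms(4) in \<open>auto simp: subset_iff\<close>)
qed

text \<open>Both points lie strictly between the same two consecutive lattice points of one line
  with normal \<open>w\<close>, since neither has an integral
  \<open>dual w\<close>-coordinate.\<close>

definition same_segment :: "real^2 \<Rightarrow> real^2 \<Rightarrow> real^2 \<Rightarrow> bool" where
  "same_segment w y y' \<longleftrightarrow> on_one_line w y \<and> on_one_line w y' \<and>
     w \<bullet> y = w \<bullet> y' \<and> \<lfloor>dual w \<bullet> y\<rfloor> = \<lfloor>dual w \<bullet> y'\<rfloor>"

lemma same_segment_diff:
  assumes "same_segment w y y'" "z \<in> int_lattice"
  shows "same_segment w (y - z) (y' - z)"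
proof -
  have w: "w \<in> W" using assms by (auto simp: same_segment_def on_one_line_def)
  have "dual w \<bullet> z \<in> \<int>" using w dual_int assms int_lattice_inner by blast
  then show ?thesis using assms
    by (auto simp: same_segment_def on_one_line_diff inner_diff_right elim!: Ints_cases)
qed

text \<open>Jumps may change along a line only at lattice points, although the other lines of the
  family cross it elsewhere as well.\<close>

definition lattice_step :: "(real^2 \<Rightarrow> bit) \<Rightarrow> bool" where
  "lattice_step f \<longleftrightarrow>
     (\<forall>y\<in>off_lines. \<exists>e>0. \<forall>x\<in>ball y e \<inter> off_lines. f x = f y) \<and>
     (\<forall>w y y'. same_segment w y y' \<longrightarrow> (\<exists>j. has_jump f w y j \<and> has_jump f w y' j))"

lemma lattice_step_add:
  assumes "lattice_step f" "lattice_step g"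
  shows "lattice_step (\<lambda>x. f x + g x)"
  unfolding lattice_step_def
proof (intro conjI ballI allI impI)
  fix y assume "y \<in> off_lines"
  then obtain e e' where "e > 0" "\<forall>x\<in>ball y e \<inter> off_lines. f x = f y"
    "e' > 0" "\<forall>x\<in>ball y e' \<inter> off_lines. g x = g y"
    using assms unfolding lattice_step_def by meson
  then show "\<exists>e>0. \<forall>x\<in>ball y e \<inter> off_lines. f x + g x = f y + g y"
    by (intro exI[of _ "min e e'"]) auto
next
  fix w y y' assume "same_segment w y y'"
  then obtain j j' where "has_jump f w y j" "has_jump f w y' j" "has_jump g w y j'" "has_jump g w y' j'"
    using assms unfolding lattice_step_def by meson
  then show "\<exists>j. has_jump (\<lambda>x. f x + g x) w y j \<and> has_jump (\<lambda>x. f x + g x) w y' j"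
    using has_jump_add by blast
qed

lemma lattice_step_translate:
  assumes "lattice_step f" "z \<in> int_lattice"
  shows "lattice_step (\<lambda>x. f (x - z))"
  unfolding lattice_step_def
proof (intro conjI ballI allI impI)
  fix y assume "y \<in> off_lines"
  then obtain e where e: "e > 0" "\<forall>x\<in>ball (y - z) e \<inter> off_lines. f x = f (y - z)"
    using assms off_lines_diff unfolding lattice_step_def by meson
  have "x - z \<in> ball (y - z) e \<inter> off_lines" if "x \<in> ball y e \<inter> off_lines" for x
    using that assms(2) by (auto simp: off_lines_diff dist_norm)
  with e show "\<exists>e>0. \<forall>x\<in>ball y e \<inter> off_lines. f (x - z) = f (y - z)"
    by blast
next
  fix w y y' assume "same_segment w y y'"
  from same_segment_diff[OF this assms(2)] obtain j
    where "has_jump f w (y - z) j" "has_jump f w (y' - z) j"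
    using assms unfolding lattice_step_def by meson
  then show "\<exists>j. has_jump (\<lambda>x. f (x - z)) w y j \<and> has_jump (\<lambda>x. f (x - z)) w y' j"
    using has_jump_translate[OF _ assms(2)] by fastforce
qed

text \<open>Serves to treat an infinite, locally finite sum of translates as a finite sum on each
  ball.\<close>

lemma lattice_step_local:
  assumes "\<And>R. \<exists>g. lattice_step g \<and> (\<forall>x\<in>ball 0 R. f x = g x)"
  shows "lattice_step f"
  unfolding lattice_step_def
proof (intro conjI ballI allI impI)
  fix y assume y: "y \<in> off_lines"
  obtain g where g: "lattice_step g" "\<forall>x\<in>ball 0 (norm y + 1). f x = g x"
    using assms by blast
  obtain e where e: "e > 0" "\<forall>x\<in>ball y e \<inter> off_lines. g x = g y"
    using g y unfolding lattice_step_def by meson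
  have "f x = f y" if x: "x \<in> ball y (min e 1) \<inter> off_lines" for x
  proof -
    have "norm x < norm y + 1"
      using x norm_triangle_ineq2[of x y] by (simp add: dist_norm norm_minus_commute)
    then show ?thesis using g(2) e x by auto
  qed
  with e(1) show "\<exists>e>0. \<forall>x\<in>ball y e \<inter> off_lines. f x = f y"
    by (intro exI[of _ "min e 1"]) auto
next
  fix w y y' assume s: "same_segment w y y'"
  obtain g where g: "lattice_step g" "\<forall>x\<in>ball 0 (max (norm y) (norm y') + 1). f x = g x"
    using assms by blast
  obtain j where j: "has_jump g w y j" "has_jump g w y' j"
    using g s unfolding lattice_step_def by meson
  have "has_jump f w y j" "has_jump f w y' j"
    using g(2) by (auto intro!: has_jump_cong[OF j(1) open_ball[of 0 "max (norm y) (norm y') + 1"]]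
        has_jump_cong[OF j(2) open_ball[of 0 "max (norm y) (norm y') + 1"]])
  then show "\<exists>j. has_jump f w y j \<and> has_jump f w y' j" by blast
qed

lemma lattice_step_0: "lattice_step (\<lambda>x. 0)"
  unfolding lattice_step_def has_jump_def
  by (auto intro!: exI[of _ "1::real"] exI[of _ "0::bit"])

lemma lattice_step_conv:
  assumes "lattice_step f" "set us \<subseteq> int_lattice"
  shows "lattice_step (conv us f)"
  using assms(2)
proof (induction us)
  case Nil
  then show ?case using lattice_step_0 by (simp add: conv_def[abs_def])
next
  case (Cons u us)
  then show ?case
    using lattice_step_add[OF lattice_step_translate[OF assms(1), of u]]
    by (simp add: conv_def[abs_def])
qed

lemma lattice_step_sum:
  assumes "finite S" "\<And>s. s \<in> S \<Longrightarrow> lattice_step (f s)"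
  shows "lattice_step (\<lambda>x. \<Sum>s\<in>S. f s x)"
  using assms by (induction S) (auto intro: lattice_step_0 lattice_step_add)

lemma of_int_floor_inner_jump:
  assumes "on_one_line w y"
  shows "has_jump (\<lambda>x. of_int \<lfloor>w \<bullet> x\<rfloor>) w y 1"
proof -
  obtain n where n: "w \<bullet> y = of_int n"
    using assms by (auto simp: on_one_line_def elim: Ints_cases)
  have w: "w \<in> W" using assms by (simp add: on_one_line_def)
  then have nw: "norm w > 0" using W_nonzero by simp
  \<comment> \<open>The radius \<open>1 / norm w\<close> is the distance between neighbouring lines
    with normal \<open>w\<close>, so only the line through \<open>y\<close> meets the ball.\<close>
  have "of_int \<lfloor>w \<bullet> x\<rfloor> = of_int (n - 1) + (if w \<bullet> x > w \<bullet> y then 1 else 0 :: bit)"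
    if x: "x \<in> ball y (1 / norm w) \<inter> off_lines" for x
  proof -
    have "\<bar>w \<bullet> (x - y)\<bar> \<le> norm w * norm (x - y)"
      by (rule Cauchy_Schwarz_ineq2)
    also have "\<dots> < 1"
      using x nw by (simp add: dist_norm norm_minus_commute field_simps)
    finally have lt: "\<bar>w \<bullet> x - n\<bar> < 1" by (simp add: inner_diff_right n)
    have "w \<bullet> x \<noteq> n" using x w by (auto simp: off_lines_def)
    show ?thesis
    proof (cases "w \<bullet> x > n")
      case True
      then have "\<lfloor>w \<bullet> x\<rfloor> = n" using lt by linarith
      then show ?thesis using True n by simp
    next
      case False
      then have "\<lfloor>w \<bullet> x\<rfloor> = n - 1" using lt \<open>w \<bullet> x \<noteq> n\<close> by linarith
      then show ?thesis using False n by simp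
    qed
  qed
  then show ?thesis unfolding has_jump_def using nw
    by (intro exI[of _ "1 / norm w"] conjI exI[of _ "of_int (n - 1)"]) auto
qed

definition crossings :: "(real^2) set" where
  "crossings = {y. \<exists>w\<in>W. \<exists>w'\<in>W. w \<noteq> w' \<and> w \<bullet> y \<in> \<int> \<and> w' \<bullet> y \<in> \<int>}"

lemma countable_crossings: "countable crossings"
proof -
  have eq: "crossings = (\<Union>w\<in>W. \<Union>w'\<in>W - {w}. \<Union>n. \<Union>m. {y. w \<bullet> y = of_int n \<and> w' \<bullet> y = of_int m})"
    by (auto simp: crossings_def Ints_def)
  have "countable {y. w \<bullet> y = of_int n \<and> w' \<bullet> y = of_int m}"
    if "w \<in> W" "w' \<in> W - {w}" for w w' and n m :: int
  proof -
    let ?A = "{y. w \<bullet> y = of_int n \<and> w' \<bullet> y = of_int m}"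
    have "?A \<subseteq> {a}" if "a \<in> ?A" for a
      using that inner_eq_imp_eq[OF cross2_distinct[of w w']] \<open>w \<in> W\<close> \<open>w' \<in> W - {w}\<close> by auto
    then show ?thesis
      by (metis (no_types, lifting) countable_empty countable_insert countable_subset equals0I)
  qed
  then show ?thesis
    unfolding eq using finite_W
    by (intro countable_UN) (auto intro: countable_finite)
qed

lemma noncrossing_cases:
  assumes "y \<notin> crossings"
  obtains "y \<in> off_lines" | w where "on_one_line w y"
  using assms unfolding crossings_def off_lines_def on_one_line_def by blast

text \<open>In general \<open>off_lines\<close> falls apart into cells. Connectedness comes instead
  from the complement of the countable set \<open>crossings\<close>, where one may pass from cell to
  cell through points on a single line. The local constants agree on overlapping balls because every
  nonempty open set meets \<open>off_lines\<close>.\<close>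

lemma constant_on_off_lines:
  fixes h :: "real^2 \<Rightarrow> 'a"
  assumes "\<And>y. y \<notin> crossings \<Longrightarrow> \<exists>e>0. \<exists>c. \<forall>x\<in>ball y e \<inter> off_lines. h x = c"
  shows "\<exists>c. \<forall>x\<in>off_lines. h x = c"
proof -
  obtain e c where ec: "\<And>y. y \<notin> crossings \<Longrightarrow> e y > 0 \<and> (\<forall>x\<in>ball y (e y) \<inter> off_lines. h x = c y)"
    using assms by metis
  have "connected (UNIV - crossings)"
    by (rule connected_open_diff_countable) (auto simp: countable_crossings)
  then have "c constant_on (UNIV - crossings)"
  proof (rule locally_constant_imp_constant)
    fix a assume a: "a \<in> UNIV - crossings"
    have "c b = c a" if b: "b \<in> ball a (e a)" "b \<notin> crossings" for b
    proof -
      have "open (ball a (e a) \<inter> ball b (e b))" "b \<in> ball a (e a) \<inter> ball b (e b)"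
        using b ec by auto
      then obtain x where x: "x \<in> ball a (e a) \<inter> ball b (e b)" "x \<in> off_lines"
        using open_meets_off_lines by blast
      have "\<forall>x\<in>ball a (e a) \<inter> off_lines. h x = c a" "\<forall>x\<in>ball b (e b) \<inter> off_lines. h x = c b"
        using ec[OF b(2)] ec[of a] a by simp_all
      with x have "h x = c a" "h x = c b" by blast+
      then show ?thesis by simp
    qed
    then show "\<exists>T. openin (top_of_set (UNIV - crossings)) T \<and> a \<in> T \<and> (\<forall>x\<in>T. c x = c a)"
    proof (intro exI[of _ "(UNIV - crossings) \<inter> ball a (e a)"] conjI ballI)
      show "openin (top_of_set (UNIV - crossings)) ((UNIV - crossings) \<inter> ball a (e a))"
        by (intro openin_open_Int open_ball)
      show "a \<in> (UNIV - crossings) \<inter> ball a (e a)" using a ec[of a] by simp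
    qed (use \<open>\<And>b. b \<in> ball a (e a) \<Longrightarrow> b \<notin> crossings \<Longrightarrow> c b = c a\<close> in blast)
  qed
  then obtain k where k: "\<And>y. y \<notin> crossings \<Longrightarrow> c y = k"
    unfolding constant_on_def by blast
  have "h x = k" if x: "x \<in> off_lines" for x
  proof -
    have "x \<notin> crossings" using x by (auto simp: crossings_def off_lines_def)
    then show ?thesis using ec[of x] k x by auto
  qed
  then show ?thesis by blast
qed

text \<open>Integer translations act transitively on the open lattice segments with normal
  \<open>w\<close>, since \<open>w \<bullet> y\<close> and
  \<open>\<lfloor>dual w \<bullet> y\<rfloor>\<close> can be changed by arbitrary integers
  independently. Periodicity carries the jump on one segment to all others.\<close>

lemma periodic_lattice_step_jump:
  assumes "lattice_step G" and per: "\<And>x z. z \<in> int_lattice \<Longrightarrow> G (x + z) = G x"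
  shows "\<exists>m. \<forall>y. on_one_line w y \<longrightarrow> has_jump G w y m"
proof (cases "\<exists>y0. on_one_line w y0")
  case True
  then obtain y0 where y0: "on_one_line w y0" by blast
  then have w: "w \<in> W" by (simp add: on_one_line_def)
  obtain j where j: "has_jump G w y0 j"
    using assms(1) y0 unfolding lattice_step_def same_segment_def by blast
  have "has_jump G w y j" if y: "on_one_line w y" for y
  proof -
    have "w \<bullet> y0 - w \<bullet> y \<in> \<int>"
      using y y0 by (auto simp: on_one_line_def)
    moreover have "of_int (\<lfloor>dual w \<bullet> y0\<rfloor> - \<lfloor>dual w \<bullet> y\<rfloor>) \<in> (\<int> :: real set)" by simp
    ultimately obtain z where z: "z \<in> int_lattice" "w \<bullet> z = w \<bullet> y0 - w \<bullet> y"
      "dual w \<bullet> z = of_int (\<lfloor>dual w \<bullet> y0\<rfloor> - \<lfloor>dual w \<bullet> y\<rfloor>)"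
      using exists_int_lattice_point[OF w] by metis
    have "\<lfloor>dual w \<bullet> (y + z)\<rfloor> = \<lfloor>dual w \<bullet> y0\<rfloor>"
      unfolding inner_add_right z(3) by (subst floor_add_int[symmetric]) simp
    then have "same_segment w y0 (y + z)"
      using y y0 z by (simp add: same_segment_def on_one_line_add inner_add_right)
    then obtain j' where j': "has_jump G w y0 j'" "has_jump G w (y + z) j'"
      using assms(1) unfolding lattice_step_def by blast
    have "j' = j" using has_jump_unique[OF j'(1) j w] .
    have "has_jump (\<lambda>x. G (x - - z)) w (y + z + - z) j'"
      using has_jump_translate[OF j'(2) int_lattice_minus[OF z(1)]] .
    then show ?thesis using per z(1) \<open>j' = j\<close> by simp
  qed
  then show ?thesis by blast
qed auto

text \<open>The floor of \<open>w \<bullet> x\<close> jumps by 1 across every line with normal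
  \<open>w\<close>, so adding \<open>m w\<close> times it cancels the jumps of \<open>G\<close>
  modulo 2. The remainder \<open>h\<close> is locally constant away from the crossings, hence
  constant.\<close>

lemma periodic_lattice_step_eq:
  assumes G: "lattice_step G" and per: "\<And>x z. z \<in> int_lattice \<Longrightarrow> G (x + z) = G x"
  obtains c m where "\<And>x. x \<in> off_lines \<Longrightarrow> G x = c + (\<Sum>w\<in>W. m w * of_int \<lfloor>w \<bullet> x\<rfloor>)"
proof -
  obtain m where m: "\<And>w y. on_one_line w y \<Longrightarrow> has_jump G w y (m w)"
    using periodic_lattice_step_jump[OF assms] by metis
  define h where "h = (\<lambda>x. G x + (\<Sum>w\<in>W. m w * of_int \<lfloor>w \<bullet> x\<rfloor>))"
  have loc: "\<exists>e>0. \<forall>x\<in>ball y e. \<forall>w\<in>V. \<lfloor>w \<bullet> x\<rfloor> = \<lfloor>w \<bullet> y\<rfloor>"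
    if "V \<subseteq> W" "\<And>w. w \<in> V \<Longrightarrow> w \<bullet> y \<notin> \<int>" for V y
  proof -
    have "finite V" using that finite_W finite_subset by blast
    then show ?thesis using that(2)
    proof (induction V)
      case (insert w V)
      then obtain e where "e > 0" "\<forall>x\<in>ball y e. \<forall>w\<in>V. \<lfloor>w \<bullet> x\<rfloor> = \<lfloor>w \<bullet> y\<rfloor>" by auto
      moreover obtain e' where "e' > 0" "\<forall>x\<in>ball y e'. \<lfloor>w \<bullet> x\<rfloor> = \<lfloor>w \<bullet> y\<rfloor>"
        using floor_inner_locally_constant[of w y] insert.prems[of w] by auto
      ultimately have "min e e' > 0" "\<forall>x\<in>ball y (min e e'). \<forall>v\<in>insert w V. \<lfloor>v \<bullet> x\<rfloor> = \<lfloor>v \<bullet> y\<rfloor>"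
        by (simp, metis insert_iff mem_ball min_less_iff_conj)
      then show ?case by blast
    qed (auto intro: exI[of _ 1])
  qed
  have "\<exists>e>0. \<exists>c. \<forall>x\<in>ball y e \<inter> off_lines. h x = c" if "y \<notin> crossings" for y
    using that
  proof (cases rule: noncrossing_cases)
    case 1
    then obtain e where e: "e > 0" "\<forall>x\<in>ball y e. \<forall>w\<in>W. \<lfloor>w \<bullet> x\<rfloor> = \<lfloor>w \<bullet> y\<rfloor>"
      using loc[of W y] by (auto simp: off_lines_def)
    obtain e' where e': "e' > 0" "\<forall>x\<in>ball y e' \<inter> off_lines. G x = G y"
      using G 1 unfolding lattice_step_def by meson
    have "h x = h y" if "x \<in> ball y (min e e') \<inter> off_lines" for x
    proof -
      have "G x = G y" using e'(2) that by simp
      moreover have "(\<Sum>w\<in>W. m w * of_int \<lfloor>w \<bullet> x\<rfloor>) = (\<Sum>w\<in>W. m w * of_int \<lfloor>w \<bullet> y\<rfloor>)"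
        by (rule sum.cong[OF refl]) (use e(2) that in \<open>metis IntD1 mem_ball min_less_iff_conj\<close>)
      ultimately show ?thesis by (simp only: h_def)
    qed
    moreover have "min e e' > 0" using e e' by simp
    ultimately show ?thesis by blast
  next
    case (2 w)
    obtain e where e: "e > 0" "\<forall>x\<in>ball y e. \<forall>v\<in>W - {w}. \<lfloor>v \<bullet> x\<rfloor> = \<lfloor>v \<bullet> y\<rfloor>"
      using loc[of "W - {w}" y] 2 by (auto simp: on_one_line_def)
    obtain e1 c1 where e1: "e1 > 0"
      "\<And>x. x \<in> ball y e1 \<inter> off_lines \<Longrightarrow> G x = c1 + (if w \<bullet> x > w \<bullet> y then m w else 0)"
      using m[OF 2] unfolding has_jump_def by blast
    obtain e2 c2 where e2: "e2 > 0"
      "\<And>x. x \<in> ball y e2 \<inter> off_lines \<Longrightarrow> of_int \<lfloor>w \<bullet> x\<rfloor> = c2 + (if w \<bullet> x > w \<bullet> y then 1 else 0 :: bit)"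
      using of_int_floor_inner_jump[OF 2] unfolding has_jump_def by blast
    have "h x = c1 + m w * c2 + (\<Sum>v\<in>W - {w}. m v * of_int \<lfloor>v \<bullet> y\<rfloor>)"
      if x: "x \<in> ball y (min e (min e1 e2)) \<inter> off_lines" for x
    proof -
      have "h x = G x + (m w * of_int \<lfloor>w \<bullet> x\<rfloor> + (\<Sum>v\<in>W - {w}. m v * of_int \<lfloor>v \<bullet> x\<rfloor>))"
        using 2 finite_W by (simp add: h_def on_one_line_def sum.remove[of W w])
      also have "(\<Sum>v\<in>W - {w}. m v * of_int \<lfloor>v \<bullet> x\<rfloor>) = (\<Sum>v\<in>W - {w}. m v * of_int \<lfloor>v \<bullet> y\<rfloor>)"
        by (rule sum.cong[OF refl]) (use e(2) x in \<open>metis IntD1 mem_ball min_less_iff_conj\<close>)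
      also have "G x = c1 + (if w \<bullet> x > w \<bullet> y then m w else 0)"
        using e1 x by auto
      also have "of_int \<lfloor>w \<bullet> x\<rfloor> = c2 + (if w \<bullet> x > w \<bullet> y then 1 else 0 :: bit)"
        using e2 x by auto
      finally show ?thesis
        by (cases "w \<bullet> x > w \<bullet> y"; cases "m w") (simp_all add: algebra_simps)
    qed
    moreover have "min e (min e1 e2) > 0" using e(1) e1(1) e2(1) by simp
    ultimately show ?thesis by blast
  qed
  from constant_on_off_lines[OF this] obtain c where c: "\<forall>x\<in>off_lines. h x = c" ..
  have "G x = c + (\<Sum>w\<in>W. m w * of_int \<lfloor>w \<bullet> x\<rfloor>)" if "x \<in> off_lines" for x
  proof -
    have "G x + (\<Sum>w\<in>W. m w * of_int \<lfloor>w \<bullet> x\<rfloor>) = c"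
      using c that unfolding h_def by blast
    then show ?thesis by (auto simp: add.assoc)
  qed
  then show ?thesis by (rule that)
qed

text \<open>The ends of the edge are lattice points, so its \<open>dual w\<close>-coordinates run
  through an interval with integer ends. Such an interval contains a whole unit interval as soon as
  it contains an interior point of it; the edge therefore contains the entire open lattice segment
  of \<open>y\<close>.\<close>

lemma same_segment_in_edge:
  assumes ab: "a \<in> int_lattice" "b \<in> int_lattice" "v \<in> W" "v \<bullet> (b - a) = 0"
    and y: "y \<in> closed_segment a b" and s: "same_segment w y y'"
  shows "v = w" "w \<bullet> y = w \<bullet> a" "y' \<in> closed_segment a b"
proof -
  obtain t where t: "0 \<le> t" "t \<le> 1" "y = (1 - t) *\<^sub>R a + t *\<^sub>R b"
    using y by (auto simp: in_segment)
  have vab: "v \<bullet> b = v \<bullet> a" using ab(4) by (simp add: inner_diff_right)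
  have vy: "v \<bullet> y = v \<bullet> a" by (rule closed_segment_inner_eq[OF y ab(4)])
  have "v \<bullet> y \<in> \<int>" unfolding vy using ab W_int int_lattice_inner by blast
  then show vw: "v = w" using s ab(3) unfolding same_segment_def on_one_line_def by blast
  then show wy: "w \<bullet> y = w \<bullet> a" using vy by simp
  let ?p = "dual w"
  have w: "w \<in> W" using ab vw by simp
  have pi: "?p \<bullet> a \<in> \<int>" "?p \<bullet> b \<in> \<int>"
    using ab dual_int[OF w] int_lattice_inner by blast+
  have ny: "?p \<bullet> y \<notin> \<int>" using s on_one_line_dual by (auto simp: same_segment_def)
  have py: "?p \<bullet> y = (1 - t) * (?p \<bullet> a) + t * (?p \<bullet> b)"
    unfolding t(3) by (simp add: inner_add_right)
  define d where "d = ?p \<bullet> b - ?p \<bullet> a"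
  \<comment> \<open>If \<open>d\<close> were 0, the \<open>dual w\<close>-coordinate would be
    constant along the edge and thus integral at \<open>y\<close>.\<close>
  have d0: "d \<noteq> 0" using ny pi py by (auto simp: d_def algebra_simps)
  define r where "r = (?p \<bullet> y' - ?p \<bullet> a) / d"
  have fl: "\<lfloor>?p \<bullet> y\<rfloor> = \<lfloor>?p \<bullet> y'\<rfloor>" "w \<bullet> y' = w \<bullet> y"
    using s by (auto simp: same_segment_def)
  obtain m n where mn: "?p \<bullet> a = of_int m" "?p \<bullet> b = of_int n"
    using pi by (auto elim!: Ints_cases)
  have eq: "y' = (1 - r) *\<^sub>R a + r *\<^sub>R b"
  proof (rule inner_eq_imp_eq)
    show "cross2 w ?p \<noteq> 0" using cross2_dual[OF w] by simp
    show "w \<bullet> y' = w \<bullet> ((1 - r) *\<^sub>R a + r *\<^sub>R b)"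
      using fl(2) wy vab vw by (simp add: inner_add_right algebra_simps)
    show "?p \<bullet> y' = ?p \<bullet> ((1 - r) *\<^sub>R a + r *\<^sub>R b)"
    proof -
      have "r * d = ?p \<bullet> y' - ?p \<bullet> a" using d0 by (simp add: r_def)
      then show ?thesis by (simp add: inner_add_right d_def algebra_simps)
    qed
  qed
  have "min (?p \<bullet> a) (?p \<bullet> b) \<le> ?p \<bullet> y" "?p \<bullet> y \<le> max (?p \<bullet> a) (?p \<bullet> b)"
  proof -
    have "?p \<bullet> y \<in> closed_segment (?p \<bullet> a) (?p \<bullet> b)"
      using t(1,2) py by (auto simp: in_segment)
    then show "min (?p \<bullet> a) (?p \<bullet> b) \<le> ?p \<bullet> y" "?p \<bullet> y \<le> max (?p \<bullet> a) (?p \<bullet> b)"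
      by (auto simp: closed_segment_eq_real_ivl split: if_splits)
  qed
  \<comment> \<open>The upper end has to be excluded, since the floor there would already be
    \<open>max m n\<close>.\<close>
  moreover have "?p \<bullet> y \<noteq> of_int (max m n)" using ny by (metis Ints_of_int)
  ultimately have "min m n \<le> \<lfloor>?p \<bullet> y\<rfloor>" "\<lfloor>?p \<bullet> y\<rfloor> < max m n"
    unfolding mn by (auto simp: le_floor_iff floor_less_iff)
  then have "of_int (min m n) \<le> ?p \<bullet> y'" "?p \<bullet> y' < of_int (max m n)"
    unfolding fl(1) by (simp_all only: le_floor_iff floor_less_iff)
  then have "0 \<le> r \<and> r \<le> 1"
    using d0 unfolding r_def d_def mn
    by (auto simp: divide_simps min_def max_def split: if_splits)
  then show "y' \<in> closed_segment a b"
    using eq by (auto simp: in_segment)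
qed

text \<open>Near a boundary point on a single line the boundary stays within that line, so each of
  the two half discs lies entirely in \<open>I\<close> or entirely in \<open>J\<close>. Both regions
  accumulate at the point, so the half discs lie in different regions and the jump is 1. Off the
  boundary the jump is 0, and an open lattice segment lies either entirely on the boundary or
  entirely off it.\<close>

lemma lattice_step_polygon:
  assumes E: "finite E" "\<And>a b. (a, b) \<in> E \<Longrightarrow>
      a \<in> int_lattice \<and> b \<in> int_lattice \<and> (\<exists>w\<in>W. w \<bullet> (b - a) = 0)"
    and B: "B = (\<Union>(a, b)\<in>E. closed_segment a b)"
    and IO: "open I" "open J" "I \<inter> J = {}" "- B = I \<union> J" "B \<subseteq> closure I" "B \<subseteq> closure J"
  shows "lattice_step (\<lambda>x. of_bool (x \<in> (B \<union> I) \<inter> off_lines))" (is "lattice_step ?f")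
proof -
  have const: "\<exists>e>0. \<exists>c. \<forall>x\<in>ball y e \<inter> off_lines. ?f x = c" if y: "y \<notin> B" for y
  proof (cases "y \<in> I")
    case True
    then obtain e where "e > 0" "ball y e \<subseteq> I" using IO openE by blast
    then show ?thesis by (intro exI[of _ e] conjI exI[of _ 1]) auto
  next
    case False
    then have "y \<in> J" using y IO by auto
    then obtain e where e: "e > 0" "ball y e \<subseteq> J" using IO openE by blast
    moreover have "(B \<union> I) \<inter> J = {}" using IO by auto
    ultimately show ?thesis by (intro exI[of _ e] conjI exI[of _ 0]) auto
  qed
  have jump0: "has_jump ?f w y 0" if "y \<notin> B" for w y
    using const[OF that] unfolding has_jump_def by auto
  have jump1: "has_jump ?f w y 1" if y: "y \<in> B" "on_one_line w y" for w y
  proof -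
    have ss: "same_segment w y y" using y by (simp add: same_segment_def)
    have w: "w \<in> W" using y by (simp add: on_one_line_def)
    \<comment> \<open>A small ball around \<open>y\<close> avoids the finitely many edges that miss
      \<open>y\<close>. The edges through \<open>y\<close> all lie in the line through
      \<open>y\<close> with normal \<open>w\<close>, because \<open>y\<close> is on no other
      line.\<close>
    let ?E' = "{(a, b) \<in> E. y \<notin> closed_segment a b}"
    have "finite ?E'" using E(1) by (rule rev_finite_subset) auto
    then have "open (- (\<Union>(a, b)\<in>?E'. closed_segment a b))"
      by (intro open_Compl closed_UN) auto
    moreover have "y \<in> - (\<Union>(a, b)\<in>?E'. closed_segment a b)" by auto
    ultimately obtain e where e: "e > 0" "ball y e \<subseteq> - (\<Union>(a, b)\<in>?E'. closed_segment a b)"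
      by (rule openE)
    have line: "w \<bullet> x = w \<bullet> y" if x: "x \<in> ball y e" "x \<in> B" for x
    proof -
      obtain a b where ab: "(a, b) \<in> E" "x \<in> closed_segment a b"
        using x B by auto
      then have y': "y \<in> closed_segment a b" using e(2) x(1) by blast
      obtain v where v: "v \<in> W" "v \<bullet> (b - a) = 0" "a \<in> int_lattice" "b \<in> int_lattice"
        using E(2)[OF ab(1)] by blast
      note * = same_segment_in_edge[OF v(3,4,1,2) y' ss]
      show ?thesis using closed_segment_inner_eq[OF ab(2) v(2)] * by simp
    qed
    define U where "U = ball y e \<inter> {x. w \<bullet> x > w \<bullet> y}"
    define L where "L = ball y e \<inter> {x. w \<bullet> x < w \<bullet> y}"
    have "convex U" "convex L"
      unfolding U_def L_def
      by (intro convex_Int convex_ball convex_halfspace_gt convex_halfspace_lt)+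
    then have conn: "connected U" "connected L" by (auto intro: convex_connected)
    have sub: "U \<subseteq> I \<union> J" "L \<subseteq> I \<union> J"
    proof -
      have "x \<notin> B" if "x \<in> U \<union> L" for x
        using that line[of x] by (auto simp: U_def L_def)
      then show "U \<subseteq> I \<union> J" "L \<subseteq> I \<union> J" using IO(4) by blast+
    qed
    have half: "X \<subseteq> I \<or> X \<subseteq> J" if "connected X" "X \<subseteq> I \<union> J" for X
      using connectedD[OF that(1) IO(1,2)] that IO(3) by blast
    have meets: "\<exists>x \<in> U \<union> L. x \<in> K" if K: "open K" "B \<subseteq> closure K" for K
    proof -
      have "ball y e \<inter> K \<noteq> {}"
      proof -
        have "y \<in> ball y e" "y \<in> closure K" using K(2) y(1) e(1) by auto
        then show ?thesis using open_Int_closure_eq_empty[OF open_ball[of y e], of K] by blast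
      qed
      then obtain x where x: "x \<in> ball y e \<inter> K" "x \<in> off_lines"
        using open_meets_off_lines[OF open_Int[OF open_ball K(1)]] by metis
      then have "w \<bullet> x \<noteq> w \<bullet> y"
        using y w by (auto simp: off_lines_def on_one_line_def)
      then show ?thesis using x by (auto simp: U_def L_def)
    qed
    obtain xI xJ where "xI \<in> U \<union> L" "xI \<in> I" "xJ \<in> U \<union> L" "xJ \<in> J"
      using meets[OF IO(1,5)] meets[OF IO(2,6)] by metis
    then have "\<not> (U \<subseteq> I \<and> L \<subseteq> I)" "\<not> (U \<subseteq> J \<and> L \<subseteq> J)"
      using IO(3) by blast+
    then have "(U \<subseteq> I \<and> L \<subseteq> J) \<or> (U \<subseteq> J \<and> L \<subseteq> I)"
      using half[OF conn(1) sub(1)] half[OF conn(2) sub(2)] by metis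
    note UL_cases = this
    have *: "x \<in> U \<or> x \<in> L" if "x \<in> ball y e \<inter> off_lines" for x
    proof -
      have "w \<bullet> x \<noteq> w \<bullet> y"
        using that y(2) w by (auto simp: off_lines_def on_one_line_def)
      then show ?thesis using that by (auto simp: U_def L_def)
    qed
    have UL: "x \<in> U \<longleftrightarrow> w \<bullet> x > w \<bullet> y" if "x \<in> ball y e" for x
      using that by (auto simp: U_def)
    have "(B \<union> I) \<inter> J = {}" using IO by auto
    show ?thesis using UL_cases
    proof (elim disjE)
      assume UI: "U \<subseteq> I \<and> L \<subseteq> J"
      have "?f x = 0 + (if w \<bullet> x > w \<bullet> y then 1 else 0)" if "x \<in> ball y e \<inter> off_lines" for x
        using UI UL[of x] *[OF that] that \<open>(B \<union> I) \<inter> J = {}\<close>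
        by (cases "x \<in> U") auto
      then show ?thesis unfolding has_jump_def using e(1) by blast
    next
      assume UJ: "U \<subseteq> J \<and> L \<subseteq> I"
      have "?f x = 1 + (if w \<bullet> x > w \<bullet> y then 1 else 0)" if "x \<in> ball y e \<inter> off_lines" for x
        using UJ UL[of x] *[OF that] that \<open>(B \<union> I) \<inter> J = {}\<close>
        by (cases "x \<in> U") auto
      then show ?thesis unfolding has_jump_def using e(1) by blast
    qed
  qed
  show ?thesis
    unfolding lattice_step_def
  proof (intro conjI ballI allI impI)
    fix y assume y: "y \<in> off_lines"
    have "y \<notin> B"
    proof
      assume "y \<in> B"
      then obtain a b where ab: "(a, b) \<in> E" "y \<in> closed_segment a b" using B by auto
      then obtain v where v: "v \<in> W" "v \<bullet> (b - a) = 0" "a \<in> int_lattice" using E(2) by blast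
      have "v \<bullet> y = v \<bullet> a" by (rule closed_segment_inner_eq[OF ab(2) v(2)])
      then show False using y v W_int int_lattice_inner by (auto simp: off_lines_def)
    qed
    then obtain e c where "e > 0" "\<forall>x\<in>ball y e \<inter> off_lines. ?f x = c"
      using const by blast
    then show "\<exists>e>0. \<forall>x\<in>ball y e \<inter> off_lines. ?f x = ?f y"
      using y by (intro exI[of _ e]) auto
  next
    fix w y y' assume s: "same_segment w y y'"
    then have s': "same_segment w y' y" by (auto simp: same_segment_def)
    have imp: "z' \<in> B" if z: "z \<in> B" "same_segment w z z'" for z z'
    proof -
      obtain a b where ab: "(a, b) \<in> E" "z \<in> closed_segment a b" using z(1) B by auto
      then obtain v where v: "v \<in> W" "v \<bullet> (b - a) = 0" "a \<in> int_lattice" "b \<in> int_lattice"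
        using E(2) by blast
      show ?thesis
        using same_segment_in_edge(3)[OF v(3,4,1,2) ab(2) z(2)] ab(1) B by auto
    qed
    have "y \<in> B \<longleftrightarrow> y' \<in> B"
      using imp[OF _ s] imp[OF _ s'] by metis
    then show "\<exists>j. has_jump ?f w y j \<and> has_jump ?f w y' j"
      using jump0 jump1 s unfolding same_segment_def
      by (intro exI[of _ "of_bool (y \<in> B)"]) simp
  qed
qed

end

section \<open>Integer points and integer periods\<close>

lemma finite_int_lattice_bounded:
  assumes "bounded S"
  shows "finite (S \<inter> int_lattice)"
proof -
  obtain D where D: "\<And>x. x \<in> S \<Longrightarrow> norm x \<le> D"
    using assms by (auto simp: bounded_iff)
  have "S \<inter> int_lattice \<subseteq> (\<lambda>(i, j). vector [of_int i, of_int j]) ` ({-\<lceil>D\<rceil>..\<lceil>D\<rceil>} \<times> {-\<lceil>D\<rceil>..\<lceil>D\<rceil>})"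
  proof
    fix x :: "real^2" assume x: "x \<in> S \<inter> int_lattice"
    then obtain i j where ij: "x $ 1 = of_int i" "x $ 2 = of_int j"
      by (auto simp: int_lattice_def elim!: Ints_cases)
        (metis Ints_cases)
    have "\<bar>x $ k\<bar> \<le> D" for k
      using D[of x] component_le_norm_cart[of x k] x by simp
    from this[of 1] this[of 2] have "\<bar>i\<bar> \<le> \<lceil>D\<rceil>" "\<bar>j\<bar> \<le> \<lceil>D\<rceil>"
      unfolding ij by linarith+
    moreover have "x = vector [of_int i, of_int j]"
      by (rule vec2_eqI) (simp_all add: ij)
    ultimately show "x \<in> (\<lambda>(i, j). vector [of_int i, of_int j]) ` ({-\<lceil>D\<rceil>..\<lceil>D\<rceil>} \<times> {-\<lceil>D\<rceil>..\<lceil>D\<rceil>})"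
      by (intro image_eqI[of _ _ "(i, j)"]) auto
  qed
  then show ?thesis by (rule finite_subset) auto
qed

lemma of_nat_sum_list_map: "of_nat (\<Sum>x\<leftarrow>xs. f x) = (\<Sum>x\<leftarrow>xs. of_nat (f x) :: 'a::semiring_1)"
  by (induction xs) simp_all

lemma norm_int_lattice_ge_1:
  assumes "z \<in> int_lattice" "z \<noteq> 0"
  shows "norm z \<ge> 1"
proof -
  obtain i where i: "z $ i \<noteq> 0" using assms(2) by (auto simp: vec_eq_iff)
  have "z $ i \<in> \<int>" using assms(1) by (simp add: int_lattice_def)
  then have "\<bar>z $ i\<bar> \<ge> 1" using i by (rule Ints_nonzero_abs_ge1)
  then show ?thesis using component_le_norm_cart[of z i] by linarith
qed

lemma int_multiple_period:
  fixes e :: "'v::real_vector"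
  assumes "\<And>x. f (x + e) = f x"
  shows "f (x + of_int n *\<^sub>R e) = f x"
proof -
  have nat: "f (x + of_nat n *\<^sub>R e) = f x" for n x
  proof (induction n)
    case (Suc n)
    have "x + of_nat (Suc n) *\<^sub>R e = (x + of_nat n *\<^sub>R e) + e"
      by (simp add: algebra_simps)
    then show ?case using assms[of "x + of_nat n *\<^sub>R e"] Suc by metis
  qed simp
  show ?thesis
  proof (cases "n \<ge> 0")
    case True
    then show ?thesis using nat[of x "nat n"] by simp
  next
    case False
    then have "x = (x + of_int n *\<^sub>R e) + of_nat (nat (- n)) *\<^sub>R e"
      by simp
    then show ?thesis using nat[of "x + of_int n *\<^sub>R e" "nat (- n)"] by metis
  qed
qed

lemma axis_in_int_lattice: "axis i 1 \<in> int_lattice"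
  by (simp add: int_lattice_def axis_def)

lemma scaled_in_int_lattice: "z \<in> int_lattice \<Longrightarrow> t \<in> \<int> \<Longrightarrow> t *\<^sub>R z \<in> int_lattice"
  by (simp add: int_lattice_def)

lemma int_lattice_period:
  fixes f :: "real^2 \<Rightarrow> 'a"
  assumes "\<And>x. f (x + axis 1 1) = f x" "\<And>x. f (x + axis 2 1) = f x" "z \<in> int_lattice"
  shows "f (x + z) = f x"
proof -
  obtain i j where ij: "z $ 1 = of_int i" "z $ 2 = of_int j"
    using assms(3) unfolding int_lattice_def by (metis (mono_tags) Ints_cases mem_Collect_eq)
  have "z = of_int i *\<^sub>R axis 1 1 + of_int j *\<^sub>R axis 2 1"
    by (rule vec2_eqI) (simp_all add: ij axis_def)
  then have "f (x + z) = f ((x + of_int i *\<^sub>R axis 1 1) + of_int j *\<^sub>R axis 2 1)"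
    by (simp add: add.assoc)
  also have "\<dots> = f (x + of_int i *\<^sub>R axis 1 1)"
    by (rule int_multiple_period) (rule assms(2))
  also have "\<dots> = f x"
    by (rule int_multiple_period) (rule assms(1))
  finally show ?thesis .
qed

section \<open>Odd covering by finitely many cosets of a scaled integer lattice\<close>

context primitive_normals
begin

lemma AE_off_lines: "AE x in lebesgue. \<forall>u\<in>set us. x - u \<in> off_lines"
proof -
  have "AE x in lebesgue. x - u \<in> off_lines" for u
  proof (rule AE_I')
    have "negligible ((+) u ` (- off_lines))"
      by (intro negligible_translation negligible_compl_off_lines)
    then show "(+) u ` (- off_lines) \<in> null_sets lebesgue"
      by (simp add: negligible_iff_null_sets)
    show "{x \<in> space lebesgue. x - u \<notin> off_lines} \<subseteq> (+) u ` (- off_lines)"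
      by (auto intro!: image_eqI[where x = "_ - u"])
  qed
  then show ?thesis by (intro AE_finite_allI) auto
qed

text \<open>The bound on \<open>length us\<close> is one shift per unit of area of the cell of
  \<open>N \<int>^2\<close>, times one factor 2 for each normal in \<open>W\<close> but one.\<close>

lemma exists_odd_conv:
  assumes Q: "bounded Q" "open I" "I \<noteq> {}" "I \<subseteq> Q"
    and step: "lattice_step (\<lambda>x. of_bool (x \<in> Q \<inter> off_lines))"
  shows "\<exists>N>0. \<exists>us. real (length us) \<le> N\<^sup>2 * 2 ^ (card W - 1) \<and>
    (AE x in lebesgue. odd (\<Sum>u\<leftarrow>us. card {l \<in> (*\<^sub>R) N ` int_lattice. x - u - l \<in> Q}))"
proof -
  obtain D where D: "\<And>x. x \<in> Q \<Longrightarrow> norm x < D"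
    using Q(1) by (meson bounded_pos_less)
  \<comment> \<open>A power of 2 is needed for the halving of periods. Exceeding
    \<open>2 * D\<close>, it makes the translates of \<open>Q\<close> by distinct vectors of
    \<open>L\<close> disjoint, which is why \<open>f0\<close> is nonzero.\<close>
  obtain m :: nat where m: "2 * D < 2 ^ m"
    using real_arch_pow[of 2 "2 * D"] by auto
  define N :: real where "N = 2 ^ m"
  have N: "N > 0" "2 * D < N" "N \<in> \<int>" using m by (simp_all add: N_def)
  define L where "L = (*\<^sub>R) N ` int_lattice"
  have L_int: "L \<subseteq> int_lattice"
    using N(3) scaled_in_int_lattice by (auto simp: L_def)
  have L_diff: "l \<in> L \<Longrightarrow> l' \<in> L \<Longrightarrow> l - l' \<in> L" and L_add: "l \<in> L \<Longrightarrow> l' \<in> L \<Longrightarrow> l + l' \<in> L" for l l'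
    using int_lattice_diff int_lattice_add unfolding L_def
    by (auto simp flip: scaleR_diff_right scaleR_add_right)
  \<comment> \<open>Leaving out the lines matches the hypothesis \<open>step\<close> and makes
    \<open>f0\<close> vanish on them; almost everywhere the count is unaffected.\<close>
  define f0 :: "real^2 \<Rightarrow> bit" where "f0 = (\<lambda>x. of_nat (card {l \<in> L. x - l \<in> Q \<inter> off_lines}))"
  have f0_per: "f0 (x + p) = f0 x" if p: "p \<in> L" for x p
  proof -
    have "bij_betw (\<lambda>l. l + p) {l \<in> L. x - l \<in> Q \<inter> off_lines} {l \<in> L. x + p - l \<in> Q \<inter> off_lines}"
      by (rule bij_betw_byWitness[where f' = "\<lambda>l. l - p"])
        (use p L_diff L_add in \<open>auto simp: algebra_simps\<close>)
    then show ?thesis unfolding f0_def by (simp add: bij_betw_same_card)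
  qed
  have f0_step: "lattice_step f0"
  proof (rule lattice_step_local)
    fix R :: real
    let ?S = "ball 0 (R + D) \<inter> L"
    have fin: "finite ?S"
      by (rule finite_subset[OF _ finite_int_lattice_bounded[of "ball 0 (R + D)"]]) (use L_int in auto)
    have "f0 x = (\<Sum>l\<in>?S. of_bool (x - l \<in> Q \<inter> off_lines))" if x: "x \<in> ball 0 R" for x
    proof -
      have "l \<in> ?S" if "l \<in> L" "x - l \<in> Q" for l
        using that x D[OF that(2)] norm_triangle_ineq4[of x "x - l"] by simp
      then have "{l \<in> L. x - l \<in> Q \<inter> off_lines} = ?S \<inter> {l. x - l \<in> Q \<inter> off_lines}" by blast
      then have "f0 x = of_nat (card (?S \<inter> {l. x - l \<in> Q \<inter> off_lines}))"
        unfolding f0_def by (simp only:)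
      also have "\<dots> = (\<Sum>l\<in>?S. of_bool (x - l \<in> Q \<inter> off_lines))"
        by (rule sum_of_bool_eq[symmetric]) (rule fin)+
      finally show ?thesis .
    qed
    moreover have "lattice_step (\<lambda>x. \<Sum>l\<in>?S. of_bool (x - l \<in> Q \<inter> off_lines))"
      using fin L_int by (intro lattice_step_sum lattice_step_translate[OF step]) auto
    ultimately show "\<exists>g. lattice_step g \<and> (\<forall>x\<in>ball 0 R. f0 x = g x)" by blast
  qed
  have f0_nonzero: "\<exists>x. f0 x \<noteq> 0"
  proof -
    obtain x where x: "x \<in> I" "x \<in> off_lines" using open_meets_off_lines[OF Q(2,3)] by blast
    have "l = 0" if l: "l \<in> L" "x - l \<in> Q" for l
    proof (rule ccontr)
      assume "l \<noteq> 0"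
      obtain z where z: "z \<in> int_lattice" "l = N *\<^sub>R z" using l by (auto simp: L_def)
      then have "norm l \<ge> N"
        using norm_int_lattice_ge_1[OF z(1)] \<open>l \<noteq> 0\<close> N(1) by auto
      moreover have "norm l < D + D"
        using D[OF l(2)] D[of x] x Q(4) norm_triangle_ineq4[of x "x - l"] by auto
      ultimately show False using N(2) by simp
    qed
    moreover have "0 \<in> L" by (auto simp: L_def int_lattice_def intro!: image_eqI[of _ _ 0])
    ultimately have "{l \<in> L. x - l \<in> Q \<inter> off_lines} = {0}" using x Q(4) by auto
    then have "f0 x = 1" by (simp add: f0_def)
    then show ?thesis by (metis zero_neq_one)
  qed
  have axis_L: "2 ^ m *\<^sub>R axis i 1 \<in> L" for i
    using axis_in_int_lattice by (auto simp: L_def N_def)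
  obtain us1 where us1: "length us1 \<le> 2 ^ m" "set us1 \<subseteq> range (\<lambda>n. of_nat n *\<^sub>R axis 1 1)"
    "\<exists>x. conv us1 f0 x \<noteq> 0" "\<forall>x. conv us1 f0 (x + axis 1 1) = conv us1 f0 x"
    using exists_conv_invariant[of f0 m "axis 1 1"] f0_per[OF axis_L] f0_nonzero by blast
  \<comment> \<open>Applied to the outcome of the first round, whose period \<open>axis 1 1\<close>
    survives any further sum of translates.\<close>
  obtain us2 where us2: "length us2 \<le> 2 ^ m" "set us2 \<subseteq> range (\<lambda>n. of_nat n *\<^sub>R axis 2 1)"
    "\<exists>x. conv us2 (conv us1 f0) x \<noteq> 0"
    "\<forall>x. conv us2 (conv us1 f0) (x + axis 2 1) = conv us2 (conv us1 f0) x"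
    using exists_conv_invariant[of "conv us1 f0" m "axis 2 1"] conv_period[of f0 "2 ^ m *\<^sub>R axis 2 1" us1]
      f0_per[OF axis_L[of 2]] us1(3) by blast
  define us where "us = list_sumset us2 us1"
  define G where "G = conv us f0"
  have G_eq: "G = conv us2 (conv us1 f0)"
    unfolding G_def us_def by (rule ext) (rule conv_list_sumset)
  have len: "real (length us) \<le> N\<^sup>2"
  proof -
    have "length us \<le> 2 ^ m * 2 ^ m"
      unfolding us_def length_list_sumset using us1(1) us2(1) by (rule mult_le_mono[rotated])
    then have "real (length us) \<le> real (2 ^ m * 2 ^ m)" by (simp only: of_nat_le_iff)
    then show ?thesis unfolding N_def power2_eq_square by simp
  qed
  have us_int: "set us \<subseteq> int_lattice"
  proof -
    have "of_nat n *\<^sub>R axis i 1 \<in> int_lattice" for n i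
      by (intro scaled_in_int_lattice axis_in_int_lattice Ints_of_nat)
    then have "set us1 \<subseteq> int_lattice" "set us2 \<subseteq> int_lattice"
      using us1(2) us2(2) by blast+
    then show ?thesis
      by (auto simp: us_def set_list_sumset intro!: int_lattice_add)
  qed
  have G_step: "lattice_step G"
    unfolding G_def by (rule lattice_step_conv[OF f0_step us_int])
  have G_per: "G (x + z) = G x" if "z \<in> int_lattice" for x z
    by (rule int_lattice_period[OF _ _ that])
      (use us2(4) conv_period[of "conv us1 f0" "axis 1 1" us2] us1(4) G_eq in auto)
  obtain x0 where x0: "G x0 \<noteq> 0" using us2(3) G_eq by auto
  \<comment> \<open>Since \<open>f0\<close> vanishes on the lines and integer shifts preserve them,
    \<open>G\<close> can be nonzero only off the lines, where the formula for \<open>G\<close> is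
    available.\<close>
  have x0_off: "x0 \<in> off_lines"
  proof (rule ccontr)
    assume "x0 \<notin> off_lines"
    have "f0 (x0 - u) = 0" if "u \<in> int_lattice" for u
    proof -
      have "x0 - u - l \<notin> off_lines" if "l \<in> L" for l
        using \<open>x0 \<notin> off_lines\<close> \<open>u \<in> int_lattice\<close> that L_int off_lines_diff by blast
      then have "{l \<in> L. x0 - u - l \<in> Q \<inter> off_lines} = {}" by blast
      then show ?thesis unfolding f0_def by (simp only: card.empty of_nat_0)
    qed
    then have "map (\<lambda>u. f0 (x0 - u)) us = map (\<lambda>u. 0) us"
      using us_int by (intro map_cong) auto
    then have "G x0 = (\<Sum>u\<leftarrow>us. 0)" unfolding G_def conv_def by (simp only:)
    then show False using x0 by simp
  qed
  obtain c mu where G: "\<And>x. x \<in> off_lines \<Longrightarrow> G x = c + (\<Sum>w\<in>W. mu w * of_int \<lfloor>w \<bullet> x\<rfloor>)"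
    using periodic_lattice_step_eq[OF G_step G_per] by blast
  have "\<exists>vs. length vs \<le> 2 ^ (card W - 1) \<and> (AE x in lebesgue. conv vs G x = 1)"
  proof (cases "\<exists>w\<in>W. mu w \<noteq> 0")
    \<comment> \<open>Without jumps \<open>G\<close> is constant off the lines, and the constant is
      1 because \<open>G\<close> is nonzero; a single copy suffices.\<close>
    case False
    then have Gc: "G x = c" if "x \<in> off_lines" for x
      using G[OF that] by simp
    then have "c = 1" using x0 x0_off by simp
    have "AE x in lebesgue. conv [0] G x = 1"
      using AE_off_lines[of "[0]"]
      by (rule eventually_mono) (use Gc \<open>c = 1\<close> in \<open>simp add: conv_def\<close>)
    then show ?thesis by (intro exI[of _ "[0]"]) auto
  next
    case True
    then obtain w0 where w0: "w0 \<in> W" "mu w0 = 1" by auto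
    \<comment> \<open>The factor 1 is the initial frequency \<open>q\<close> for the successive
      doublings.\<close>
    define H where "H = (\<lambda>x. c + of_int \<lfloor>1 * (w0 \<bullet> x)\<rfloor> + (\<Sum>w\<in>W - {w0}. mu w * of_int \<lfloor>w \<bullet> x\<rfloor>))"
    have GH: "G x = H x" if "x \<in> off_lines" for x
      using G[OF that] w0 finite_W by (simp add: H_def sum.remove[of W w0] add.assoc)
    have "\<exists>vs. length vs = 2 ^ card (W - {w0}) \<and> (\<forall>x. conv vs H x = 1)"
      unfolding H_def
      by (rule exists_conv_eq_1[where g = "\<lambda>w y. mu w * of_int \<lfloor>y\<rfloor>"])
        (use finite_W w0 two_normals cross2_distinct in auto)
    then obtain vs where vs: "length vs = 2 ^ card (W - {w0})" "\<And>x. conv vs H x = 1" by blast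
    have "AE x in lebesgue. conv vs G x = 1"
      using AE_off_lines[of vs]
    proof (rule eventually_mono)
      fix x assume x: "\<forall>u\<in>set vs. x - u \<in> off_lines"
      then have "map (\<lambda>u. G (x - u)) vs = map (\<lambda>u. H (x - u)) vs"
        using GH by (intro map_cong) auto
      then show "conv vs G x = 1" using vs(2)[of x] unfolding conv_def by (simp only:)
    qed
    then show ?thesis using vs(1) w0 finite_W by (intro exI[of _ vs]) auto
  qed
  then obtain vs where vs: "length vs \<le> 2 ^ (card W - 1)" "AE x in lebesgue. conv vs G x = 1"
    by blast
  define us' where "us' = list_sumset vs us"
  have "real (length us') \<le> N\<^sup>2 * 2 ^ (card W - 1)"
  proof -
    have "real (length us') = real (length us) * real (length vs)"
      by (simp add: us'_def length_list_sumset)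
    also have "\<dots> \<le> N\<^sup>2 * 2 ^ (card W - 1)"
      using len vs(1) by (intro mult_mono) (simp_all flip: of_nat_le_iff)
    finally show ?thesis .
  qed
  moreover have "AE x in lebesgue. odd (\<Sum>u\<leftarrow>us'. card {l \<in> L. x - u - l \<in> Q})"
    using vs(2) AE_off_lines[of us']
  proof eventually_elim
    case (elim x)
    have "conv us' f0 x = 1"
      using elim(1) unfolding us'_def conv_list_sumset G_def .
    moreover have "card {l \<in> L. x - u - l \<in> Q \<inter> off_lines} = card {l \<in> L. x - u - l \<in> Q}"
      if "u \<in> set us'" for u
      using elim(2) that L_int off_lines_diff by (intro arg_cong[of _ _ card]) blast
    then have "map (\<lambda>u. f0 (x - u)) us' = map (\<lambda>u. of_nat (card {l \<in> L. x - u - l \<in> Q})) us'"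
      unfolding f0_def by (intro map_cong) auto
    ultimately have "(of_nat (\<Sum>u\<leftarrow>us'. card {l \<in> L. x - u - l \<in> Q}) :: bit) = 1"
      unfolding conv_def by (simp only: of_nat_sum_list_map)
    then show ?case by (rule bit_of_nat_eq_1_iff[THEN iffD1])
  qed
  ultimately show ?thesis using N(1) unfolding L_def by blast
qed

end

section \<open>Translates along a lattice\<close>

lemma measure_centered_cbox:
  assumes "s \<ge> 0"
  shows "measure lebesgue (cbox (\<chi> i. - s) (\<chi> i. s) :: (real^2) set) = (2 * s)\<^sup>2"
proof -
  have "(cbox (\<chi> i. - s) (\<chi> i. s) :: (real^2) set) \<noteq> {}"
    using assms by (simp add: interval_ne_empty_cart)
  then show ?thesis
    by (simp add: content_cbox_cart power2_eq_square UNIV_2)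
qed

lemma int_lattice_translates_disjoint:
  fixes h :: "real^2 \<Rightarrow> real^2"
  assumes h: "linear h" "inj h" and l: "l \<in> h ` int_lattice" "l' \<in> h ` int_lattice" "l \<noteq> l'"
  shows "(+) l ` h ` box 0 One \<inter> (+) l' ` h ` box 0 One = {}"
proof (rule ccontr)
  assume "\<not> ?thesis"
  then obtain u u' where u: "u \<in> box 0 One" "u' \<in> box 0 One" "l + h u = l' + h u'"
    by auto
  obtain z z' where z: "l = h z" "l' = h z'" "z \<in> int_lattice" "z' \<in> int_lattice"
    using l by auto
  have "h (z + u) = h (z' + u')" using u(3) z h(1) by (simp add: linear_add)
  then have eq: "z + u = z' + u'" using h(2) by (simp add: inj_eq)
  have "z $ i = z' $ i" for i
  proof -
    have "0 < u $ i" "u $ i < 1" "0 < u' $ i" "u' $ i < 1"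
      using u(1,2) by (auto simp: mem_box cart_eq_inner_axis axis_in_Basis_iff)
    moreover have "z $ i + u $ i = z' $ i + u' $ i" using arg_cong[OF eq, of "\<lambda>x. x $ i"] by simp
    moreover obtain m n where "z $ i = of_int m" "z' $ i = of_int n"
      using z(3,4) unfolding int_lattice_def by (metis (mono_tags) Ints_cases mem_Collect_eq)
    ultimately show ?thesis by simp
  qed
  then have "z = z'" by (simp add: vec_eq_iff)
  then show False using l(3) z by simp
qed

text \<open>The images under \<open>h\<close> of the open unit cells at the points of \<open>F\<close> are disjoint and lie in a
  slightly larger square.\<close>

lemma card_lattice_points_box:
  fixes h :: "real^2 \<Rightarrow> real^2"
  assumes h: "linear h" "inj h"
  obtains c where "c \<ge> 0" "\<And>s F. s \<ge> 0 \<Longrightarrow> finite F \<Longrightarrow> F \<subseteq> h ` int_lattice \<Longrightarrow>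
    (\<And>x i. x \<in> F \<Longrightarrow> \<bar>x $ i\<bar> \<le> s) \<Longrightarrow> real (card F) * \<bar>det (matrix h)\<bar> \<le> (2 * s + c)\<^sup>2"
proof -
  define C where "C = h ` box 0 One"
  have C: "C \<in> lmeasurable" "measure lebesgue C = \<bar>det (matrix h)\<bar>"
    using measurable_linear_image[OF h(1)] measure_linear_image[OF h(1), of "box 0 One"]
    by (simp_all add: C_def measure_lborel_box_eq)
  obtain b where b: "b \<ge> 0" "\<And>x. x \<in> C \<Longrightarrow> norm x \<le> b"
  proof -
    have "bounded C" unfolding C_def
      by (intro bounded_linear_image linear_linear[THEN iffD2] h(1) bounded_box)
    then show ?thesis using that by (meson bounded_pos less_imp_le)
  qed
  have "real (card F) * \<bar>det (matrix h)\<bar> \<le> (2 * s + 2 * b)\<^sup>2"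
    if F: "s \<ge> 0" "finite F" "F \<subseteq> h ` int_lattice" "\<And>x i. x \<in> F \<Longrightarrow> \<bar>x $ i\<bar> \<le> s" for s F
  proof -
    have meas: "(+) l ` C \<in> lmeasurable" for l by (rule measurable_translation[OF C(1)])
    have "pairwise (\<lambda>l l'. negligible ((+) l ` C \<inter> (+) l' ` C)) F"
      unfolding pairwise_def C_def
    proof (intro ballI impI)
      fix l l' assume "l \<in> F" "l' \<in> F" "l \<noteq> l'"
      then have "(+) l ` h ` box 0 One \<inter> (+) l' ` h ` box 0 One = {}"
        using int_lattice_translates_disjoint[OF h, of l l'] F(3) by blast
      then show "negligible ((+) l ` h ` box 0 One \<inter> (+) l' ` h ` box 0 One)" by simp
    qed
    then have "measure lebesgue (\<Union>((\<lambda>l. (+) l ` C) ` F)) = (\<Sum>l\<in>F. measure lebesgue ((+) l ` C))"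
      using F(2) meas by (intro measure_negligible_finite_Union_image) auto
    also have "\<dots> = real (card F) * \<bar>det (matrix h)\<bar>"
      by (simp only: measure_translation C(2)) simp
    finally have "real (card F) * \<bar>det (matrix h)\<bar> = measure lebesgue (\<Union>l\<in>F. (+) l ` C)" ..
    also have "\<dots> \<le> measure lebesgue (cbox (\<chi> i. - (s + b)) (\<chi> i. s + b) :: (real^2) set)"
    proof (rule measure_mono_fmeasurable)
      show "(\<Union>l\<in>F. (+) l ` C) \<subseteq> cbox (\<chi> i. - (s + b)) (\<chi> i. s + b)"
      proof
        fix x assume "x \<in> (\<Union>l\<in>F. (+) l ` C)"
        then obtain l u where lu: "l \<in> F" "u \<in> C" "x = l + u" by auto
        have "- (s + b) \<le> x $ i \<and> x $ i \<le> s + b" for i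
          using F(4)[OF lu(1), of i] b(2)[OF lu(2)] component_le_norm_cart[of u i] lu(3)
          unfolding abs_le_iff by simp
        then show "x \<in> cbox (\<chi> i. - (s + b)) (\<chi> i. s + b)"
          unfolding mem_box_cart by simp
      qed
      show "(\<Union>l\<in>F. (+) l ` C) \<in> sets lebesgue"
        using F(2) meas by (intro sets.finite_UN) auto
    qed auto
    also have "\<dots> = (2 * s + 2 * b)\<^sup>2"
      using F(1) b(1) by (subst measure_centered_cbox) (simp_all add: algebra_simps)
    finally show ?thesis .
  qed
  with b(1) that[of "2 * b"] show ?thesis by auto
qed

lemma finite_linear_lattice_bounded:
  fixes h :: "real^2 \<Rightarrow> real^2"
  assumes "linear h" "inj h" "bounded S"
  shows "finite {l \<in> h ` int_lattice. l \<in> S}"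
proof -
  obtain g where g: "linear g" "g \<circ> h = id"
    using linear_injective_left_inverse[OF assms(1,2)] by blast
  have "bounded (g ` S)"
    using g(1) assms(3) by (intro bounded_linear_image) (simp_all add: linear_linear)
  then have "finite (h ` (g ` S \<inter> int_lattice))"
    by (intro finite_imageI finite_int_lattice_bounded)
  moreover have "{l \<in> h ` int_lattice. l \<in> S} \<subseteq> h ` (g ` S \<inter> int_lattice)"
  proof
    fix l assume "l \<in> {l \<in> h ` int_lattice. l \<in> S}"
    then obtain z where z: "z \<in> int_lattice" "l = h z" "l \<in> S" by auto
    have "z = g l" using g(2) z(2) by (metis comp_apply id_apply)
    then show "l \<in> h ` (g ` S \<inter> int_lattice)" using z by blast
  qed
  ultimately show ?thesis by (rule rev_finite_subset)
qed

text \<open>Multiplicity of \<open>z\<close> among the vectors \<open>u + l\<close> with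
  \<open>u\<close> in \<open>us\<close> and \<open>l\<close> in \<open>L\<close>: entries of
  \<open>us\<close> that are congruent modulo \<open>L\<close> contribute the same translates, which
  must be counted repeatedly.\<close>

definition copies :: "(real^2) set \<Rightarrow> (real^2) list \<Rightarrow> real^2 \<Rightarrow> nat" where
  "copies L us z = length (filter (\<lambda>u. z - u \<in> L) us)"

lemma copies_pos_iff: "0 < copies L us z \<longleftrightarrow> (\<exists>u\<in>set us. z - u \<in> L)"
  by (auto simp: copies_def filter_empty_conv)

lemma sum_copies:
  assumes "finite T"
  shows "(\<Sum>z\<in>T. copies L us z) = (\<Sum>u\<leftarrow>us. card {z \<in> T. z - u \<in> L})"
proof (induction us)
  case (Cons u us)
  have "(\<Sum>z\<in>T. copies L (u # us) z) = (\<Sum>z\<in>T. of_bool (z - u \<in> L) + copies L us z)"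
    by (rule sum.cong) (auto simp: copies_def)
  also have "\<dots> = card {z \<in> T. z - u \<in> L} + (\<Sum>z\<in>T. copies L us z)"
    using assms by (simp add: sum.distrib Int_def)
  finally show ?case using Cons by simp
qed (simp add: copies_def)

text \<open>Double counting: the indexed copies are regrouped by the shift \<open>u\<close> they
  stem from instead of by their translation vector \<open>z\<close>.\<close>

lemma family_index_restrict:
  assumes "\<And>u. u \<in> set us \<Longrightarrow> finite {l \<in> L. u + l \<in> S}"
  shows "finite {(z, i) \<in> family_index (copies L us). z \<in> S}"
    and "card {(z, i) \<in> family_index (copies L us). z \<in> S} = (\<Sum>u\<leftarrow>us. card {l \<in> L. u + l \<in> S})"
proof -
  define T where "T = (\<Union>u\<in>set us. (+) u ` {l \<in> L. u + l \<in> S})"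
  have fin: "finite T" unfolding T_def using assms by auto
  have eq: "{(z, i) \<in> family_index (copies L us). z \<in> S} = (SIGMA z:T. {..<copies L us z})"
  proof (intro set_eqI iffI)
    fix p assume p: "p \<in> {(z, i) \<in> family_index (copies L us). z \<in> S}"
    obtain z i where zi: "p = (z, i)" by (cases p)
    then have "i < copies L us z" "z \<in> S" using p by (auto simp: family_index_def)
    moreover then obtain u where "u \<in> set us" "z - u \<in> L"
      using copies_pos_iff[of L us z] by (metis gr_zeroI less_nat_zero_code)
    then have "z \<in> T" using \<open>z \<in> S\<close> unfolding T_def by (auto intro!: bexI[of _ u] image_eqI[of _ _ "z - u"])
    ultimately show "p \<in> (SIGMA z:T. {..<copies L us z})" using zi by auto
  next
    fix p assume "p \<in> (SIGMA z:T. {..<copies L us z})"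
    then show "p \<in> {(z, i) \<in> family_index (copies L us). z \<in> S}"
      by (auto simp: T_def family_index_def)
  qed
  show "finite {(z, i) \<in> family_index (copies L us). z \<in> S}"
    unfolding eq using fin by auto
  have "card {(z, i) \<in> family_index (copies L us). z \<in> S} = (\<Sum>z\<in>T. copies L us z)"
    unfolding eq using fin by (simp add: card_SigmaI)
  also have "\<dots> = (\<Sum>u\<leftarrow>us. card {z \<in> T. z - u \<in> L})"
    by (rule sum_copies[OF fin])
  also have "map (\<lambda>u. card {z \<in> T. z - u \<in> L}) us = map (\<lambda>u. card {l \<in> L. u + l \<in> S}) us"
  proof (rule map_cong[OF refl])
    fix u assume u: "u \<in> set us"
    have "{z \<in> T. z - u \<in> L} = (+) u ` {l \<in> L. u + l \<in> S}"
    proof (intro set_eqI iffI)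
      fix z assume "z \<in> {z \<in> T. z - u \<in> L}"
      then show "z \<in> (+) u ` {l \<in> L. u + l \<in> S}"
        by (intro image_eqI[of _ _ "z - u"]) (auto simp: T_def)
    next
      fix z assume "z \<in> (+) u ` {l \<in> L. u + l \<in> S}"
      then show "z \<in> {z \<in> T. z - u \<in> L}" using u by (auto simp: T_def)
    qed
    then show "card {z \<in> T. z - u \<in> L} = card {l \<in> L. u + l \<in> S}"
      by (simp add: card_image)
  qed
  finally show "card {(z, i) \<in> family_index (copies L us). z \<in> S} = (\<Sum>u\<leftarrow>us. card {l \<in> L. u + l \<in> S})" .
qed

lemma members_at_eq:
  "members_at X Z x = {(z, i) \<in> family_index Z. z \<in> {z. x - z \<in> X}}"
  by (force simp: members_at_def)

lemma discrete_if_finite_ball: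
  fixes S :: "'a::metric_space set"
  assumes "\<And>x. finite (S \<inter> ball x 1)"
  shows "discrete S"
proof (rule discreteI)
  fix x assume x: "x \<in> S"
  have "open (ball x 1 - (S \<inter> ball x 1 - {x}))"
    using assms by (intro open_Diff open_ball finite_imp_closed) auto
  moreover have "(ball x 1 - (S \<inter> ball x 1 - {x})) \<inter> S = {x}" using x by auto
  ultimately show "x isolated_in S" unfolding isolated_in_def using x by blast
qed

lemma sum_list_le_length:
  assumes "\<And>u. u \<in> set us \<Longrightarrow> f u \<le> (M::'a::linordered_semidom)"
  shows "(\<Sum>u\<leftarrow>us. f u) \<le> of_nat (length us) * M"
  using assms by (induction us) (auto simp: algebra_simps intro!: add_mono)

lemma bounded_reflect: "bounded X \<Longrightarrow> bounded {z. x - z \<in> (X::(real^2) set)}"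
proof -
  assume "bounded X"
  then obtain D where D: "\<And>y. y \<in> X \<Longrightarrow> norm y \<le> D" by (auto simp: bounded_iff)
  have "norm z \<le> norm x + D" if "x - z \<in> X" for z
    using D[OF that] norm_triangle_ineq4[of x "x - z"] by simp
  then show ?thesis unfolding bounded_iff by blast
qed

lemma ratio_tendsto: "(\<lambda>n. K * ((real n + c) / real n)\<^sup>2) \<longlonglongrightarrow> K"
proof -
  have "(\<lambda>n. K * (1 + c * (1 / real n))\<^sup>2) \<longlonglongrightarrow> K * (1 + c * 0)\<^sup>2"
    by (intro tendsto_intros lim_1_over_n)
  moreover have "eventually (\<lambda>n. K * (1 + c * (1 / real n))\<^sup>2 = K * ((real n + c) / real n)\<^sup>2) sequentially"
    using eventually_gt_at_top[of 0] by eventually_elim (simp add: field_simps)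
  ultimately show ?thesis by (simp add: Lim_transform_eventually)
qed

section \<open>Degree, density and covered area for translates along a lattice\<close>

locale lattice_translates =
  fixes h :: "real^2 \<Rightarrow> real^2" and us :: "(real^2) list" and L :: "(real^2) set"
  assumes linear_h: "linear h" and inj_h: "inj h"
  defines "L \<equiv> h ` int_lattice"
begin

lemma L_diff: "l \<in> L \<Longrightarrow> l' \<in> L \<Longrightarrow> l - l' \<in> L"
proof -
  assume "l \<in> L" "l' \<in> L"
  then obtain z z' where "l = h z" "l' = h z'" "z \<in> int_lattice" "z' \<in> int_lattice"
    by (auto simp: L_def)
  then have "l - l' = h (z - z')" "z - z' \<in> int_lattice"
    using linear_diff[OF linear_h] int_lattice_diff by auto
  then show ?thesis by (auto simp: L_def)
qed

lemma finite_L_bounded: "bounded S \<Longrightarrow> finite {l \<in> L. u + l \<in> S}"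
proof -
  assume "bounded S"
  then have "finite {l \<in> L. l \<in> (\<lambda>x. x - u) ` S}"
    unfolding L_def by (intro finite_linear_lattice_bounded linear_h inj_h bounded_translation_minus)
  moreover have "l \<in> (\<lambda>x. x - u) ` S" if "u + l \<in> S" for l
    by (rule image_eqI[OF _ that]) simp
  ultimately show ?thesis by (elim rev_finite_subset) auto
qed

lemma finite_members_at: "bounded X \<Longrightarrow> finite (members_at X (copies L us) x)"
  unfolding members_at_eq by (intro family_index_restrict(1) finite_L_bounded bounded_reflect)

lemma card_members_at:
  "bounded X \<Longrightarrow> card (members_at X (copies L us) x) = (\<Sum>u\<leftarrow>us. card {l \<in> L. x - u - l \<in> X})"
  unfolding members_at_eq
  by (subst family_index_restrict(2)[OF finite_L_bounded[OF bounded_reflect]]) (simp_all add: diff_diff_eq)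

text \<open>Relative to one contributing vector \<open>l0\<close>, all other contributing vectors
  lie in a fixed ball of radius twice the bound on \<open>X\<close>, so the count is bounded
  uniformly in \<open>x\<close>.\<close>

lemma card_lattice_le:
  assumes "bounded X"
  shows "\<exists>M. \<forall>x. card {l \<in> L. x - l \<in> X} \<le> M"
proof -
  obtain D where D: "\<And>x. x \<in> X \<Longrightarrow> norm x \<le> D"
    using assms by (auto simp: bounded_iff)
  let ?S = "{l \<in> L. 0 + l \<in> cball 0 (2 * D)}"
  have fin: "finite ?S" by (rule finite_L_bounded) simp
  have "card {l \<in> L. x - l \<in> X} \<le> card ?S" for x
  proof (cases "{l \<in> L. x - l \<in> X} = {}")
    case False
    then obtain l0 where l0: "l0 \<in> L" "x - l0 \<in> X" by auto
    have "l - l0 \<in> ?S" if "l \<in> L" "x - l \<in> X" for l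
    proof -
      have "norm (l - l0) = norm ((x - l0) - (x - l))" by simp
      also have "\<dots> \<le> norm (x - l0) + norm (x - l)" by (rule norm_triangle_ineq4)
      also have "\<dots> \<le> 2 * D" using D[OF l0(2)] D[OF that(2)] by simp
      finally show ?thesis using L_diff[OF that(1) l0(1)] by simp
    qed
    then show ?thesis
      by (intro card_inj_on_le[of "\<lambda>l. l - l0"] fin) (auto simp: inj_on_def)
  next
    case True
    then show ?thesis by (simp only: card.empty)
  qed
  then show ?thesis by blast
qed

lemma bounded_degree_copies:
  assumes "bounded X"
  shows "uniformly_bounded_degree X (copies L us)"
proof -
  obtain M where M: "\<And>x. card {l \<in> L. x - l \<in> X} \<le> M"
    using card_lattice_le[OF assms] by blast
  have "card (members_at X (copies L us) x) \<le> length us * M" for x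
    unfolding card_members_at[OF assms] using sum_list_le_length[of us _ M] M by simp
  then show ?thesis
    unfolding uniformly_bounded_degree_def using finite_members_at[OF assms] by blast
qed

lemma discrete_support: "discrete {z. 0 < copies L us z}"
proof (rule discrete_if_finite_ball)
  fix x :: "real^2"
  have "{z. 0 < copies L us z} \<inter> ball x 1 = (\<Union>u\<in>set us. (+) u ` {l \<in> L. u + l \<in> ball x 1})"
  proof (intro set_eqI iffI)
    fix z assume "z \<in> {z. 0 < copies L us z} \<inter> ball x 1"
    then obtain u where "u \<in> set us" "z - u \<in> L" "z \<in> ball x 1"
      unfolding copies_pos_iff by blast
    then show "z \<in> (\<Union>u\<in>set us. (+) u ` {l \<in> L. u + l \<in> ball x 1})"
      by (intro UN_I[of u] image_eqI[of _ _ "z - u"]) simp_all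
  next
    fix z assume "z \<in> (\<Union>u\<in>set us. (+) u ` {l \<in> L. u + l \<in> ball x 1})"
    then obtain u l where "u \<in> set us" "l \<in> L" "z = u + l" "z \<in> ball x 1" by blast
    moreover from this have "z - u \<in> L" by simp
    ultimately show "z \<in> {z. 0 < copies L us z} \<inter> ball x 1"
      unfolding copies_pos_iff by blast
  qed
  then show "finite ({z. 0 < copies L us z} \<inter> ball x 1)"
    using finite_L_bounded[OF bounded_ball] by simp
qed

definition covolume :: real where "covolume = \<bar>det (matrix h)\<bar>"

lemma covolume_pos: "covolume > 0"
  using det_nz_iff_inj[OF linear_h] inj_h by (simp add: covolume_def)

lemma nonneg_if_length_le:
  assumes "real (length us) \<le> covolume * t"
  shows "t \<ge> 0"
proof -
  have "0 \<le> covolume * t" using assms of_nat_0_le_iff by (rule order_trans[rotated])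
  then show ?thesis using covolume_pos by (simp add: zero_le_mult_iff)
qed

text \<open>A translate meeting the square of side \<open>n\<close> has its lattice vector in a
  square of side \<open>n + 2 * (D + U)\<close>, where \<open>D\<close> and \<open>U\<close> bound
  \<open>X\<close> and \<open>us\<close>. The rest of \<open>c\<close> is the slack
  \<open>c0\<close> of packing cells into that square. Everything depends on \<open>n\<close> only
  through the side length, so \<open>c\<close> disappears in the limit.\<close>

lemma card_meeting_square:
  fixes X :: "(real^2) set"
  assumes "bounded X"
  obtains c where "c \<ge> 0"
    "\<And>n u. u \<in> set us \<Longrightarrow> finite {l \<in> L. centered_square n \<inter> translate X (u + l) \<noteq> {}}"
    "\<And>n u. u \<in> set us \<Longrightarrow>
      real (card {l \<in> L. centered_square n \<inter> translate X (u + l) \<noteq> {}}) * covolume \<le> (real n + c)\<^sup>2"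
proof -
  obtain c0 where c0: "c0 \<ge> 0" "\<And>s F. s \<ge> 0 \<Longrightarrow> finite F \<Longrightarrow> F \<subseteq> L \<Longrightarrow>
    (\<And>x i. x \<in> F \<Longrightarrow> \<bar>x $ i\<bar> \<le> s) \<Longrightarrow> real (card F) * covolume \<le> (2 * s + c0)\<^sup>2"
    using card_lattice_points_box[OF linear_h inj_h] unfolding L_def covolume_def by blast
  obtain D where D: "D \<ge> 0" "\<And>x. x \<in> X \<Longrightarrow> norm x \<le> D"
    using assms by (meson bounded_pos less_imp_le)
  obtain U where U: "U \<ge> 0" "\<And>u. u \<in> set us \<Longrightarrow> norm u \<le> U"
    using finite_imp_bounded[of "set us"] by (meson bounded_pos finite_set less_imp_le)
  define c where "c = 2 * (D + U) + c0"
  have comp: "\<bar>l $ i\<bar> \<le> real n / 2 + D + U"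
    if ul: "u \<in> set us" "centered_square n \<inter> translate X (u + l) \<noteq> {}" for u l n i
  proof -
    obtain x where x: "x \<in> X" "x + (u + l) \<in> centered_square n" using ul(2) by auto
    have "\<bar>(x + (u + l)) $ i\<bar> \<le> real n / 2"
    proof -
      have "- (real n / 2) \<le> (x + (u + l)) $ i \<and> (x + (u + l)) $ i \<le> real n / 2"
        using x(2) by (simp add: centered_square_def mem_box_cart)
      then show ?thesis by linarith
    qed
    moreover have "\<bar>x $ i\<bar> \<le> D" using D(2)[OF x(1)] component_le_norm_cart[of x i] by simp
    moreover have "\<bar>u $ i\<bar> \<le> U" using U(2)[OF ul(1)] component_le_norm_cart[of u i] by simp
    ultimately show ?thesis unfolding vector_add_component by linarith
  qed
  have fin: "finite {l \<in> L. centered_square n \<inter> translate X (u + l) \<noteq> {}}" if "u \<in> set us" for n u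
  proof -
    let ?S = "cbox (\<chi> i. - (real n / 2 + D + U)) (\<chi> i. real n / 2 + D + U) :: (real^2) set"
    have "finite {l \<in> L. 0 + l \<in> ?S}"
      by (rule finite_L_bounded) (rule bounded_cbox)
    moreover have "l \<in> ?S" if "centered_square n \<inter> translate X (u + l) \<noteq> {}" for l
    proof -
      have "- (real n / 2 + D + U) \<le> l $ i \<and> l $ i \<le> real n / 2 + D + U" for i
        using comp[OF \<open>u \<in> set us\<close> that, of i] by linarith
      then show ?thesis unfolding mem_box_cart by simp
    qed
    ultimately show ?thesis by (rule_tac rev_finite_subset) auto
  qed
  have card: "real (card {l \<in> L. centered_square n \<inter> translate X (u + l) \<noteq> {}}) * covolume \<le> (real n + c)\<^sup>2"
    if "u \<in> set us" for n u
  proof -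
    have "real (card {l \<in> L. centered_square n \<inter> translate X (u + l) \<noteq> {}}) * covolume
        \<le> (2 * (real n / 2 + D + U) + c0)\<^sup>2"
      using D(1) U(1) by (intro c0(2) fin that) (auto intro: comp[OF that])
    then show ?thesis by (simp add: c_def algebra_simps)
  qed
  have "c \<ge> 0" using c0(1) D(1) U(1) by (simp add: c_def)
  then show ?thesis using fin card that by blast
qed

text \<open>Here \<open>t\<close> bounds the number of translates per unit area, and each translate
  contributes at most \<open>area X\<close>.\<close>

lemma cover_density_le:
  assumes X: "bounded X" "X \<in> lmeasurable" and len: "real (length us) \<le> covolume * t"
  shows "cover_density X (copies L us) \<le> ennreal (area X * t)"
proof -
  obtain c where c: "c \<ge> 0"
    "\<And>n u. u \<in> set us \<Longrightarrow> finite {l \<in> L. centered_square n \<inter> translate X (u + l) \<noteq> {}}"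
    "\<And>n u. u \<in> set us \<Longrightarrow>
      real (card {l \<in> L. centered_square n \<inter> translate X (u + l) \<noteq> {}}) * covolume \<le> (real n + c)\<^sup>2"
    using card_meeting_square[OF X(1)] by blast
  let ?I = "family_index (copies L us)"
  let ?f = "\<lambda>n (z, i::nat). emeasure lebesgue (centered_square n \<inter> translate X z)"
  have term_le: "(\<Sum>\<^sub>\<infinity>p\<in>?I. ?f n p) / of_nat n ^ 2 \<le> ennreal (area X * t * ((real n + c) / real n)\<^sup>2)"
    if n: "n > 0" for n
  proof -
    let ?S = "{z. centered_square n \<inter> translate X z \<noteq> {}}"
    let ?A = "{(z, i) \<in> ?I. z \<in> ?S}"
    have finA: "finite ?A" and cardA: "card ?A = (\<Sum>u\<leftarrow>us. card {l \<in> L. u + l \<in> ?S})"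
      using family_index_restrict[of us L ?S] c(2)[of _ n] by simp_all
    have "(\<Sum>\<^sub>\<infinity>p\<in>?I. ?f n p) = (\<Sum>\<^sub>\<infinity>p\<in>?A. ?f n p)"
      by (rule infsum_cong_neutral) auto
    also have "\<dots> = (\<Sum>p\<in>?A. ?f n p)" using finA by (rule infsum_finite)
    \<comment> \<open>Translates cut by the border of the square are counted with their full area;
      this changes only lower order terms.\<close>
    also have "\<dots> \<le> (\<Sum>p\<in>?A. ennreal (area X))"
    proof (rule sum_mono)
      fix p assume "p \<in> ?A"
      obtain z i where p: "p = (z, i)" by (cases p)
      have T: "translate X z = (+) z ` X" by (auto simp: add.commute)
      have "translate X z \<in> lmeasurable" unfolding T by (rule measurable_translation[OF X(2)])
      then have "emeasure lebesgue (centered_square n \<inter> translate X z) \<le> emeasure lebesgue (translate X z)"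
        by (intro emeasure_mono) auto
      also have "\<dots> = ennreal (area (translate X z))"
        by (rule emeasure_eq_measure2) fact
      also have "area (translate X z) = area X" unfolding T by (rule measure_translation)
      finally show "?f n p \<le> ennreal (area X)" by (simp add: p)
    qed
    also have "\<dots> = ennreal (real (card ?A) * area X)"
      by (simp add: ennreal_of_nat_eq_real_of_nat ennreal_mult)
    finally have le: "(\<Sum>\<^sub>\<infinity>p\<in>?I. ?f n p) \<le> ennreal (real (card ?A) * area X)" .
    have "real (card ?A) \<le> t * (real n + c)\<^sup>2"
    proof -
      have "real (card ?A) = (\<Sum>u\<leftarrow>us. real (card {l \<in> L. u + l \<in> ?S}))"
        unfolding cardA by (rule of_nat_sum_list_map)
      also have "\<dots> \<le> of_nat (length us) * ((real n + c)\<^sup>2 / covolume)"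
        using c(3) covolume_pos by (intro sum_list_le_length) (simp add: field_simps)
      also have "\<dots> \<le> (covolume * t) * ((real n + c)\<^sup>2 / covolume)"
        using len covolume_pos by (intro mult_right_mono) auto
      finally show ?thesis using covolume_pos by simp
    qed
    then have "real (card ?A) * area X \<le> t * (real n + c)\<^sup>2 * area X"
      by (rule mult_right_mono) simp
    then have "real (card ?A) * area X \<le> area X * t * (real n + c)\<^sup>2"
      by (simp only: ac_simps)
    then have "(\<Sum>\<^sub>\<infinity>p\<in>?I. ?f n p) \<le> ennreal (area X * t * (real n + c)\<^sup>2)"
      using le ennreal_leI order_trans by blast
    then have "(\<Sum>\<^sub>\<infinity>p\<in>?I. ?f n p) / of_nat n ^ 2 \<le> ennreal (area X * t * (real n + c)\<^sup>2) / of_nat n ^ 2"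
      by (rule divide_right_mono_ennreal)
    also have "\<dots> = ennreal (area X * t * (real n + c)\<^sup>2) / ennreal (real n ^ 2)"
      by (simp add: ennreal_of_nat_eq_real_of_nat ennreal_power)
    also have "\<dots> = ennreal (area X * t * (real n + c)\<^sup>2 / real n ^ 2)"
    proof (rule divide_ennreal)
      have "t \<ge> 0" using len by (rule nonneg_if_length_le)
      then show "0 \<le> area X * t * (real n + c)\<^sup>2" by simp
      show "0 < real n ^ 2" using n by simp
    qed
    finally show ?thesis by (simp add: power_divide)
  qed
  have "cover_density X (copies L us) \<le> liminf (\<lambda>n. ennreal (area X * t * ((real n + c) / real n)\<^sup>2))"
    unfolding cover_density_def
    by (rule Liminf_mono, rule eventually_mono[OF eventually_gt_at_top[of 0]]) (rule term_le)
  also have "\<dots> = ennreal (area X * t)"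
    by (intro lim_imp_Liminf tendsto_ennrealI ratio_tendsto) simp
  finally show ?thesis .
qed

text \<open>A cover has density at least 1: the translates of \<open>Y\<close> meeting the square of
  side \<open>n\<close> fill it up to a null set, while their total area is at most
  \<open>t * area Y * (n + c)^2\<close>. Dividing by \<open>n^2\<close> and letting \<open>n\<close>
  grow gives the claim.\<close>

lemma area_ge_if_covers:
  assumes Y: "bounded Y" "Y \<in> lmeasurable" and len: "real (length us) \<le> covolume * t"
    and cover: "AE x in lebesgue. \<exists>u\<in>set us. \<exists>l\<in>L. x - u - l \<in> Y"
  shows "1 \<le> t * area Y"
proof -
  obtain c where c: "c \<ge> 0"
    "\<And>n u. u \<in> set us \<Longrightarrow> finite {l \<in> L. centered_square n \<inter> translate Y (u + l) \<noteq> {}}"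
    "\<And>n u. u \<in> set us \<Longrightarrow>
      real (card {l \<in> L. centered_square n \<inter> translate Y (u + l) \<noteq> {}}) * covolume \<le> (real n + c)\<^sup>2"
    using card_meeting_square[OF Y(1)] by blast
  have meas: "translate Y z \<in> lmeasurable" "area (translate Y z) = area Y" for z
    using measurable_translation[OF Y(2), of z] measure_translation[of z Y]
    by (simp_all add: add.commute[of z])
  have bound: "1 \<le> t * area Y * ((real n + c) / real n)\<^sup>2" if n: "n > 0" for n
  proof -
    let ?F = "\<lambda>u. {l \<in> L. centered_square n \<inter> translate Y (u + l) \<noteq> {}}"
    let ?V = "\<Union>u\<in>set us. \<Union>l\<in>?F u. translate Y (u + l)"
    have V: "?V \<in> lmeasurable"
      by (intro fmeasurable.finite_UN finite_set c(2) meas)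
    have "(real n)\<^sup>2 = area (centered_square n)"
      using measure_centered_cbox[of "real n / 2"] by (simp add: centered_square_def)
    also have "\<dots> \<le> area ?V"
    proof -
      have "emeasure lebesgue (centered_square n) \<le> emeasure lebesgue ?V"
      proof (rule emeasure_mono_AE)
        show "AE x in lebesgue. x \<in> centered_square n \<longrightarrow> x \<in> ?V"
          using cover
        proof eventually_elim
          case (elim x)
          show ?case
          proof
            assume x: "x \<in> centered_square n"
            obtain u l where ul: "u \<in> set us" "l \<in> L" "x - u - l \<in> Y" using elim by blast
            then have "x \<in> translate Y (u + l)"
              by (auto intro!: image_eqI[of _ _ "x - u - l"])
            then show "x \<in> ?V" using x ul by blast
          qed
        qed
        show "?V \<in> sets lebesgue" using V by auto
      qed
      moreover have "centered_square n \<in> lmeasurable" by (simp add: centered_square_def)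
      ultimately show ?thesis
        unfolding emeasure_eq_measure2[OF V] by (simp add: emeasure_eq_measure2)
    qed
    also have "\<dots> \<le> (\<Sum>u\<in>set us. area (\<Union>l\<in>?F u. translate Y (u + l)))"
      using c(2) meas by (intro measure_UNION_le sets.finite_UN) auto
    also have "\<dots> \<le> (\<Sum>u\<in>set us. (real n + c)\<^sup>2 / covolume * area Y)"
    proof (rule sum_mono)
      fix u assume u: "u \<in> set us"
      have "area (\<Union>l\<in>?F u. translate Y (u + l)) \<le> (\<Sum>l\<in>?F u. area (translate Y (u + l)))"
        using c(2)[OF u] meas by (intro measure_UNION_le) auto
      also have "\<dots> = real (card (?F u)) * area Y" by (simp only: meas(2)) simp
      also have "\<dots> \<le> (real n + c)\<^sup>2 / covolume * area Y"
        using c(3)[OF u, of n] covolume_pos by (intro mult_right_mono) (auto simp: field_simps)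
      finally show "area (\<Union>l\<in>?F u. translate Y (u + l)) \<le> (real n + c)\<^sup>2 / covolume * area Y" .
    qed
    also have "\<dots> = real (card (set us)) * ((real n + c)\<^sup>2 / covolume * area Y)" by simp
    also have "\<dots> \<le> (covolume * t) * ((real n + c)\<^sup>2 / covolume * area Y)"
      using len card_length[of us] covolume_pos by (intro mult_right_mono) auto
    also have "\<dots> = t * area Y * (real n + c)\<^sup>2" using covolume_pos by simp
    finally show ?thesis using n by (simp add: power_divide field_simps)
  qed
  show ?thesis
    by (rule tendsto_lowerbound[OF ratio_tendsto[of "t * area Y" c]],
        rule eventually_mono[OF eventually_gt_at_top[of 0]], rule bound) simp_all
qed

end

text \<open>One further translate flips the parity exactly on itself, so the set changes by a
  symmetric difference with it.\<close>

lemma odd_translates_bounded_lmeasurable: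
  fixes X :: "(real^2) set"
  assumes X: "bounded X" "X \<in> lmeasurable" and "finite K"
  shows "bounded {x. odd (card {k \<in> K. x - k \<in> X})} \<and>
         {x. odd (card {k \<in> K. x - k \<in> X})} \<in> lmeasurable"
  using assms(3)
proof induction
  case (insert k K)
  let ?Y = "{x. odd (card {k \<in> K. x - k \<in> X})}" and ?T = "(+) k ` X"
  have mem: "x \<in> ?T \<longleftrightarrow> x - k \<in> X" for x
    by (auto intro!: image_eqI[of _ _ "x - k"])
  have "{x. odd (card {k' \<in> insert k K. x - k' \<in> X})} = (?Y - ?T) \<union> (?T - ?Y)"
  proof (intro set_eqI)
    fix x
    have "{k' \<in> insert k K. x - k' \<in> X} =
        (if x \<in> ?T then insert k {k' \<in> K. x - k' \<in> X} else {k' \<in> K. x - k' \<in> X})"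
      unfolding mem by auto
    then have "odd (card {k' \<in> insert k K. x - k' \<in> X}) \<longleftrightarrow>
        (odd (card {k' \<in> K. x - k' \<in> X}) \<noteq> (x \<in> ?T))"
      using insert.hyps by simp
    then show "x \<in> {x. odd (card {k' \<in> insert k K. x - k' \<in> X})} \<longleftrightarrow> x \<in> (?Y - ?T) \<union> (?T - ?Y)"
      by blast
  qed
  moreover have "bounded ?T" "?T \<in> lmeasurable"
    using X by (auto intro: bounded_translation measurable_translation)
  ultimately show ?case
    using insert.IH
    by (auto intro: bounded_subset[of "?Y \<union> ?T"] fmeasurable.Un fmeasurable.Diff)
qed simp

section \<open>Parity of finite sums and affine invariance of null sets\<close>

lemma mem_translate_iff: "x \<in> translate X k \<longleftrightarrow> x - k \<in> X"
  by (auto intro!: image_eqI[of _ _ "x - k"])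

lemma odd_sum_listD: "odd (\<Sum>u\<leftarrow>us. f u :: nat) \<Longrightarrow> \<exists>u\<in>set us. odd (f u)"
  by (induction us) auto

lemma odd_sumD: "odd (\<Sum>u\<in>S. f u :: nat) \<Longrightarrow> \<exists>u\<in>S. odd (f u)"
  by (metis dvd_sum)

lemma odd_sum_iff_odd_card:
  assumes "finite K" "\<And>k. k \<in> K \<Longrightarrow> odd (f k :: nat)"
  shows "odd (\<Sum>k\<in>K. f k) \<longleftrightarrow> odd (card K)"
  using assms by induction auto

lemma sum_card_swap:
  assumes "finite A" "finite B"
  shows "(\<Sum>a\<in>A. card {b \<in> B. R a b}) = (\<Sum>b\<in>B. card {a \<in> A. R a b})"
proof -
  have "(\<Sum>a\<in>A. card {b \<in> B. R a b}) = (\<Sum>a\<in>A. \<Sum>b\<in>B. of_bool (R a b))"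
    using assms by (simp add: Int_def)
  also have "\<dots> = (\<Sum>b\<in>B. \<Sum>a\<in>A. of_bool (R a b))" by (rule sum.swap)
  also have "\<dots> = (\<Sum>b\<in>B. card {a \<in> A. R a b})"
    using assms by (simp add: Int_def)
  finally show ?thesis .
qed

lemma AE_lebesgue_affine:
  fixes f :: "real^2 \<Rightarrow> real^2"
  assumes f: "linear f" "inj f" and ae: "AE x in lebesgue. R x"
  shows "AE x in lebesgue. R (f x + c)"
proof -
  obtain g where g: "linear g" "\<And>x. g (f x) = x"
    using linear_injective_left_inverse[OF f] by (metis comp_apply id_apply)
  obtain N where N: "N \<in> null_sets lebesgue" "{x. \<not> R x} \<subseteq> N"
    using ae unfolding eventually_ae_filter by auto
  then have "negligible ((+) (- c) ` N)"
    by (intro negligible_translation) (simp add: negligible_iff_null_sets)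
  then have "negligible (g ` (+) (- c) ` N)"
    using measurable_linear_image[OF g(1)] measure_linear_image[OF g(1)] by (simp add: negligible_iff_measure)
  then have "g ` (+) (- c) ` N \<in> null_sets lebesgue" by (simp add: negligible_iff_null_sets)
  then show ?thesis
  proof (rule AE_I')
    show "{x \<in> space lebesgue. \<not> R (f x + c)} \<subseteq> g ` (+) (- c) ` N"
    proof
      fix x assume "x \<in> {x \<in> space lebesgue. \<not> R (f x + c)}"
      then have "f x + c \<in> N" using N(2) by auto
      then show "x \<in> g ` (+) (- c) ` N"
        using g(2)[of x] by (intro image_eqI[of _ _ "f x"] image_eqI[of _ _ "f x + c"]) simp_all
    qed
  qed
qed

lemma AE_lebesgue_translate:
  fixes a :: "real^2"
  assumes "AE x in lebesgue. R x"
  shows "AE x in lebesgue. R (x - a)"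
  using AE_lebesgue_affine[OF linear_id _ assms, of "- a"] by simp

context lattice_translates
begin

lemma odd_cover_copies:
  assumes "bounded X" "AE x in lebesgue. odd (\<Sum>u\<leftarrow>us. card {l \<in> L. x - u - l \<in> X})"
  shows "odd_cover X (copies L us)"
  unfolding odd_cover_def card_members_at[OF assms(1)]
  using assms discrete_support bounded_degree_copies by blast

text \<open>The translates of an odd cover by an odd number of vectors together form an odd cover, and
  regrouping them shows that the points covered an odd number of times by \<open>K\<close> still cover.\<close>

lemma odd_area_ge:
  assumes X: "bounded X" "X \<in> lmeasurable" and len: "real (length us) \<le> covolume * t"
    and odd: "AE x in lebesgue. odd (\<Sum>u\<leftarrow>us. card {l \<in> L. x - u - l \<in> X})"
  shows "t > 0" "odd_area X \<ge> 1 / t"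
proof -
  have bound: "1 \<le> t * area {x. odd (card {k \<in> K. x - k \<in> X})}"
    if K: "finite K" "odd (card K)" for K
  proof (rule area_ge_if_covers[OF _ _ len])
    let ?Y = "{x. odd (card {k \<in> K. x - k \<in> X})}"
    show "bounded ?Y" "?Y \<in> lmeasurable"
      using odd_translates_bounded_lmeasurable[OF X K(1)] by blast+
    have "AE x in lebesgue. \<forall>k\<in>K. odd (\<Sum>u\<leftarrow>us. card {l \<in> L. x - k - u - l \<in> X})"
      by (intro AE_finite_allI K(1) AE_lebesgue_translate[OF odd])
    then show "AE x in lebesgue. \<exists>u\<in>set us. \<exists>l\<in>L. x - u - l \<in> ?Y"
    proof eventually_elim
      case (elim x)
      \<comment> \<open>The lattice vectors that contribute at \<open>x\<close> for some
        \<open>k\<close>; a finite set common to all \<open>k\<close> allows the sums over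
        \<open>k\<close> and \<open>l\<close> to be exchanged.\<close>
      let ?A = "\<lambda>u. \<Union>k\<in>K. {l \<in> L. x - k - u - l \<in> X}"
      have fin: "finite (?A u)" for u
      proof (intro finite_UN_I K(1))
        fix k
        have "finite {l \<in> L. 0 + l \<in> {z. x - k - u - z \<in> X}}"
          by (intro finite_L_bounded bounded_reflect X(1))
        then show "finite {l \<in> L. x - k - u - l \<in> X}" by simp
      qed
      \<comment> \<open>An odd number of odd counts. Regrouped by \<open>u\<close> and
        \<open>l\<close>, some group must have odd size, and this says that the translate of
        \<open>?Y\<close> by \<open>u + l\<close> contains \<open>x\<close>.\<close>
      have "odd (\<Sum>k\<in>K. \<Sum>u\<leftarrow>us. card {l \<in> L. x - k - u - l \<in> X})"
        by (subst odd_sum_iff_odd_card[OF K(1)]) (use elim K(2) in auto)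
      also have "(\<Sum>k\<in>K. \<Sum>u\<leftarrow>us. card {l \<in> L. x - k - u - l \<in> X}) =
          (\<Sum>u\<leftarrow>us. \<Sum>k\<in>K. card {l \<in> L. x - k - u - l \<in> X})"
        by (induction us) (simp_all add: sum.distrib)
      finally obtain u where u: "u \<in> set us" "odd (\<Sum>k\<in>K. card {l \<in> L. x - k - u - l \<in> X})"
        using odd_sum_listD by blast
      have "(\<Sum>k\<in>K. card {l \<in> L. x - k - u - l \<in> X}) = (\<Sum>k\<in>K. card {l \<in> ?A u. x - k - u - l \<in> X})"
        by (intro sum.cong refl arg_cong[of _ _ card]) blast
      also have "\<dots> = (\<Sum>l\<in>?A u. card {k \<in> K. x - k - u - l \<in> X})"
        by (rule sum_card_swap[OF K(1) fin])
      finally have "odd (\<Sum>l\<in>?A u. card {k \<in> K. x - k - u - l \<in> X})"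
        using u(2) by (rule back_subst[where P = odd, rotated])
      from odd_sumD[OF this] obtain l where "l \<in> ?A u" "odd (card {k \<in> K. x - k - u - l \<in> X})" ..
      moreover have "x - k - u - l = x - u - l - k" for k by (simp add: algebra_simps)
      ultimately have "l \<in> L" "x - u - l \<in> ?Y" by auto
      then show ?case using u(1) by blast
    qed
  qed
  show t: "t > 0"
  proof (rule ccontr)
    assume "\<not> t > 0"
    \<comment> \<open>The single translate \<open>K = {0}\<close> already forces \<open>t\<close> to
      be positive.\<close>
    then have "t * area {x. odd (card {k \<in> {0}. x - k \<in> X})} \<le> 0"
      by (intro mult_nonpos_nonneg) auto
    moreover have "1 \<le> t * area {x. odd (card {k \<in> {0}. x - k \<in> X})}" by (rule bound) auto
    ultimately show False by simp
  qed
  show "odd_area X \<ge> 1 / t"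
    unfolding odd_area_def mem_translate_iff
  proof (rule cINF_greatest)
    show "{K :: (real^2) set. finite K \<and> odd (card K)} \<noteq> {}"
      by (auto intro!: exI[of _ "{0}"])
    show "1 / t \<le> area {x. odd (card {k \<in> K. x - k \<in> X})}"
      if "K \<in> {K. finite K \<and> odd (card K)}" for K
      using bound[of K] that t by (simp add: field_simps)
  qed
qed

end

section \<open>Polygons and their affine images\<close>

lemma cross2_linear:
  fixes f :: "real^2 \<Rightarrow> real^2"
  assumes "linear f"
  shows "cross2 (f u) (f v) = det (matrix f) * cross2 u v"
proof -
  have f: "f x = matrix f *v x" for x using matrix_works[of f x] assms by simp
  show ?thesis unfolding f[of u] f[of v]
    by (simp add: cross2_def det_2 matrix_vector_mult_def sum_2 algebra_simps)
qed

lemma cross2_eq_0_imp_multiple: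
  assumes "cross2 u v = 0" "u \<noteq> 0"
  shows "\<exists>c. v = c *\<^sub>R u"
proof -
  have e: "u $ 1 * v $ 2 = u $ 2 * v $ 1" using assms(1) by (simp add: cross2_def)
  show ?thesis
  proof (cases "u $ 1 = 0")
    case True
    then have "u $ 2 \<noteq> 0" using assms(2) vec2_eqI[of u 0] by auto
    then have "v = (v $ 2 / u $ 2) *\<^sub>R u"
      using True e by (intro vec2_eqI) auto
    then show ?thesis by blast
  next
    case False
    then have "v = (v $ 1 / u $ 1) *\<^sub>R u"
      using e by (intro vec2_eqI) (auto simp: field_simps)
    then show ?thesis by blast
  qed
qed

lemma cross2_scaleR: "cross2 (a *\<^sub>R u) (b *\<^sub>R v) = a * b * cross2 u v"
  by (simp add: cross2_def algebra_simps)

lemma cross2_self: "cross2 u u = 0"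
  by (simp add: cross2_def)

lemma span_singleton_eq_iff:
  assumes "u \<noteq> 0" "v \<noteq> (0 :: real^2)"
  shows "span {u} = span {v} \<longleftrightarrow> cross2 u v = 0"
proof
  assume "span {u} = span {v}"
  then have "v \<in> span {u}" by (auto intro: span_base)
  then show "cross2 u v = 0" using cross2_scaleR[of 1 u _ u] cross2_self
    by (auto simp: span_singleton)
next
  assume "cross2 u v = 0"
  then obtain c where c: "v = c *\<^sub>R u" using cross2_eq_0_imp_multiple assms by blast
  then have "(1 / c) *\<^sub>R v = u" using assms(2) by auto
  then have "u \<in> span {v}" by (metis insertI1 span_base span_scale)
  moreover have "v \<in> span {u}" unfolding c by (intro span_scale span_base) simp
  ultimately have "u \<in> span {v}" "v \<in> span {u}" by blast+
  then show "span {u} = span {v}" by (simp add: span_eq)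
qed

lemma collinear_iff_cross2: "collinear {a, b, c :: real^2} \<longleftrightarrow> cross2 (a - b) (c - b) = 0"
proof -
  have "collinear {a, b, c} \<longleftrightarrow> collinear {0, a - b, c - b}"
    by (auto simp: collinear_def)
  also have "\<dots> \<longleftrightarrow> cross2 (a - b) (c - b) = 0"
    unfolding collinear_lemma
    using cross2_eq_0_imp_multiple[of "a - b" "c - b"] cross2_scaleR[of 1 "a - b" _ "a - b"] cross2_self
    by (auto simp: cross2_def[of 0] cross2_def[of _ 0])
  finally show ?thesis .
qed

section \<open>The boundary curve and the region of a polygon\<close>

lemma pathstart_polygonal_path: "xs \<noteq> [] \<Longrightarrow> pathstart (polygonal_path xs) = hd xs"
  by (induction xs rule: polygonal_path.induct) auto

lemma pathfinish_polygonal_path: "xs \<noteq> [] \<Longrightarrow> pathfinish (polygonal_path xs) = last xs"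
  by (induction xs rule: polygonal_path.induct) auto

lemma path_image_polygonal_path:
  "2 \<le> length xs \<Longrightarrow>
     path_image (polygonal_path xs) = (\<Union>(a, b)\<in>set (zip xs (tl xs)). closed_segment a b)"
proof (induction xs rule: polygonal_path.induct)
  case (4 a b c vs)
  have "path_image (polygonal_path (a # b # c # vs)) =
      closed_segment a b \<union> path_image (polygonal_path (b # c # vs))"
    by (simp add: path_image_join pathstart_polygonal_path)
  then show ?case using 4 by simp
qed auto

lemma path_image_polygon_boundary:
  assumes "vs \<noteq> []"
  shows "path_image (polygon_boundary vs) = (\<Union>(a, b)\<in>polygon_edges vs. closed_segment a b)"
proof -
  have "zip (vs @ [hd vs]) (tl (vs @ [hd vs])) = zip vs (rotate1 vs)"
  proof -
    have "tl (vs @ [hd vs]) = rotate1 vs" using assms by (cases vs) simp_all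
    then show ?thesis by (simp add: zip_append1)
  qed
  moreover have "2 \<le> length (vs @ [hd vs])" using assms by (cases vs) auto
  ultimately show ?thesis
    unfolding polygon_boundary_def polygon_edges_def by (simp only: path_image_polygonal_path)
qed

lemma pathfinish_polygon_boundary:
  "vs \<noteq> [] \<Longrightarrow> pathfinish (polygon_boundary vs) = pathstart (polygon_boundary vs)"
  by (simp add: polygon_boundary_def pathstart_polygonal_path pathfinish_polygonal_path)

lemma polygon_edge_nth:
  "i < length vs \<Longrightarrow> (vs ! i, vs ! ((i + 1) mod length vs)) \<in> polygon_edges vs"
  unfolding polygon_edges_def
  by (auto simp: set_zip nth_rotate1 intro!: exI[of _ i])

lemma polygon_edgeE:
  assumes "(a, b) \<in> polygon_edges vs"
  obtains i where "i < length vs" "a = vs ! i" "b = vs ! ((i + 1) mod length vs)"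
  using assms unfolding polygon_edges_def by (auto simp: set_zip nth_rotate1)

lemma finite_polygon_edges: "finite (polygon_edges vs)"
  by (simp add: polygon_edges_def)

lemma polygon_edge_ends: "(a, b) \<in> polygon_edges vs \<Longrightarrow> a \<in> set vs \<and> b \<in> set vs"
  unfolding polygon_edges_def by (auto dest: set_zip_leftD set_zip_rightD)

lemma polygon_edge_nonzero:
  assumes "polygon_with_vertices vs P" "(a, b) \<in> polygon_edges vs"
  shows "a \<noteq> b"
proof -
  obtain i where i: "i < length vs" "a = vs ! i" "b = vs ! ((i + 1) mod length vs)"
    using assms(2) by (rule polygon_edgeE)
  have "\<not> collinear {vs ! i, vs ! ((i + 1) mod length vs), vs ! ((i + 2) mod length vs)}"
    using assms(1) i(1) by (simp add: polygon_with_vertices_def)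
  then show ?thesis unfolding i(2,3) collinear_iff_cross2 by (auto simp: cross2_def)
qed

text \<open>By Jordan-Brouwer separation the complement of the curve is disconnected, and each of
  its components has the whole curve as its frontier. The outside is connected, so the inside is
  nonempty, and any component within the inside already accumulates at every point of the
  curve.\<close>

lemma simple_closed_curve_plane:
  fixes c :: "real \<Rightarrow> real^2"
  assumes "simple_path c" "pathfinish c = pathstart c"
  defines "B \<equiv> path_image c"
  shows "inside B \<noteq> {}" "B \<subseteq> closure (inside B)" "B \<subseteq> closure (outside B)" "frontier (outside B) = B"
proof -
  have "B homeomorphic sphere (0::complex) 1"
    unfolding B_def by (rule homeomorphic_simple_path_image_circle[OF assms(1,2)]) simp
  also have "sphere (0::complex) 1 homeomorphic sphere (0::real^2) 1"
    by (rule homeomorphic_spheres_gen) auto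
  finally have hom: "B homeomorphic sphere (0::real^2) 1" .
  have B: "bounded B" using bounded_simple_path_image[OF assms(1)] by (simp add: B_def)
  have conn: "connected (outside B)" by (rule connected_outside[OF B]) simp
  show ne: "inside B \<noteq> {}"
  proof
    assume "inside B = {}"
    then have "- B = outside B" using inside_Un_outside[of B] by simp
    then show False using conn Jordan_Brouwer_separation[OF hom] by simp
  qed
  have fr: "frontier T = B" if "T \<in> components (- B)" for T
    by (rule Jordan_Brouwer_frontier[OF hom that]) simp
  have "outside B \<in> components (- B)"
    using conn outside_bounded_nonempty[OF B] by (simp add: outside_in_components)
  then show fo: "frontier (outside B) = B" by (rule fr)
  then show "B \<subseteq> closure (outside B)" by (auto simp: frontier_def)
  obtain x where x: "x \<in> inside B" using ne by blast
  then have "x \<in> - B" using inside_no_overlap[of B] by blast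
  then have "connected_component_set (- B) x \<in> components (- B)" by (rule componentsI)
  from fr[OF this] have "B \<subseteq> closure (connected_component_set (- B) x)"
    by (auto simp: frontier_def)
  also have "\<dots> \<subseteq> closure (inside B)"
    using inside_same_component[OF _ x] by (intro closure_mono) auto
  finally show "B \<subseteq> closure (inside B)" .
qed

lemma polygon_region:
  assumes "polygon_with_vertices vs P"
  defines "B \<equiv> path_image (polygon_boundary vs)"
  shows "P = B \<union> inside B" "closed B" "bounded B" "open (inside B)" "open (outside B)"
    "inside B \<noteq> {}" "B \<subseteq> closure (inside B)" "B \<subseteq> closure (outside B)"
    "frontier P = B" "compact P" "area P > 0"
    "B = (\<Union>(a, b)\<in>polygon_edges vs. closed_segment a b)"
proof -
  have vs: "vs \<noteq> []" and simple: "simple_path (polygon_boundary vs)" and P: "P = B \<union> inside B"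
    using assms(1) by (auto simp: polygon_with_vertices_def B_def)
  show "P = B \<union> inside B" by (rule P)
  show B: "closed B" "bounded B"
    using closed_simple_path_image[OF simple] bounded_simple_path_image[OF simple] by (simp_all add: B_def)
  show oi: "open (inside B)" by (rule open_inside[OF B(1)])
  show oo: "open (outside B)" by (rule open_outside[OF B(1)])
  note curve = simple_closed_curve_plane[OF simple pathfinish_polygon_boundary[OF vs], folded B_def]
  show "inside B \<noteq> {}" "B \<subseteq> closure (inside B)" "B \<subseteq> closure (outside B)"
    by (rule curve)+
  have PO: "P = - outside B" using P union_with_inside by simp
  show "frontier P = B" unfolding PO frontier_complement by (rule curve(4))
  have "closed P" unfolding PO using oo by (simp add: closed_def)
  moreover have "bounded P" unfolding P using B bounded_inside by auto
  ultimately show cP: "compact P" by (simp add: compact_eq_bounded_closed)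
  show "area P > 0"
  proof -
    have "\<not> negligible P"
      using open_not_negligible[OF oi curve(1)] negligible_subset[of P "inside B"] P by blast
    then have "area P \<noteq> 0"
      using lmeasurable_compact[OF cP] negligible_iff_measure by blast
    then show ?thesis using measure_nonneg[of lebesgue P] by (simp only: less_le) simp
  qed
  show "B = (\<Union>(a, b)\<in>polygon_edges vs. closed_segment a b)"
    unfolding B_def by (rule path_image_polygon_boundary[OF vs])
qed

lemma inside_linear_image:
  fixes f :: "'a::euclidean_space \<Rightarrow> 'a"
  assumes f: "linear f" "inj f"
  shows "inside (f ` S) = f ` inside S"
proof -
  \<comment> \<open>Stated for an arbitrary injective linear map, so that the inverse of
    \<open>f\<close> yields the reverse inclusion.\<close>
  have sub: "f ` inside S \<subseteq> inside (f ` S)" if f: "linear f" "inj f" for f :: "'a \<Rightarrow> 'a" and S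
  proof
    fix y assume "y \<in> f ` inside S"
    then obtain x where x: "x \<in> inside S" "y = f x" by blast
    obtain g where g: "linear g" "\<And>x. g (f x) = x" "\<And>x. f (g x) = x"
      using linear_injective_isomorphism[OF f] by blast
    let ?C = "connected_component_set (- f ` S) y"
    have y: "y \<notin> f ` S" using x f(2) inside_no_overlap[of S] by (auto simp: inj_eq simp del: inside_no_overlap)
    have "g ` ?C \<subseteq> connected_component_set (- S) x"
    proof (rule connected_component_maximal)
      show "x \<in> g ` ?C" using y g(2) x by (auto simp: image_iff intro!: exI[of _ y] connected_component_refl)
      show "connected (g ` ?C)"
        by (intro connected_linear_image g(1)) simp
      show "g ` ?C \<subseteq> - S"
        using connected_component_subset[of "- f ` S" y] g(3) by (fastforce simp: image_iff)
    qed
    then have "f ` g ` ?C \<subseteq> f ` connected_component_set (- S) x" by blast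
    moreover have "f ` g ` ?C = ?C" using g(3) by (simp add: image_comp comp_def)
    moreover have "bounded (f ` connected_component_set (- S) x)"
      using x f(1) by (intro bounded_linear_image) (auto simp: inside_def linear_linear)
    ultimately have "bounded ?C" by (metis bounded_subset)
    then show "y \<in> inside (f ` S)" using y by (simp add: inside_def)
  qed
  obtain g where g: "linear g" "\<And>x. g (f x) = x" "\<And>x. f (g x) = x"
    using linear_injective_isomorphism[OF f] by blast
  have "inj g" using g(3) by (rule inj_on_inverseI)
  then have "g ` inside (f ` S) \<subseteq> inside (g ` f ` S)" by (rule sub[OF g(1)])
  also have "g ` f ` S = S" using g(2) by (simp add: image_comp comp_def)
  finally have "f ` g ` inside (f ` S) \<subseteq> f ` inside S" by blast
  moreover have "f ` g ` inside (f ` S) = inside (f ` S)" using g(3) by (simp add: image_comp comp_def)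
  ultimately show ?thesis using sub[OF f] by blast
qed

lemma polygonal_path_map:
  assumes "linear f"
  shows "polygonal_path (map f xs) = f \<circ> polygonal_path xs"
proof (induction xs rule: polygonal_path.induct)
  case (4 a b c vs)
  then show ?case
    using linear_add[OF assms] linear_scale[OF assms]
    by (auto simp: joinpaths_def linepath_def fun_eq_iff)
qed (use assms in \<open>simp_all add: linepath_def fun_eq_iff linear_add linear_scale linear_0\<close>)

lemma polygon_with_vertices_linear_image:
  assumes f: "linear f" "inj f" and P: "polygon_with_vertices vs P"
  shows "polygon_with_vertices (map f vs) (f ` P)"
proof -
  have vs: "vs \<noteq> []" "3 \<le> length vs" using P by (auto simp: polygon_with_vertices_def)
  have path: "polygon_boundary (map f vs) = f \<circ> polygon_boundary vs"
    using polygonal_path_map[OF f(1), of "vs @ [hd vs]"] vs by (simp add: polygon_boundary_def hd_map)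
  have img: "path_image (polygon_boundary (map f vs)) = f ` path_image (polygon_boundary vs)"
    unfolding path by (rule path_image_linear_image[OF f(1)])
  show ?thesis
    unfolding polygon_with_vertices_def
  proof (intro conjI allI impI)
    show "3 \<le> length (map f vs)" using vs by simp
    show "simple_path (polygon_boundary (map f vs))"
      using P unfolding path simple_path_linear_image_eq[OF f] by (simp add: polygon_with_vertices_def)
    show "f ` P = path_image (polygon_boundary (map f vs)) \<union> inside (path_image (polygon_boundary (map f vs)))"
      using P unfolding img inside_linear_image[OF f] polygon_with_vertices_def by blast
    fix i assume i: "i < length (map f vs)"
    have "(i + 1) mod length vs < length vs" "(i + 2) mod length vs < length vs"
      using vs by (simp_all add: mod_less_divisor)
    moreover have "\<not> collinear {vs ! i, vs ! ((i + 1) mod length vs), vs ! ((i + 2) mod length vs)}"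
      using P i by (simp add: polygon_with_vertices_def)
    ultimately show "\<not> collinear {map f vs ! i, map f vs ! ((i + 1) mod length (map f vs)),
        map f vs ! ((i + 2) mod length (map f vs))}"
      using i det_nz_iff_inj[OF f(1)] f(2)
      by (simp add: collinear_iff_cross2 cross2_linear[OF f(1)] flip: linear_diff[OF f(1)])
  qed
qed

text \<open>Points of the segment tending to \<open>a\<close> lie infinitely often in one and the
  same \<open>closed_segment p q\<close>, by the pigeonhole principle. Being closed, it contains
  \<open>a\<close> too, and two distinct points in common make it parallel to
  \<open>b - a\<close>.\<close>

lemma segment_in_finite_union:
  fixes a b :: "real^2"
  assumes "finite F" "a \<noteq> b" "closed_segment a b \<subseteq> (\<Union>(p, q)\<in>F. closed_segment p q)"
  shows "\<exists>(p, q)\<in>F. a \<in> closed_segment p q \<and> p \<noteq> q \<and> cross2 (b - a) (q - p) = 0"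
proof -
  define x where "x = (\<lambda>n::nat. a + (1 / real (Suc n)) *\<^sub>R (b - a))"
  have "x n \<in> closed_segment a b" for n
  proof -
    have "x n = (1 - 1 / real (Suc n)) *\<^sub>R a + (1 / real (Suc n)) *\<^sub>R b"
      by (simp add: x_def algebra_simps)
    then show ?thesis unfolding in_segment by (intro exI[of _ "1 / real (Suc n)"]) simp
  qed
  note seg = this
  have "\<forall>n\<in>UNIV. \<exists>e\<in>F. x n \<in> closed_segment (fst e) (snd e)"
  proof (intro ballI)
    fix n
    have "x n \<in> (\<Union>(p, q)\<in>F. closed_segment p q)"
      using seg[of n] assms(3) by blast
    then show "\<exists>e\<in>F. x n \<in> closed_segment (fst e) (snd e)" by (auto simp: case_prod_beta)
  qed
  from pigeonhole_infinite_rel[OF infinite_UNIV_nat assms(1) this]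
  obtain e where "e \<in> F" and inf: "infinite {n. x n \<in> closed_segment (fst e) (snd e)}" by auto
  then obtain p q where pq: "(p, q) \<in> F" "infinite {n. x n \<in> closed_segment p q}"
    by (cases e) auto
  have "x \<longlonglongrightarrow> a + 0 *\<^sub>R (b - a)"
    unfolding x_def using LIMSEQ_Suc[OF lim_1_over_n] by (intro tendsto_intros)
  then have lim: "x \<longlonglongrightarrow> a" by simp
  have a: "a \<in> closed_segment p q"
  proof (rule ccontr)
    assume "a \<notin> closed_segment p q"
    then have "eventually (\<lambda>n. x n \<in> - closed_segment p q) sequentially"
      by (intro topological_tendstoD[OF lim]) (auto simp: open_Compl)
    then obtain m where "\<And>n. n \<ge> m \<Longrightarrow> x n \<notin> closed_segment p q"
      by (auto simp: eventually_sequentially)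
    then have "{n. x n \<in> closed_segment p q} \<subseteq> {..<m}" by (auto simp: not_le[symmetric])
    then show False using pq(2) finite_subset by blast
  qed
  obtain n where n: "x n \<in> closed_segment p q"
    using pq(2) not_finite_existsD by blast
  obtain s t where st: "a = (1 - s) *\<^sub>R p + s *\<^sub>R q" "x n = (1 - t) *\<^sub>R p + t *\<^sub>R q"
    using a n by (auto simp: in_segment)
  have "(1 / real (Suc n)) *\<^sub>R (b - a) = x n - a" by (simp add: x_def)
  also have "\<dots> = (t - s) *\<^sub>R (q - p)" unfolding st by (simp add: algebra_simps)
  finally have eq: "(1 / real (Suc n)) *\<^sub>R (b - a) = (t - s) *\<^sub>R (q - p)" .
  have "real (Suc n) *\<^sub>R ((1 / real (Suc n)) *\<^sub>R (b - a)) = b - a"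
    unfolding scaleR_scaleR by simp
  then have ba: "b - a = (real (Suc n) * (t - s)) *\<^sub>R (q - p)"
    unfolding eq by simp
  then have "p \<noteq> q" using assms(2) by auto
  moreover have "cross2 (b - a) (q - p) = 0"
    unfolding ba using cross2_scaleR[of _ "q - p" 1 "q - p"] cross2_self by simp
  ultimately show ?thesis using pq(1) a by blast
qed

text \<open>A finite set that depends on a family of segments only and contains the vertices of
  every polygon with boundary inside their union, whatever list describes that polygon.\<close>

definition edge_crossings :: "((real^2) \<times> (real^2)) set \<Rightarrow> (real^2) set" where
  "edge_crossings F = {x. \<exists>(a, b)\<in>F. \<exists>(c, d)\<in>F.
     x \<in> closed_segment a b \<and> x \<in> closed_segment c d \<and> cross2 (b - a) (d - c) \<noteq> 0}"

lemma closed_segment_diff: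
  assumes "x \<in> closed_segment a b" "y \<in> closed_segment a b"
  shows "\<exists>t. y - x = t *\<^sub>R (b - a)"
proof -
  obtain s t where "x = (1 - s) *\<^sub>R a + s *\<^sub>R b" "y = (1 - t) *\<^sub>R a + t *\<^sub>R b"
    using assms by (auto simp: in_segment)
  then have "y - x = ((1 - t) *\<^sub>R a + t *\<^sub>R b) - ((1 - s) *\<^sub>R a + s *\<^sub>R b)" by (simp only:)
  also have "\<dots> = (t - s) *\<^sub>R (b - a)" by (simp add: algebra_simps)
  finally show ?thesis ..
qed

text \<open>Two distinct common points of two segments would make both segments parallel to their
  difference.\<close>

lemma finite_edge_crossings:
  assumes "finite F"
  shows "finite (edge_crossings F)"
proof -
  have single: "finite {x. x \<in> closed_segment a b \<and> x \<in> closed_segment c d \<and> cross2 (b - a) (d - c) \<noteq> 0}"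
    (is "finite ?S") for a b c d :: "real^2"
  proof -
    have "x = y" if x: "x \<in> ?S" and y: "y \<in> ?S" for x y
    proof -
      obtain s where s: "y - x = s *\<^sub>R (b - a)" using closed_segment_diff x y by blast
      obtain t where t: "y - x = t *\<^sub>R (d - c)" using closed_segment_diff x y by blast
      have "0 = cross2 (y - x) (y - x)" by (simp add: cross2_self)
      also have "\<dots> = cross2 (s *\<^sub>R (b - a)) (t *\<^sub>R (d - c))" using s t by simp
      also have "\<dots> = s * t * cross2 (b - a) (d - c)" by (rule cross2_scaleR)
      finally have "s = 0 \<or> t = 0" using x by auto
      then have "y - x = 0" using s t by auto
      then show ?thesis by simp
    qed
    then have "\<exists>z. ?S \<subseteq> {z}" by blast
    then show ?thesis using finite_subset by blast
  qed
  have "edge_crossings F \<subseteq> (\<Union>(a, b)\<in>F. \<Union>(c, d)\<in>F.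
      {x. x \<in> closed_segment a b \<and> x \<in> closed_segment c d \<and> cross2 (b - a) (d - c) \<noteq> 0})"
    unfolding edge_crossings_def by fast
  moreover have "finite \<dots>" using assms single by (intro finite_UN_I) (auto simp: case_prod_beta)
  ultimately show ?thesis by (rule finite_subset)
qed

text \<open>Along each of the two edges at a vertex some segment of \<open>F\<close> through the
  vertex is parallel to that edge. As straight angles are excluded, the two segments found are not
  parallel.\<close>

lemma polygon_vertices_subset_edge_crossings:
  assumes P: "polygon_with_vertices vs P" and F: "finite F"
    and sub: "path_image (polygon_boundary vs) \<subseteq> (\<Union>(p, q)\<in>F. closed_segment p q)"
  shows "set vs \<subseteq> edge_crossings F"
proof
  fix v assume "v \<in> set vs"
  then obtain j where j: "j < length vs" "v = vs ! j" by (auto simp: in_set_conv_nth)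
  define n where "n = length vs"
  have n: "n \<ge> 3" using P by (simp add: polygon_with_vertices_def n_def)
  \<comment> \<open>The cyclic predecessor of \<open>j\<close>; adding \<open>n\<close> first
    prevents the subtraction on natural numbers from being cut off at 0.\<close>
  define i where "i = (j + n - 1) mod n"
  have i: "i < n" using n by (simp add: i_def)
  have i1: "(i + 1) mod n = j"
  proof -
    have "(i + 1) mod n = ((j + n - 1) + 1) mod n" unfolding i_def by (rule mod_add_left_eq)
    also have "(j + n - 1) + 1 = j + n" using n by simp
    finally show ?thesis using j(1) by (simp add: n_def)
  qed
  have i2: "(i + 2) mod n = (j + 1) mod n"
    using i1 by (metis Suc_eq_plus1 add_2_eq_Suc' mod_Suc_eq)
  have B: "path_image (polygon_boundary vs) = (\<Union>(a, b)\<in>polygon_edges vs. closed_segment a b)"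
    using polygon_region(12)[OF P] .
  let ?a = "vs ! i" and ?c = "vs ! ((j + 1) mod n)"
  have ea: "(?a, v) \<in> polygon_edges vs" and ec: "(v, ?c) \<in> polygon_edges vs"
    using polygon_edge_nth[of i vs] polygon_edge_nth[of j vs] i j i1 by (auto simp: n_def)
  have sa: "closed_segment v ?a \<subseteq> (\<Union>(p, q)\<in>F. closed_segment p q)"
    using ea sub unfolding B by (subst closed_segment_commute) blast
  have sc: "closed_segment v ?c \<subseteq> (\<Union>(p, q)\<in>F. closed_segment p q)"
    using ec sub unfolding B by blast
  have ne: "v \<noteq> ?a" "v \<noteq> ?c"
    using polygon_edge_nonzero[OF P ea] polygon_edge_nonzero[OF P ec] by auto
  have "\<not> collinear {vs ! i, vs ! ((i + 1) mod n), vs ! ((i + 2) mod n)}"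
    using P i by (simp add: polygon_with_vertices_def n_def)
  then have nc: "cross2 (?a - v) (?c - v) \<noteq> 0"
    unfolding i1 i2 collinear_iff_cross2 j(2) .
  obtain p q where pq: "(p, q) \<in> F" "v \<in> closed_segment p q" "p \<noteq> q" "cross2 (?a - v) (q - p) = 0"
    using segment_in_finite_union[OF F ne(1) sa] by blast
  obtain p' q' where pq': "(p', q') \<in> F" "v \<in> closed_segment p' q'" "p' \<noteq> q'" "cross2 (?c - v) (q' - p') = 0"
    using segment_in_finite_union[OF F ne(2) sc] by blast
  obtain s where s: "q - p = s *\<^sub>R (?a - v)"
    using cross2_eq_0_imp_multiple[OF pq(4)] ne(1) by auto
  obtain t where t: "q' - p' = t *\<^sub>R (?c - v)"
    using cross2_eq_0_imp_multiple[OF pq'(4)] ne(2) by auto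
  have "s \<noteq> 0" "t \<noteq> 0" using s t pq(3) pq'(3) by auto
  then have "cross2 (q - p) (q' - p') \<noteq> 0"
    using nc unfolding s t cross2_scaleR by simp
  then show "v \<in> edge_crossings F"
    unfolding edge_crossings_def using pq(1,2) pq'(1,2) by blast
qed

lemma edge_crossings_affine_image:
  fixes f :: "real^2 \<Rightarrow> real^2"
  assumes f: "linear f" "inj f"
  shows "edge_crossings ((\<lambda>(a, b). (f a + c, f b + c)) ` F) \<subseteq> (\<lambda>x. f x + c) ` edge_crossings F"
proof
  fix x assume "x \<in> edge_crossings ((\<lambda>(a, b). (f a + c, f b + c)) ` F)"
  then obtain p q r s where pq: "(p, q) \<in> F" "(r, s) \<in> F"
    and x: "x \<in> closed_segment (f p + c) (f q + c)" "x \<in> closed_segment (f r + c) (f s + c)"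
    and nc: "cross2 (f q + c - (f p + c)) (f s + c - (f r + c)) \<noteq> 0"
    unfolding edge_crossings_def by auto
  have seg: "closed_segment (f a + c) (f b + c) = (\<lambda>x. f x + c) ` closed_segment a b" for a b
    using closed_segment_translation[of c "f a" "f b"] closed_segment_linear_image[OF f(1), of a b]
    by (simp add: image_comp comp_def add.commute)
  obtain y where y: "y \<in> closed_segment p q" "x = f y + c" using x(1) seg by auto
  obtain z where z: "z \<in> closed_segment r s" "x = f z + c" using x(2) seg by auto
  have "y = z" using y z f(2) by (simp add: inj_eq)
  have "cross2 (f (q - p)) (f (s - r)) \<noteq> 0" using nc by (simp add: linear_diff[OF f(1)])
  then have "cross2 (q - p) (s - r) \<noteq> 0" unfolding cross2_linear[OF f(1)] by simp
  then have "y \<in> edge_crossings F"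
    unfolding edge_crossings_def using pq y(1) z(1) \<open>y = z\<close> by blast
  then show "x \<in> (\<lambda>x. f x + c) ` edge_crossings F" using y(2) by blast
qed

lemma frontier_affine_image:
  fixes f :: "real^2 \<Rightarrow> real^2"
  assumes "linear f" "inj f"
  shows "frontier ((\<lambda>x. f x + c) ` S) = (\<lambda>x. f x + c) ` frontier S"
proof -
  have comp: "(\<lambda>x. f x + c) ` T = (+) c ` f ` T" for T
    by (simp add: image_comp comp_def add.commute)
  have "frontier (f ` S) = f ` frontier S"
    unfolding frontier_def closure_injective_linear_image[OF assms, symmetric] interior_injective_linear_image[OF assms]
    by (rule image_set_diff[OF assms(2), symmetric])
  then show ?thesis unfolding comp frontier_translation by simp
qed

text \<open>The two vertex lists in play below, that of \<open>P\<close> and that of its affine image \<open>Q\<close>, need not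
  correspond to each other a priori: they are related through the common frontier.\<close>

locale affine_polygons =
  fixes vs P ws Q f c
  assumes P: "polygon_with_vertices vs P" and Q: "polygon_with_vertices ws Q"
    and linear_f: "linear f" and bij_f: "bij f" and image: "Q = (\<lambda>x. f x + c) ` P"
begin

lemma inj_f: "inj f"
  using bij_f by (rule bij_is_inj)

definition "image_edges = (\<lambda>(a, b). (f a + c, f b + c)) ` polygon_edges vs"

lemma finite_image_edges: "finite image_edges"
  by (simp add: image_edges_def finite_polygon_edges)

lemma boundary_eq: "path_image (polygon_boundary ws) = (\<Union>(p, q)\<in>image_edges. closed_segment p q)"
proof -
  have seg: "closed_segment (f a + c) (f b + c) = (\<lambda>x. f x + c) ` closed_segment a b" for a b
    using closed_segment_translation[of c "f a" "f b"] closed_segment_linear_image[OF linear_f, of a b]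
    by (simp add: image_comp comp_def add.commute)
  have "path_image (polygon_boundary ws) = (\<lambda>x. f x + c) ` frontier P"
    using polygon_region(9)[OF Q] frontier_affine_image[OF linear_f inj_f] image by simp
  also have "frontier P = (\<Union>(a, b)\<in>polygon_edges vs. closed_segment a b)"
    using polygon_region(9,12)[OF P] by simp
  finally show ?thesis
    by (simp add: image_edges_def image_UN seg case_prod_beta)
qed

lemma vertices_subset: "set ws \<subseteq> (\<lambda>x. f x + c) ` edge_crossings (polygon_edges vs)"
  using polygon_vertices_subset_edge_crossings[OF Q finite_image_edges eq_refl[OF boundary_eq]]
    edge_crossings_affine_image[OF linear_f inj_f] unfolding image_edges_def by (rule order_trans)

text \<open>Every edge of \<open>ws\<close> lies in the union of the images of the edges of
  \<open>vs\<close>, so it is parallel to one of them.\<close>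

lemma card_edge_directions_le: "card (edge_directions ws) \<le> card (edge_directions vs)"
proof -
  have "edge_directions ws \<subseteq> (\<lambda>S. f ` S) ` edge_directions vs"
  proof
    fix d assume "d \<in> edge_directions ws"
    then obtain a b where ab: "(a, b) \<in> polygon_edges ws" "d = span {b - a}"
      by (auto simp: edge_directions_def)
    have ne: "a \<noteq> b" by (rule polygon_edge_nonzero[OF Q ab(1)])
    have "closed_segment a b \<subseteq> (\<Union>(p, q)\<in>image_edges. closed_segment p q)"
      using ab(1) polygon_region(12)[OF Q] unfolding boundary_eq[symmetric] by blast
    from segment_in_finite_union[OF finite_image_edges ne this]
    obtain p q where pq: "(p, q) \<in> image_edges" "p \<noteq> q" "cross2 (b - a) (q - p) = 0" by blast
    then have d: "d = span {q - p}" using ne span_singleton_eq_iff[of "b - a" "q - p"] ab(2) by simp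
    obtain p' q' where pq': "(p', q') \<in> polygon_edges vs" "p = f p' + c" "q = f q' + c"
      using pq(1) by (auto simp: image_edges_def)
    then have "d = f ` span {q' - p'}"
      using d linear_span_image[OF linear_f, of "{q' - p'}"] by (simp add: linear_diff[OF linear_f])
    then show "d \<in> (\<lambda>S. f ` S) ` edge_directions vs"
      using pq'(1) by (auto simp: edge_directions_def)
  qed
  moreover have fin: "finite (edge_directions vs)"
    by (simp add: edge_directions_def finite_polygon_edges)
  ultimately have "card (edge_directions ws) \<le> card ((\<lambda>S. f ` S) ` edge_directions vs)"
    by (intro card_mono finite_imageI)
  also have "\<dots> \<le> card (edge_directions vs)" using fin by (rule card_image_le)
  finally show ?thesis .
qed

lemma area_eq: "area Q = \<bar>det (matrix f)\<bar> * area P"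
proof -
  have "Q = (+) c ` f ` P" unfolding image by (simp add: image_comp comp_def add.commute)
  then have "area Q = area (f ` P)" by (simp add: measure_translation)
  also have "\<dots> = \<bar>det (matrix f)\<bar> * area P"
    using lmeasurable_compact[OF polygon_region(10)[OF P]] by (rule measure_linear_image[OF linear_f])
  finally show ?thesis .
qed

text \<open>Three consecutive vertices of the integer image span a parallelogram of integer area,
  and they come from the finite set \<open>edge_crossings (polygon_edges vs)\<close>, which does not
  depend on \<open>f\<close>. Hence \<open>\<bar>det (matrix f)\<bar>\<close> is a natural number
  divided by one of finitely many constants, and the areas of integer images are discrete.\<close>

lemma det_discrete:
  assumes int: "set ws \<subseteq> int_lattice"
  shows "\<exists>x\<in>edge_crossings (polygon_edges vs). \<exists>y\<in>edge_crossings (polygon_edges vs).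
    \<exists>z\<in>edge_crossings (polygon_edges vs). \<exists>m::nat. cross2 (x - y) (z - y) \<noteq> 0 \<and>
      \<bar>det (matrix f)\<bar> * \<bar>cross2 (x - y) (z - y)\<bar> = real m"
proof -
  have len: "3 \<le> length ws" using Q by (simp add: polygon_with_vertices_def)
  have mem: "ws ! 0 \<in> set ws" "ws ! 1 \<in> set ws" "ws ! 2 \<in> set ws"
    using len by (auto intro!: nth_mem)
  have "(0 + 1) mod length ws = 1" "(0 + 2) mod length ws = 2" using len by simp_all
  moreover have "\<not> collinear {ws ! 0, ws ! ((0 + 1) mod length ws), ws ! ((0 + 2) mod length ws)}"
    using Q len unfolding polygon_with_vertices_def by fastforce
  ultimately have nc: "cross2 (ws ! 0 - ws ! 1) (ws ! 2 - ws ! 1) \<noteq> 0"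
    unfolding collinear_iff_cross2 by simp
  obtain x y z where xyz: "x \<in> edge_crossings (polygon_edges vs)" "y \<in> edge_crossings (polygon_edges vs)"
    "z \<in> edge_crossings (polygon_edges vs)" "ws ! 0 = f x + c" "ws ! 1 = f y + c" "ws ! 2 = f z + c"
  proof -
    have "ws ! 0 \<in> (\<lambda>x. f x + c) ` edge_crossings (polygon_edges vs)"
      "ws ! 1 \<in> (\<lambda>x. f x + c) ` edge_crossings (polygon_edges vs)"
      "ws ! 2 \<in> (\<lambda>x. f x + c) ` edge_crossings (polygon_edges vs)"
      using mem vertices_subset by (simp_all only: subset_iff)
    then show thesis by (elim imageE) (rule that)
  qed
  have eq: "cross2 (ws ! 0 - ws ! 1) (ws ! 2 - ws ! 1) = det (matrix f) * cross2 (x - y) (z - y)"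
    unfolding xyz(4-6) by (simp add: cross2_linear[OF linear_f] flip: linear_diff[OF linear_f])
  have "cross2 (ws ! 0 - ws ! 1) (ws ! 2 - ws ! 1) \<in> \<int>"
  proof -
    have "ws ! 0 \<in> int_lattice" "ws ! 1 \<in> int_lattice" "ws ! 2 \<in> int_lattice"
      using mem int by (simp_all only: subset_iff)
    then show ?thesis by (simp add: cross2_def int_lattice_def)
  qed
  then obtain k :: int where "det (matrix f) * cross2 (x - y) (z - y) = of_int k"
    unfolding eq by (auto elim: Ints_cases)
  then have "\<bar>det (matrix f)\<bar> * \<bar>cross2 (x - y) (z - y)\<bar> = real (nat \<bar>k\<bar>)"
    by (simp flip: abs_mult)
  moreover have "cross2 (x - y) (z - y) \<noteq> 0" using nc eq by auto
  ultimately show ?thesis using xyz(1-3) by blast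
qed

end

section \<open>Existence of an integer polygon of minimal area\<close>

lemma common_denominator:
  assumes "finite S" "S \<subseteq> \<rat>"
  shows "\<exists>M>0. \<forall>q\<in>S. real M * q \<in> \<int>"
  using assms
proof induction
  case (insert q S)
  then obtain M where M: "M > 0" "\<forall>q\<in>S. real M * q \<in> \<int>" by auto
  obtain a b :: int where ab: "b > 0" "q = of_int a / of_int b"
    using insert.prems by (auto elim: Rats_cases')
  have "real (M * nat b) * r \<in> \<int>" if "r \<in> insert q S" for r
  proof (cases "r = q")
    case True
    then have "real (M * nat b) * r = of_int (int M * a)" using ab by simp
    then show ?thesis by (metis Ints_of_int)
  next
    case False
    then have "real M * r \<in> \<int>" using M that by auto
    then have "of_int b * (real M * r) \<in> \<int>" by (rule Ints_mult[OF Ints_of_int])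
    moreover have "real (M * nat b) * r = of_int b * (real M * r)" using ab(1) by simp
    ultimately show ?thesis by (simp only:)
  qed
  then show ?case using M ab by (intro exI[of _ "M * nat b"]) auto
qed (auto intro: exI[of _ 1])

lemma exists_minimal_of_finite_below:
  fixes g :: "'a \<Rightarrow> real"
  assumes "R a" and fin: "finite {g x | x. R x \<and> g x \<le> g a}"
  shows "\<exists>x. R x \<and> (\<forall>y. R y \<longrightarrow> g x \<le> g y)"
proof -
  let ?A = "{g x | x. R x \<and> g x \<le> g a}"
  have "?A \<noteq> {}" using assms(1) by auto
  then have "Min ?A \<in> ?A" using fin by (rule Min_in[rotated])
  then obtain x where x: "R x" "g x = Min ?A" "g x \<le> g a" by auto
  have "g x \<le> g y" if "R y" for y
  proof (cases "g y \<le> g a")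
    case True
    then show ?thesis unfolding x(2) using that fin by (intro Min_le) auto
  next
    case False
    then show ?thesis using x(3) by simp
  qed
  then show ?thesis using x(1) by blast
qed

lemma integer_polygon_altdef:
  "integer_polygon Q \<longleftrightarrow> (\<exists>ws. polygon_with_vertices ws Q \<and> set ws \<subseteq> int_lattice)"
  unfolding integer_polygon_def int_lattice_def by blast

text \<open>The choice made by \<open>arg_min\<close> is meaningful only if the minimum is attained.
  Clearing denominators gives one integer image \<open>Q0\<close>; at most as large as
  \<open>area Q0\<close> there are only finitely many areas, each being
  \<open>m / d * area P\<close> with a natural number \<open>m\<close> and \<open>d\<close> from the
  finite set \<open>?D\<close>.\<close>

lemma P_INT_properties:
  assumes "rational_polygon vs P"
  shows "integer_polygon (P_INT P)" "affinely_equivalent P (P_INT P)"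
proof -
  let ?R = "\<lambda>Q. integer_polygon Q \<and> affinely_equivalent P Q"
  have P: "polygon_with_vertices vs P" and rat: "\<And>v i. v \<in> set vs \<Longrightarrow> v $ i \<in> \<rat>"
    using assms by (auto simp: rational_polygon_def)
  have "\<exists>Q. ?R Q"
  proof -
    have "finite (\<Union>v\<in>set vs. range (\<lambda>i. v $ i))" by simp
    moreover have "(\<Union>v\<in>set vs. range (\<lambda>i. v $ i)) \<subseteq> \<rat>" using rat by auto
    ultimately obtain M where M: "M > 0" "\<And>v i. v \<in> set vs \<Longrightarrow> real M * v $ i \<in> \<int>"
      using common_denominator by (metis (no_types, lifting) UN_I rangeI)
    let ?f = "(*\<^sub>R) (real M) :: real^2 \<Rightarrow> real^2"
    have f: "linear ?f" by (rule linear_scaleR)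
    have inj: "inj ?f" using M(1) by (intro injI) simp
    have "polygon_with_vertices (map ?f vs) (?f ` P)"
      by (rule polygon_with_vertices_linear_image[OF f inj P])
    moreover have "set (map ?f vs) \<subseteq> int_lattice"
      using M(2) by (auto simp: int_lattice_def)
    ultimately have "integer_polygon (?f ` P)" unfolding integer_polygon_altdef by blast
    moreover have "affinely_equivalent P (?f ` P)"
      unfolding affinely_equivalent_def
      using f inj linear_injective_imp_surjective[OF f inj]
      by (intro exI[of _ ?f] exI[of _ 0]) (simp add: bij_def)
    ultimately show ?thesis by blast
  qed
  then obtain Q0 where Q0: "?R Q0" by blast
  let ?X = "edge_crossings (polygon_edges vs)"
  let ?D = "{\<bar>cross2 (x - y) (z - y)\<bar> | x y z. x \<in> ?X \<and> y \<in> ?X \<and> z \<in> ?X} - {0}"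
  have fX: "finite ?X" by (intro finite_edge_crossings finite_polygon_edges)
  have "?D \<subseteq> (\<lambda>(x, y, z). \<bar>cross2 (x - y) (z - y)\<bar>) ` (?X \<times> ?X \<times> ?X)"
    by force
  then have fD: "finite ?D" using fX by (meson finite_SigmaI finite_imageI finite_subset)
  have aP: "area P > 0" by (rule polygon_region(11)[OF P])
  have "\<exists>d\<in>?D. \<exists>m::nat. area Q = real m / d * area P" if Q: "?R Q" for Q
  proof -
    obtain ws where ws: "polygon_with_vertices ws Q" "set ws \<subseteq> int_lattice"
      using Q integer_polygon_altdef by blast
    obtain f c where f: "linear f" "bij f" "Q = (\<lambda>x. f x + c) ` P"
      using Q by (auto simp: affinely_equivalent_def)
    interpret affine_polygons vs P ws Q f c by (rule affine_polygons.intro[OF P ws(1) f])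
    obtain x y z m where xyz: "x \<in> ?X" "y \<in> ?X" "z \<in> ?X" "cross2 (x - y) (z - y) \<noteq> 0"
      and m: "\<bar>det (matrix f)\<bar> * \<bar>cross2 (x - y) (z - y)\<bar> = real m"
      using det_discrete[OF ws(2)] by blast
    have "area Q = real m / \<bar>cross2 (x - y) (z - y)\<bar> * area P"
      unfolding area_eq m[symmetric] using xyz(4) by simp
    moreover have "\<bar>cross2 (x - y) (z - y)\<bar> \<in> ?D" using xyz by auto
    ultimately show ?thesis by blast
  qed
  then have sub: "{area Q | Q. ?R Q \<and> area Q \<le> area Q0} \<subseteq>
      (\<Union>d\<in>?D. (\<lambda>m. real m / d * area P) ` {m. real m \<le> area Q0 * d / area P})"
  proof (intro subsetI)
    fix a assume "a \<in> {area Q | Q. ?R Q \<and> area Q \<le> area Q0}"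
    then obtain Q where Q: "a = area Q" "?R Q" "area Q \<le> area Q0" by blast
    obtain d m where d: "d \<in> ?D" and m: "area Q = real m / d * area P"
      using \<open>\<And>Q. ?R Q \<Longrightarrow> \<exists>d\<in>?D. \<exists>m::nat. area Q = real m / d * area P\<close>[OF Q(2)] by blast
    have "d > 0" using d by auto
    then have "real m \<le> area Q0 * d / area P"
      using Q(3) aP unfolding m by (simp add: field_simps)
    then show "a \<in> (\<Union>d\<in>?D. (\<lambda>m. real m / d * area P) ` {m. real m \<le> area Q0 * d / area P})"
      using d m Q(1) by (intro UN_I[OF d] image_eqI[of _ _ m]) simp_all
  qed
  have "finite {m. real m \<le> r}" for r
    by (rule finite_subset[of _ "{..nat \<lfloor>r\<rfloor>}"]) (auto simp: le_nat_floor)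
  then have "finite {area Q | Q. ?R Q \<and> area Q \<le> area Q0}"
    using fD by (intro finite_subset[OF sub] finite_UN_I finite_imageI)
  from exists_minimal_of_finite_below[of ?R Q0 area, OF Q0 this]
  have "\<exists>Q. is_arg_min area ?R Q" unfolding is_arg_min_def by (meson linorder_not_le)
  then have "is_arg_min area ?R (P_INT P)"
    unfolding P_INT_def arg_min_def by (rule someI_ex)
  then show "integer_polygon (P_INT P)" "affinely_equivalent P (P_INT P)"
    unfolding is_arg_min_def by blast+
qed

section \<open>Integer polygons\<close>

text \<open>Dividing \<open>e\<close> by the gcd of its coordinates and turning it by a right angle
  gives \<open>w\<close>. The Bezout coefficients of that gcd give \<open>p\<close>, with signs
  chosen to make the determinant 1.\<close>

lemma exists_primitive_normal:
  assumes "e \<in> int_lattice" "e \<noteq> 0"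
  shows "\<exists>w\<in>int_lattice. \<exists>p\<in>int_lattice. cross2 w p = 1 \<and> (\<forall>x. w \<bullet> x = 0 \<longleftrightarrow> x \<in> span {e})"
proof -
  obtain a b where ab: "e $ 1 = of_int a" "e $ 2 = of_int b"
    using assms(1) unfolding int_lattice_def by (metis (mono_tags) Ints_cases mem_Collect_eq)
  have ne: "a \<noteq> 0 \<or> b \<noteq> 0" using assms(2) ab vec2_eqI[of e 0] by auto
  define g where "g = gcd a b"
  have g: "g > 0" using ne by (simp add: g_def)
  obtain a' b' where ab': "a = g * a'" "b = g * b'"
    unfolding g_def by (meson dvdE gcd_dvd1 gcd_dvd2)
  obtain s t where "s * a + t * b = g" using bezout_int[of a b] unfolding g_def by blast
  then have "g * (s * a' + t * b') = g * 1" unfolding ab' by (simp add: algebra_simps)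
  then have st: "s * a' + t * b' = 1" using g by simp
  define w :: "real^2" where "w = vector [- of_int b', of_int a']"
  define p :: "real^2" where "p = vector [- of_int s, - of_int t]"
  have "w \<in> int_lattice" "p \<in> int_lattice"
    by (auto simp: int_lattice_def w_def p_def forall_2)
  moreover have "cross2 w p = of_int (s * a' + t * b')"
    by (simp add: cross2_def w_def p_def algebra_simps)
  then have "cross2 w p = 1" unfolding st by simp
  moreover have "w \<bullet> x = 0 \<longleftrightarrow> x \<in> span {e}" for x
  proof -
    have "of_int g * (w \<bullet> x) = cross2 e x"
      by (simp add: inner_vec2 cross2_def w_def ab ab' algebra_simps)
    then have "w \<bullet> x = 0 \<longleftrightarrow> cross2 e x = 0" using g by (metis mult_eq_0_iff of_int_eq_0_iff less_irrefl)
    also have "\<dots> \<longleftrightarrow> x \<in> span {e}"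
    proof
      assume "cross2 e x = 0"
      then obtain r where "x = r *\<^sub>R e" using cross2_eq_0_imp_multiple[OF _ assms(2)] by blast
      then show "x \<in> span {e}" by (simp add: span_scale span_base)
    next
      assume "x \<in> span {e}"
      then obtain r where "x = r *\<^sub>R e" by (auto simp: span_singleton)
      then show "cross2 e x = 0" using cross2_scaleR[of 1 e r e] cross2_self by simp
    qed
    finally show ?thesis .
  qed
  ultimately show ?thesis by blast
qed

lemma cross2_eq_0_inner:
  assumes "cross2 w w' = 0" "w \<noteq> 0" "w \<bullet> x = 0"
  shows "w' \<bullet> x = 0"
proof -
  obtain r where "w' = r *\<^sub>R w" using cross2_eq_0_imp_multiple[OF assms(1,2)] by blast
  then show ?thesis using assms(3) by simp
qed

lemma cross2_commute_0: "cross2 w w' = 0 \<Longrightarrow> cross2 w' w = 0"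
  by (simp add: cross2_def mult.commute)

lemma edge_directionsI: "(a, b) \<in> polygon_edges ws \<Longrightarrow> span {b - a} \<in> edge_directions ws"
  unfolding edge_directions_def by (rule image_eqI[of _ _ "(a, b)"]) simp_all

lemma polygon_two_directions:
  assumes "polygon_with_vertices ws Q"
  shows "\<exists>d\<in>edge_directions ws. \<exists>d'\<in>edge_directions ws. d \<noteq> d'"
proof -
  have len: "3 \<le> length ws" using assms by (simp add: polygon_with_vertices_def)
  have mods: "(0 + 1) mod length ws = 1" "(0 + 2) mod length ws = 2" "(1 + 1) mod length ws = 2"
    using len by simp_all
  have "\<not> collinear {ws ! 0, ws ! ((0 + 1) mod length ws), ws ! ((0 + 2) mod length ws)}"
    using assms len unfolding polygon_with_vertices_def by fastforce
  then have nc: "cross2 (ws ! 0 - ws ! 1) (ws ! 2 - ws ! 1) \<noteq> 0"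
    unfolding collinear_iff_cross2 mods .
  have e: "(ws ! 0, ws ! 1) \<in> polygon_edges ws" "(ws ! 1, ws ! 2) \<in> polygon_edges ws"
    using polygon_edge_nth[of 0 ws] polygon_edge_nth[of 1 ws] len unfolding mods by force+
  have "cross2 (ws ! 1 - ws ! 0) (ws ! 2 - ws ! 1) \<noteq> 0"
    using nc by (simp add: cross2_def algebra_simps)
  moreover have "ws ! 1 - ws ! 0 \<noteq> 0" "ws ! 2 - ws ! 1 \<noteq> 0"
    using polygon_edge_nonzero[OF assms e(1)] polygon_edge_nonzero[OF assms e(2)] by auto
  ultimately have "span {ws ! 1 - ws ! 0} \<noteq> span {ws ! 2 - ws ! 1}"
    by (simp add: span_singleton_eq_iff)
  then show ?thesis using edge_directionsI[OF e(1)] edge_directionsI[OF e(2)] by blast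
qed

lemma integer_polygon_odd_translates:
  assumes Q: "polygon_with_vertices ws Q" and int: "set ws \<subseteq> int_lattice"
  shows "\<exists>N>0. \<exists>us. real (length us) \<le> N\<^sup>2 * 2 ^ (card (edge_directions ws) - 1) \<and>
    (AE x in lebesgue. odd (\<Sum>u\<leftarrow>us. card {l \<in> (*\<^sub>R) N ` int_lattice. x - u - l \<in> Q}))"
proof -
  let ?D = "edge_directions ws"
  have finD: "finite ?D" by (simp add: edge_directions_def finite_polygon_edges)
  have "\<exists>w p. w \<in> int_lattice \<and> p \<in> int_lattice \<and> cross2 w p = 1 \<and> (\<forall>x. w \<bullet> x = 0 \<longleftrightarrow> x \<in> d)"
    if d: "d \<in> ?D" for d
  proof -
    obtain a b where ab: "(a, b) \<in> polygon_edges ws" "d = span {b - a}"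
      using d by (auto simp: edge_directions_def)
    have "b - a \<in> int_lattice" using polygon_edge_ends[OF ab(1)] int int_lattice_diff by blast
    moreover have "b - a \<noteq> 0" using polygon_edge_nonzero[OF Q ab(1)] by simp
    ultimately show ?thesis using exists_primitive_normal ab(2) by blast
  qed
  then obtain n p where np: "\<And>d. d \<in> ?D \<Longrightarrow> n d \<in> int_lattice"
    "\<And>d. d \<in> ?D \<Longrightarrow> p d \<in> int_lattice" "\<And>d. d \<in> ?D \<Longrightarrow> cross2 (n d) (p d) = 1"
    "\<And>d x. d \<in> ?D \<Longrightarrow> n d \<bullet> x = 0 \<longleftrightarrow> x \<in> d"
    by metis
  have nz: "n d \<noteq> 0" if "d \<in> ?D" for d using np(3)[OF that] by (auto simp: cross2_def)
  \<comment> \<open>A direction is the orthogonal complement of its normal, so parallel normals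
    belong to the same direction.\<close>
  have inj: "d = d'" if "d \<in> ?D" "d' \<in> ?D" "cross2 (n d) (n d') = 0" for d d'
    using cross2_eq_0_inner[OF that(3) nz[OF that(1)]]
      cross2_eq_0_inner[OF cross2_commute_0[OF that(3)] nz[OF that(2)]] np(4) that(1,2) by blast
  \<comment> \<open>One normal for each direction, not for each edge, so that the exponent counts
    classes of parallel edges.\<close>
  define W where "W = n ` ?D"
  define dual where "dual = p \<circ> inv_into ?D n"
  have inv: "inv_into ?D n w \<in> ?D" "n (inv_into ?D n w) = w" if "w \<in> W" for w
    using that unfolding W_def by (simp_all add: inv_into_into f_inv_into_f)
  interpret primitive_normals W dual
  proof
    show "finite W" using finD by (simp add: W_def)
    show "w \<in> int_lattice" if "w \<in> W" for w using that np(1) by (auto simp: W_def)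
    show "dual w \<in> int_lattice" if "w \<in> W" for w using inv(1)[OF that] np(2) by (simp add: dual_def)
    show "cross2 w (dual w) = 1" if "w \<in> W" for w
      using np(3)[OF inv(1)[OF that]] inv(2)[OF that] by (simp add: dual_def)
    show "cross2 w w' \<noteq> 0" if "w \<in> W" "w' \<in> W" "w \<noteq> w'" for w w'
      using that inj by (auto simp: W_def)
    show "\<exists>w'\<in>W. w' \<noteq> w" if "w \<in> W" for w
    proof -
      obtain d d' where d: "d \<in> ?D" "d' \<in> ?D" "d \<noteq> d'" using polygon_two_directions[OF Q] by blast
      then have "n d \<noteq> n d'" using inj[of d d'] cross2_self by auto
      then show ?thesis using d by (auto simp: W_def)
    qed
  qed
  let ?B = "path_image (polygon_boundary ws)"
  note R = polygon_region[OF Q]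
  have E: "a \<in> int_lattice \<and> b \<in> int_lattice \<and> (\<exists>w\<in>W. w \<bullet> (b - a) = 0)"
    if "(a, b) \<in> polygon_edges ws" for a b
  proof -
    have d: "span {b - a} \<in> ?D" using that by (rule edge_directionsI)
    then have "n (span {b - a}) \<bullet> (b - a) = 0" using np(4) by (simp add: span_base)
    then show ?thesis using d polygon_edge_ends[OF that] int by (auto simp: W_def)
  qed
  have "lattice_step (\<lambda>x. of_bool (x \<in> (?B \<union> inside ?B) \<inter> off_lines))"
    by (rule lattice_step_polygon[OF finite_polygon_edges E R(12) R(4,5) inside_Int_outside
          inside_Un_outside[symmetric] R(7,8)])
  then have "lattice_step (\<lambda>x. of_bool (x \<in> Q \<inter> off_lines))" using R(1) by simp
  moreover have "bounded Q" using R(10) by (rule compact_imp_bounded)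
  moreover have "inside ?B \<subseteq> Q" using R(1) by blast
  ultimately obtain N us where N: "N > 0" "real (length us) \<le> N\<^sup>2 * 2 ^ (card W - 1)"
    "AE x in lebesgue. odd (\<Sum>u\<leftarrow>us. card {l \<in> (*\<^sub>R) N ` int_lattice. x - u - l \<in> Q})"
    using exists_odd_conv[OF _ R(4,6)] by blast
  have "card W \<le> card ?D" unfolding W_def using finD by (rule card_image_le)
  then have "N\<^sup>2 * 2 ^ (card W - 1) \<le> N\<^sup>2 * 2 ^ (card ?D - 1)"
    by (intro mult_left_mono power_increasing) auto
  with N(2) have "real (length us) \<le> N\<^sup>2 * 2 ^ (card ?D - 1)" by (rule order_trans)
  then show ?thesis using N(1,3) by blast
qed

theorem theorem3:
  fixes P :: "(real^2) set" and vs :: "(real^2) list" and k :: nat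
  assumes "rational_polygon vs P"
    and "card (edge_directions vs) = k"
  shows "(\<exists>Z. odd_cover P Z \<and> uniformly_bounded_degree P Z \<and>
              cover_density P Z \<le> ennreal (A_INT P * 2 ^ (k - 1))) \<and>
         odd_compression_ratio P \<ge> inverse (A_INT P) * inverse (2 ^ (k - 1))"
proof -
  let ?Q = "P_INT P"
  have P: "polygon_with_vertices vs P" using assms(1) by (simp add: rational_polygon_def)
  obtain ws where ws: "polygon_with_vertices ws ?Q" "set ws \<subseteq> int_lattice"
    using P_INT_properties(1)[OF assms(1)] integer_polygon_altdef by blast
  obtain f c where f: "linear f" "bij f" "?Q = (\<lambda>x. f x + c) ` P"
    using P_INT_properties(2)[OF assms(1)] unfolding affinely_equivalent_def by blast
  interpret affine_polygons vs P ws ?Q f c by (rule affine_polygons.intro[OF P ws(1) f])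
  obtain N us where N: "N > 0"
    "real (length us) \<le> N\<^sup>2 * 2 ^ (card (edge_directions ws) - 1)"
    "AE x in lebesgue. odd (\<Sum>u\<leftarrow>us. card {l \<in> (*\<^sub>R) N ` int_lattice. x - u - l \<in> ?Q})"
    using integer_polygon_odd_translates[OF ws] by blast
  obtain g where g: "linear g" "\<And>x. g (f x) = x" "\<And>x. f (g x) = x"
    using linear_injective_isomorphism[OF f(1) inj_f] by blast
  \<comment> \<open>Translation vectors are pulled back along the linear part \<open>f\<close>
    alone, so the lattice \<open>N \<int>^2\<close> for \<open>Q\<close> becomes its image under the
    inverse \<open>g\<close>.\<close>
  define h where "h = (\<lambda>x. N *\<^sub>R g x)"
  have h: "linear h" "inj h"
  proof -
    show "linear h" unfolding h_def using g(1) by (rule linear_compose_scale_right)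
    have "inj g" using g(3) by (rule inj_on_inverseI)
    then show "inj h" using N(1) by (simp add: h_def inj_def)
  qed
  define us' where "us' = map g us"
  define L where "L = h ` int_lattice"
  interpret lattice_translates h us' L
    unfolding L_def by (rule lattice_translates.intro[OF h])
  \<comment> \<open>The bound on the number of translates of \<open>P\<close> per unit area:
    \<open>2 ^ (k - 1)\<close> for \<open>Q\<close>, multiplied by the factor by which
    \<open>f\<close> scales areas.\<close>
  define t where "t = \<bar>det (matrix f)\<bar> * 2 ^ (k - 1)"
  \<comment> \<open>The composition of \<open>f\<close> and \<open>h\<close> is multiplication by
    \<open>N\<close>; comparing determinants of the unit vectors and their images gives the product
    of the two scaling factors.\<close>
  have covol: "covolume * \<bar>det (matrix f)\<bar> = N\<^sup>2"
  proof -
    let ?e = "axis 1 1 :: real^2" and ?e' = "axis 2 1 :: real^2"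
    have "det (matrix h) * (det (matrix f) * cross2 ?e ?e') = cross2 (h (f ?e)) (h (f ?e'))"
      by (simp add: cross2_linear[OF h(1)] cross2_linear[OF f(1)])
    also have "\<dots> = N\<^sup>2 * cross2 ?e ?e'"
      by (simp add: h_def g(2) cross2_scaleR power2_eq_square)
    also have "cross2 ?e ?e' = 1" by (simp add: cross2_def axis_def)
    finally show ?thesis unfolding covolume_def by (simp flip: abs_mult)
  qed
  have len: "real (length us') \<le> covolume * t"
  proof -
    have "N\<^sup>2 * 2 ^ (card (edge_directions ws) - 1) \<le> N\<^sup>2 * 2 ^ (k - 1)"
      using card_edge_directions_le assms(2) by (intro mult_left_mono power_increasing) auto
    also have "\<dots> = covolume * t" unfolding t_def covol[symmetric] by (simp only: mult.assoc)
    finally show ?thesis using N(2) by (simp add: us'_def)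
  qed
  have mem: "f x + c - u - N *\<^sub>R z \<in> ?Q \<longleftrightarrow> x - g u - h z \<in> P" for x u z
  proof -
    have "f x + c - u - N *\<^sub>R z = f (x - g u - h z) + c"
      by (simp add: h_def linear_diff[OF f(1)] linear_scale[OF f(1)] g(3))
    then show ?thesis unfolding f(3) using inj_f by (auto simp: inj_eq)
  qed
  have card_eq: "card {l \<in> (*\<^sub>R) N ` int_lattice. f x + c - u - l \<in> ?Q} = card {l \<in> L. x - g u - l \<in> P}"
    for x u
  proof -
    have "{l \<in> (*\<^sub>R) N ` int_lattice. f x + c - u - l \<in> ?Q} =
        (*\<^sub>R) N ` {z \<in> int_lattice. x - g u - h z \<in> P}"
      using mem by auto
    moreover have "{l \<in> L. x - g u - l \<in> P} = h ` {z \<in> int_lattice. x - g u - h z \<in> P}"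
      by (auto simp: L_def)
    moreover have "inj ((*\<^sub>R) N :: real^2 \<Rightarrow> real^2)" using N(1) by (simp add: inj_def)
    ultimately show ?thesis using h(2) by (simp add: card_image inj_on_subset)
  qed
  have odd: "AE x in lebesgue. odd (\<Sum>u\<leftarrow>us'. card {l \<in> L. x - u - l \<in> P})"
    using AE_lebesgue_affine[OF f(1) inj_f N(3), of c] by (simp add: card_eq us'_def comp_def)
  have bP: "bounded P" "P \<in> lmeasurable" "area P > 0"
    using polygon_region(10,11)[OF P] compact_imp_bounded lmeasurable_compact by blast+
  have A: "area P * t = A_INT P * 2 ^ (k - 1)"
    unfolding A_INT_def area_eq t_def by simp
  have "cover_density P (copies L us') \<le> ennreal (A_INT P * 2 ^ (k - 1))"
    using cover_density_le[OF bP(1,2) len] unfolding A .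
  moreover have "odd_compression_ratio P \<ge> inverse (A_INT P) * inverse (2 ^ (k - 1))"
  proof -
    have "inverse (A_INT P) * inverse (2 ^ (k - 1)) = 1 / t / area P"
      unfolding inverse_mult_distrib[symmetric] A[symmetric] by (simp add: divide_simps)
    also have "\<dots> \<le> odd_area P / area P"
      using odd_area_ge(2)[OF bP(1,2) len odd] bP(3) by (intro divide_right_mono) auto
    finally show ?thesis unfolding odd_compression_ratio_def .
  qed
  ultimately show ?thesis
    using odd_cover_copies[OF bP(1) odd] bounded_degree_copies[OF bP(1)] by blast
qed

end
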